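(* Let $s\in(0,1)$ and let $\Omega\subset\mathbb{R}^N$ be a bounded open set satisfying a $(\rho,\theta)$-Lipschitz cone condition for some $\rho\in(0,+\infty)$ and $\theta\in(0,\pi/2)$. Let $f\in L^2(\mathbb{R}^N)$ and let $u\in\mathcal{X}^s_0(\Omega)$ be the weak solution of $(-\Delta)^su=f$ in $\Omega$, $u=0$ in $\mathbb{R}^N\setminus\Omega$. Then $u\in B^{3s/2}_{2,\infty}(\mathbb{R}^N)$, and moreover $$\|u\|_{B^{3s/2}_{2,\infty}(\mathbb{R}^N)}\le C\,\|f\|^{1/2}_{H^{-s}(\mathbb{R}^N)}\|f\|^{1/2}_{L^2(\mathbb{R}^N)},$$ where the constant $C$ depends only on $N$, $s$, $\mathrm{diam}\,\Omega$, $\rho$ and $\theta$.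
   Context: Gagliardo seminorm: $\|v\|_s^2:=\iint_{\mathbb{R}^{2N}}\frac{|v(x)-v(y)|^2}{|x-y|^{N+2s}}\,dx\,dy$. For an open set $\Omega\subseteq\mathbb{R}^N$, $\mathcal{X}^s_0(\Omega):=\{v\in H^s(\mathbb{R}^N): v=0\text{ a.e. in }\mathbb{R}^N\setminus\Omega\}$. $H^{-s}(\mathbb{R}^N)$ is the dual of $H^s(\mathbb{R}^N)$ (normed by $(\|v\|^2_{L^2}+\|v\|_s^2)^{1/2}$); $f\in L^2(\mathbb{R}^N)$ is viewed as the functional $\langle f,\varphi\rangle=\int_{\mathbb{R}^N} f\varphi\,dx$. $(-\Delta)^{s/2}$ is the Fourier multiplier with symbol $|\xi|^s$. Weak solution of $(-\Delta)^su=f$ in $\Omega$, $u=0$ in $\mathbb{R}^N\setminus\Omega$: $u\in\mathcal{X}^s_0(\Omega)$ with $\int_{\mathbb{R}^N}(-\Delta)^{s/2}u\,(-\Delta)^{s/2}\varphi\,dx=\langle f,\varphi\rangle$ for all $\varphi\in\mathcal{X}^s_0(\Omega)$ (it exists and is unique for bounded $\Omega$). Besov space: with $u_h(x)=u(x+h)$, for $r\in(0,1]$, $B^r_{2,\infty}(\mathbb{R}^N)$ is the set of $u\in L^2(\mathbb{R}^N)$ with finite norm $\|u\|_{B^r_{2,\infty}}:=\|u\|_{L^2}+\sup_{h\ne0}|h|^{-r}\|u_{2h}-2u_h+u\|_{L^2}$; for $r>1$, $B^r_{2,\infty}(\mathbb{R}^N)$ is the set of $u\in L^2(\mathbb{R}^N)$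 whose distributional partial derivatives all lie in $B^{r-1}_{2,\infty}(\mathbb{R}^N)$, with norm $\|u\|_{L^2}+\sum_{i=1}^N\|\partial u/\partial x_i\|_{B^{r-1}_{2,\infty}}$. Lipschitz cone condition: for a unit vector $\mathbf n$, $\rho>0$ and $\theta\in(0,\pi/2)$ let $\mathcal{C}_{\rho,\theta}(\mathbf n):=\{\mathbf v\in\mathbb{R}^N:0<|\mathbf v|<\rho,\ \mathbf v\cdot\mathbf n>|\mathbf v|\cos\theta\}$. For an open set $\Omega$ and $x_0\in\mathbb{R}^N$ let $\mathcal{N}_{\rho,\theta}(x_0,\Omega)$ be the set of unit vectors $\mathbf n$ such that for every $\mathbf v\in\mathcal{C}_{\rho,\theta}(\mathbf n)$: (i) $y-\mathbf v\in\Omega$ for every $y\in B_{3\rho}(x_0)\cap\Omega$; (ii) $y+\mathbf v\in\mathbb{R}^N\setminus\Omega$ for every $y\in B_{3\rho}(x_0)\setminus\Omega$. $\Omega$ satisfies the (uniform) $(\rho,\theta)$-Lipschitz cone condition if $\mathcal{N}_{\rho,\theta}(x_0,\Omega)\ne\emptyset$ for all $x_0\in\mathbb{R}^N$. *)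

theory Defs
  imports "HOL-Analysis.Analysis"
begin

text \<open>
  Elements of function spaces are Borel functions rather than equivalence classes; every class of
  Lebesgue measurable functions has a Borel representative, and all notions below are invariant
  under changes on null sets.
\<close>

definition L2_space :: "(real^'n \<Rightarrow> 'b::{banach, second_countable_topology}) set" where
  "L2_space = {f \<in> borel_measurable lborel. integrable lborel (\<lambda>x. (norm (f x))\<^sup>2)}"

definition L2_norm :: "(real^'n \<Rightarrow> 'b::{banach, second_countable_topology}) \<Rightarrow> real" where
  "L2_norm f = sqrt (\<integral>x. (norm (f x))\<^sup>2 \<partial>lborel)"

definition L2_pairing :: "(real^'n \<Rightarrow> real) \<Rightarrow> (real^'n \<Rightarrow> real) \<Rightarrow> real" where
  "L2_pairing f g = (\<integral>x. f x * g x \<partial>lborel)"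


section \<open>Fractional Sobolev spaces\<close>

definition gagliardo_sq :: "real \<Rightarrow> (real^'n \<Rightarrow> real) \<Rightarrow> ennreal" where
  "gagliardo_sq s v =
     (\<integral>\<^sup>+p. ennreal ((v (fst p) - v (snd p))\<^sup>2 / norm (fst p - snd p) powr (real CARD('n) + 2 * s))
        \<partial>(lborel \<Otimes>\<^sub>M lborel))"

definition Hs_space :: "real \<Rightarrow> (real^'n \<Rightarrow> real) set" where
  "Hs_space s = {v \<in> L2_space. gagliardo_sq s v < \<infinity>}"

definition Hs_norm :: "real \<Rightarrow> (real^'n \<Rightarrow> real) \<Rightarrow> real" where
  "Hs_norm s v = sqrt ((L2_norm v)\<^sup>2 + enn2real (gagliardo_sq s v))"

text \<open>
  The norm in \<open>H\<^sup>-\<^sup>s\<close> of the functional represented by \<open>f \<in> L\<^sup>2\<close>. The set of values is then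
  bounded, by \<open>L2_norm f\<close>, so that the supremum is a genuine one.
\<close>

definition Hdual_norm :: "real \<Rightarrow> (real^'n \<Rightarrow> real) \<Rightarrow> real" where
  "Hdual_norm s f = (SUP \<phi>\<in>{\<phi> \<in> Hs_space s. Hs_norm s \<phi> \<le> 1}. \<bar>L2_pairing f \<phi>\<bar>)"

definition X0_space :: "real \<Rightarrow> (real^'n) set \<Rightarrow> (real^'n \<Rightarrow> real) set" where
  "X0_space s \<Omega> = {v \<in> Hs_space s. AE x in lborel. x \<notin> \<Omega> \<longrightarrow> v x = 0}"


section \<open>The fractional Laplacian\<close>

definition fourier_integral :: "(real^'n \<Rightarrow> complex) \<Rightarrow> real^'n \<Rightarrow> complex" where
  "fourier_integral f \<xi> = (\<integral>x. cis (- (\<xi> \<bullet> x)) * f x \<partial>lborel)"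

text \<open>
  The Fourier--Plancherel transform on \<open>L\<^sup>2\<close>, as a relation that determines \<open>F\<close> up to null sets:
  \<open>F\<close> is the \<open>L\<^sup>2\<close> limit of the Fourier integrals of the truncations of \<open>f\<close> to balls. The
  frequency variable is angular, which is what makes \<open>-\<Delta>\<close> the multiplier with symbol \<open>|\<xi>|\<^sup>2\<close>.
\<close>

definition has_fourier_transform :: "(real^'n \<Rightarrow> complex) \<Rightarrow> (real^'n \<Rightarrow> complex) \<Rightarrow> bool"
    (infix "has'_fourier'_transform" 50) where
  "f has_fourier_transform F \<longleftrightarrow>
     f \<in> L2_space \<and> F \<in> L2_space \<and>
     ((\<lambda>R. \<integral>\<^sup>+\<xi>. ennreal ((norm (F \<xi> - fourier_integral (\<lambda>x. indicator (ball 0 R) x * f x) \<xi>))\<^sup>2)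
        \<partial>lborel) \<longlongrightarrow> 0) at_top"

text \<open>
  \<open>has_half_laplacian s u w\<close>: the function \<open>w\<close> is \<open>(-\<Delta>)\<^sup>s\<^sup>/\<^sup>2 u\<close>, the image of \<open>u\<close> under the
  Fourier multiplier with symbol \<open>|\<xi>|\<^sup>s\<close>. For \<open>u \<in> H\<^sup>s\<close> such a \<open>w\<close> exists and is unique up to
  null sets; it is real-valued because the symbol is real and even.
\<close>

definition has_half_laplacian :: "real \<Rightarrow> (real^'n \<Rightarrow> real) \<Rightarrow> (real^'n \<Rightarrow> real) \<Rightarrow> bool" where
  "has_half_laplacian s u w \<longleftrightarrow>
     (\<exists>F. (\<lambda>x. complex_of_real (u x)) has_fourier_transform F \<and>
          (\<lambda>x. complex_of_real (w x)) has_fourier_transform (\<lambda>\<xi>. of_real (norm \<xi> powr s) * F \<xi>))"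

definition weak_solution :: "real \<Rightarrow> (real^'n) set \<Rightarrow> (real^'n \<Rightarrow> real) \<Rightarrow> (real^'n \<Rightarrow> real) \<Rightarrow> bool" where
  "weak_solution s \<Omega> f u \<longleftrightarrow>
     u \<in> X0_space s \<Omega> \<and>
     (\<exists>U. has_half_laplacian s u U \<and>
        (\<forall>\<phi>\<in>X0_space s \<Omega>. \<exists>\<Phi>. has_half_laplacian s \<phi> \<Phi> \<and> L2_pairing U \<Phi> = L2_pairing f \<phi>))"


section \<open>Distributional derivatives\<close>

definition partial_deriv :: "'n \<Rightarrow> (real^'n \<Rightarrow> real) \<Rightarrow> real^'n \<Rightarrow> real" where
  "partial_deriv i \<phi> x = frechet_derivative \<phi> (at x) (axis i 1)"

primrec C_k :: "nat \<Rightarrow> (real^'n \<Rightarrow> real) \<Rightarrow> bool" where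
  "C_k 0 \<phi> = continuous_on UNIV \<phi>"
| "C_k (Suc k) \<phi> = (\<phi> differentiable_on UNIV \<and> (\<forall>i. C_k k (partial_deriv i \<phi>)))"

definition test_function :: "(real^'n \<Rightarrow> real) \<Rightarrow> bool" where
  "test_function \<phi> \<longleftrightarrow> (\<forall>k. C_k k \<phi>) \<and> compact (closure {x. \<phi> x \<noteq> 0})"

definition locally_integrable :: "(real^'n \<Rightarrow> real) \<Rightarrow> bool" where
  "locally_integrable g \<longleftrightarrow> (\<forall>K. compact K \<longrightarrow> set_integrable lborel K g)"

definition has_weak_partial :: "'n \<Rightarrow> (real^'n \<Rightarrow> real) \<Rightarrow> (real^'n \<Rightarrow> real) \<Rightarrow> bool" where
  "has_weak_partial i u g \<longleftrightarrow>
     locally_integrable u \<and> locally_integrable g \<and>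
     (\<forall>\<phi>. test_function \<phi> \<longrightarrow> L2_pairing u (partial_deriv i \<phi>) = - L2_pairing g \<phi>)"

definition weak_partial :: "'n \<Rightarrow> (real^'n \<Rightarrow> real) \<Rightarrow> real^'n \<Rightarrow> real" where
  "weak_partial i u = (SOME g. has_weak_partial i u g)"


section \<open>Besov spaces\<close>

text \<open>
  Only orders \<open>r > 0\<close> are meaningful. The norms take extended values, so that the supremum over
  the increments may be infinite.
\<close>

definition second_difference :: "real^'n \<Rightarrow> (real^'n \<Rightarrow> real) \<Rightarrow> real^'n \<Rightarrow> real" where
  "second_difference h u x = u (x + 2 *\<^sub>R h) - 2 * u (x + h) + u x"

function besov_norm :: "real \<Rightarrow> (real^'n \<Rightarrow> real) \<Rightarrow> ennreal" where
  "besov_norm r u =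
     ennreal (L2_norm u) +
     (if r \<le> 1
      then SUP h\<in>-{0}. ennreal (norm h powr (-r) * L2_norm (second_difference h u))
      else \<Sum>i\<in>UNIV. besov_norm (r - 1) (weak_partial i u))"
  by pat_completeness auto
termination
  by (relation "Wellfounded.measure (\<lambda>(r, u). nat \<lceil>r\<rceil>)") auto

function besov_space :: "real \<Rightarrow> (real^'n \<Rightarrow> real) set" where
  "besov_space r =
     (if r \<le> 1
      then {u \<in> L2_space. besov_norm r u < \<infinity>}
      else {u \<in> L2_space. \<forall>i. \<exists>g\<in>besov_space (r - 1). has_weak_partial i u g})"
  by pat_completeness auto
termination
  by (relation "Wellfounded.measure (\<lambda>r. nat \<lceil>r\<rceil>)") auto

declare besov_norm.simps [simp del] besov_space.simps [simp del]


section \<open>The Lipschitz cone condition\<close>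

definition cone :: "real \<Rightarrow> real \<Rightarrow> real^'n \<Rightarrow> (real^'n) set" where
  "cone \<rho> \<theta> n = {v. 0 < norm v \<and> norm v < \<rho> \<and> v \<bullet> n > norm v * cos \<theta>}"

definition cone_directions :: "real \<Rightarrow> real \<Rightarrow> real^'n \<Rightarrow> (real^'n) set \<Rightarrow> (real^'n) set" where
  "cone_directions \<rho> \<theta> x\<^sub>0 \<Omega> =
     {n. norm n = 1 \<and>
         (\<forall>v\<in>cone \<rho> \<theta> n.
            (\<forall>y\<in>ball x\<^sub>0 (3 * \<rho>) \<inter> \<Omega>. y - v \<in> \<Omega>) \<and>
            (\<forall>y\<in>ball x\<^sub>0 (3 * \<rho>) - \<Omega>. y + v \<notin> \<Omega>))}"

definition lipschitz_cone_condition :: "real \<Rightarrow> real \<Rightarrow> (real^'n) set \<Rightarrow> bool" where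
  "lipschitz_cone_condition \<rho> \<theta> \<Omega> \<longleftrightarrow> (\<forall>x\<^sub>0. cone_directions \<rho> \<theta> x\<^sub>0 \<Omega> \<noteq> {})"

end

theory Submission
  imports Defs "HOL-Probability.Characteristic_Functions"
begin

text \<open>
  The method is Savare's. A weak solution \<open>u\<close> minimises the energy \<open>J v = [v]\<^sup>2 / 2 - \<kappa> \<langle>f, v\<rangle>\<close> over
  \<open>X0_space s \<Omega>\<close>, where \<open>[v]\<close> is the Gagliardo seminorm, and \<open>[v - u]\<^sup>2 / 2 = J v - J u\<close>. The competitor
  \<open>v = \<phi> u(\<cdot> + h) + (1 - \<phi>) u\<close> is admissible when \<open>\<phi>\<close> is supported near \<open>x\<^sub>0\<close> and \<open>h\<close> lies in the
  cone at \<open>x\<^sub>0\<close>; by convexity \<open>J v - J u\<close> is \<open>O(|h|\<^sup>s)\<close>. Since also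
  \<open>\<parallel>w(\<cdot> + h) - w\<parallel> = O(|h|\<^sup>s) [w]\<close> in \<open>L\<^sup>2\<close>, the second differences of \<open>u\<close> are \<open>O(|h|\<^sup>3\<^sup>s\<^sup>/\<^sup>2)\<close>.
  Every small increment is a difference of two comparable elements of the cone, and finitely many
  cut-offs cover \<open>\<Omega>\<close>. The Fourier transform enters only through Plancherel's identity, which gives
  \<open>[v]\<^sup>2 = \<kappa> \<parallel>(-\<Delta>)\<^sup>s\<^sup>/\<^sup>2 v\<parallel>\<^sup>2\<close>. For \<open>3s/2 > 1\<close> the dyadic difference quotients
  converge in \<open>L\<^sup>2\<close>, and their limits are the weak derivatives.
\<close>

text \<open>The exponent \<open>3 * s / 2\<close> is \<open>s + s / 2\<close>: one more difference
  in \<open>L2\<close> gains \<open>s\<close>, and the energy gap bounds the square of a seminorm,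
  so its order \<open>|h|^s\<close> counts only half. The gap is small solely because the leading
  term \<open>[u]^2\<close> cancels, so the energy of the competitor must be bounded with leading
  coefficient \<open>1 + O(|h|^s)\<close>; the convex combination and the cut-off error are
  estimated sharply for this reason, while the other estimates waste constants freely. The geometric
  mean of the two norms of \<open>f\<close> comes from the same gap: \<open>[u]\<close> is
  controlled by the dual norm, but testing \<open>f\<close> against the increment of
  \<open>u\<close> costs its \<open>L2\<close> norm. Translates of \<open>u\<close> are known to
  vanish outside \<open>\<Omega>\<close> near \<open>x0\<close> only for increments in the cone,
  which is one-sided; this forces the detour over differences of two cone elements. Since the
  constant may see \<open>\<Omega>\<close> only through its diameter, each constant is a function of
  the parameters, and the covering is chosen for a ball instead of \<open>\<Omega>\<close>.\<close>

section \<open>Changes of variables for the Lebesgue integral\<close>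

lemma nn_integral_shift:
  fixes f :: "'a::euclidean_space \<Rightarrow> ennreal"
  assumes [measurable]: "f \<in> borel_measurable borel"
  shows "(\<integral>\<^sup>+x. f (x + h) \<partial>lborel) = (\<integral>\<^sup>+x. f x \<partial>lborel)"
proof -
  have "(\<integral>\<^sup>+x. f x \<partial>lborel) = (\<integral>\<^sup>+x. f x \<partial>distr lborel borel ((+) h))"
    by (simp only: lborel_distr_plus)
  also have "\<dots> = (\<integral>\<^sup>+x. f (h + x) \<partial>lborel)"
    by (rule nn_integral_distr) auto
  finally show ?thesis by (simp add: add.commute)
qed

lemma nn_integral_scale:
  fixes f :: "'a::euclidean_space \<Rightarrow> ennreal"
  assumes [measurable]: "f \<in> borel_measurable borel" and "c \<noteq> 0"
  shows "(\<integral>\<^sup>+x. f x \<partial>lborel) = ennreal (\<bar>c\<bar> ^ DIM('a)) * (\<integral>\<^sup>+x. f (c *\<^sub>R x) \<partial>lborel)"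
  by (subst lborel_affine[OF assms(2), of 0])
    (simp add: nn_integral_density nn_integral_distr nn_integral_cmult)

lemma nn_integral_reflect:
  fixes f :: "'a::euclidean_space \<Rightarrow> ennreal"
  assumes "f \<in> borel_measurable borel"
  shows "(\<integral>\<^sup>+x. f (c - x) \<partial>lborel) = (\<integral>\<^sup>+x. f x \<partial>lborel)"
  using nn_integral_scale[OF assms, of "-1"] nn_integral_shift[of "\<lambda>x. f (- x)" "- c"] assms by simp

text \<open>
  Both sides, multiplied by the volume of the unit ball \<open>B\<close>, equal the integral of
  \<open>f x * indicator B (x - T y)\<close> over all pairs \<open>(x, y)\<close>.
\<close>

lemma nn_integral_orthogonal:
  fixes f :: "'a::euclidean_space \<Rightarrow> ennreal" and T :: "'a \<Rightarrow> 'a"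
  assumes [measurable]: "f \<in> borel_measurable borel" and T: "orthogonal_transformation T"
  shows "(\<integral>\<^sup>+x. f (T x) \<partial>lborel) = (\<integral>\<^sup>+x. f x \<partial>lborel)"
proof -
  let ?B = "indicator (ball 0 1) :: 'a \<Rightarrow> ennreal"
  let ?V = "emeasure lborel (ball (0::'a) 1)"
  have lin: "linear T" using T by (simp add: orthogonal_transformation_linear)
  have [measurable]: "T \<in> borel \<rightarrow>\<^sub>M borel"
    using lin by (intro borel_measurable_continuous_onI) (simp add: linear_continuous_on linear_linear)
  have surj: "\<exists>x'. x = T x'" for x
    using orthogonal_transformation_surj[OF T] by (metis surjD)
  have add: "T a + T b = T (a + b)" "T a - T b = T (a - b)" for a b
    using lin by (simp_all add: linear_add linear_diff)
  have BT: "?B (T x) = ?B x" for x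
    using T by (simp add: indicator_def orthogonal_transformation_norm)
  have B [measurable]: "?B \<in> borel_measurable borel" by (intro borel_measurable_indicator) auto
  have V: "(\<integral>\<^sup>+y. ?B (x - T y) \<partial>lborel) = ?V" for x
  proof -
    obtain x' where "x = T x'" using surj by blast
    then have "(\<integral>\<^sup>+y. ?B (x - T y) \<partial>lborel) = (\<integral>\<^sup>+y. ?B (x' - y) \<partial>lborel)"
      by (simp add: add BT)
    also have "\<dots> = ?V" using nn_integral_reflect[OF B, of x'] by simp
    finally show ?thesis .
  qed
  have F: "(\<integral>\<^sup>+y. f (x + T y) \<partial>lborel) = (\<integral>\<^sup>+y. f (T y) \<partial>lborel)" for x
  proof -
    obtain x' where "x = T x'" using surj by blast
    then have "(\<integral>\<^sup>+y. f (x + T y) \<partial>lborel) = (\<integral>\<^sup>+y. f (T (y + x')) \<partial>lborel)"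
      by (simp add: add add.commute)
    also have "\<dots> = (\<integral>\<^sup>+y. f (T y) \<partial>lborel)" by (rule nn_integral_shift[of "\<lambda>y. f (T y)"]) auto
    finally show ?thesis .
  qed
  have "?V * (\<integral>\<^sup>+x. f x \<partial>lborel) = (\<integral>\<^sup>+x. \<integral>\<^sup>+y. f x * ?B (x - T y) \<partial>lborel \<partial>lborel)"
    by (simp add: nn_integral_cmult nn_integral_multc V mult.commute)
  also have "\<dots> = (\<integral>\<^sup>+y. \<integral>\<^sup>+x. f x * ?B (x - T y) \<partial>lborel \<partial>lborel)"
    by (rule lborel_pair.Fubini'[symmetric]) measurable
  also have "\<dots> = (\<integral>\<^sup>+y. \<integral>\<^sup>+x. f (x + T y) * ?B x \<partial>lborel \<partial>lborel)"
  proof (rule nn_integral_cong)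
    fix y
    show "(\<integral>\<^sup>+x. f x * ?B (x - T y) \<partial>lborel) = (\<integral>\<^sup>+x. f (x + T y) * ?B x \<partial>lborel)"
      by (subst nn_integral_shift[where h = "T y", symmetric]) auto
  qed
  also have "\<dots> = (\<integral>\<^sup>+x. \<integral>\<^sup>+y. f (x + T y) * ?B x \<partial>lborel \<partial>lborel)"
    by (rule lborel_pair.Fubini') measurable
  also have "\<dots> = ?V * (\<integral>\<^sup>+y. f (T y) \<partial>lborel)"
    by (simp add: nn_integral_cmult nn_integral_multc F mult.commute)
  finally have eq: "?V * (\<integral>\<^sup>+x. f x \<partial>lborel) = ?V * (\<integral>\<^sup>+y. f (T y) \<partial>lborel)" .
  have "0 < unit_ball_vol (real DIM('a))" by (rule unit_ball_vol_pos) simp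
  then have "unit_ball_vol (real DIM('a)) \<noteq> 0" by (rule less_imp_neq[symmetric])
  then have "?V \<noteq> 0" "?V \<noteq> \<infinity>" by (simp_all add: emeasure_ball)
  with eq show ?thesis by (simp add: ennreal_mult_cancel_left)
qed

section \<open>Squared norms and first differences\<close>

text \<open>Extended-valued, so that estimates can be chained before square integrability is known;
  membership in \<open>L2_space\<close> is then finiteness of the value.\<close>

definition sqn :: "(real^'n \<Rightarrow> real) \<Rightarrow> ennreal" where
  "sqn v = (\<integral>\<^sup>+x. ennreal ((v x)\<^sup>2) \<partial>lborel)"

definition fdiff :: "real^'n \<Rightarrow> (real^'n \<Rightarrow> real) \<Rightarrow> real^'n \<Rightarrow> real" where
  "fdiff h v x = v (x + h) - v x"

lemma fdiff_measurable [measurable]: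
  assumes [measurable]: "v \<in> borel_measurable borel"
  shows "fdiff h v \<in> borel_measurable borel"
  unfolding fdiff_def[abs_def] by measurable

lemma fdiff_measurable_comp [measurable (raw)]:
  assumes [measurable]: "v \<in> borel_measurable borel" "f \<in> M \<rightarrow>\<^sub>M borel" "g \<in> M \<rightarrow>\<^sub>M borel"
  shows "(\<lambda>x. fdiff (f x) v (g x)) \<in> borel_measurable M"
  unfolding fdiff_def[abs_def] by measurable

lemma second_difference_eq: "second_difference h u = fdiff h (fdiff h u)"
  by (auto simp: second_difference_def fdiff_def fun_eq_iff scaleR_2 add.assoc)

lemma L2_spaceD: "v \<in> L2_space \<Longrightarrow> v \<in> borel_measurable borel"
  by (simp add: L2_space_def)

lemma L2_space_iff: "v \<in> L2_space \<longleftrightarrow> v \<in> borel_measurable borel \<and> sqn v < \<infinity>"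
  unfolding L2_space_def sqn_def by (auto simp: integrable_iff_bounded)

lemma sqn_eq_L2_norm:
  assumes "v \<in> L2_space" shows "sqn v = ennreal ((L2_norm v)\<^sup>2)"
  using assms unfolding L2_space_def sqn_def L2_norm_def
  by (simp add: nn_integral_eq_integral)

lemma L2_norm_nonneg [simp]: "0 \<le> L2_norm v"
  by (simp add: L2_norm_def)

lemma L2_norm_le:
  assumes "v \<in> borel_measurable borel" "sqn v \<le> ennreal (a\<^sup>2)" "0 \<le> a"
  shows "L2_norm v \<le> a"
proof -
  have "v \<in> L2_space" using assms by (auto simp: L2_space_iff intro: le_less_trans)
  then show ?thesis using assms sqn_eq_L2_norm[of v] by (simp add: ennreal_le_iff power2_le_iff_abs_le)
qed

lemma sqn_mono_AE: "AE x in lborel. \<bar>v x\<bar> \<le> \<bar>w x\<bar> \<Longrightarrow> sqn v \<le> sqn w"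
  unfolding sqn_def by (intro nn_integral_mono_AE) (auto simp: abs_le_square_iff)

lemma sqn_mono: "(\<And>x. \<bar>v x\<bar> \<le> \<bar>w x\<bar>) \<Longrightarrow> sqn v \<le> sqn w"
  by (rule sqn_mono_AE) auto

lemma sqn_shift [simp]:
  "v \<in> borel_measurable borel \<Longrightarrow> sqn (\<lambda>x. v (x + h)) = sqn v"
  unfolding sqn_def by (rule nn_integral_shift[of "\<lambda>x. ennreal ((v x)\<^sup>2)"]) auto

lemma sqn_minus: "sqn (\<lambda>x. - v x) = sqn v"
  by (simp add: sqn_def)

lemma sqn_cmult:
  "v \<in> borel_measurable borel \<Longrightarrow> sqn (\<lambda>x. c * v x) = ennreal (c\<^sup>2) * sqn v"
  unfolding sqn_def by (simp add: power_mult_distrib ennreal_mult' nn_integral_cmult)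

lemma square_add_le: "(a + b)\<^sup>2 \<le> 2 * a\<^sup>2 + 2 * (b::real)\<^sup>2"
  using sum_squares_bound[of a b] by (simp add: power2_sum)

text \<open>A substitute for Minkowski's inequality that stays with squares in
  \<open>ennreal\<close>; the factor \<open>2\<close> is harmless wherever only the order in
  \<open>|h|\<close> counts. Where the leading constant must stay near \<open>1\<close>, a version
  with weights \<open>1 + d\<close> and \<open>1 + 1 / d\<close> takes its place.\<close>

lemma sqn_le_add:
  assumes [measurable]: "v \<in> borel_measurable borel" "w \<in> borel_measurable borel"
    and le: "\<And>x. \<bar>f x\<bar> \<le> \<bar>v x + w x\<bar>"
  shows "sqn f \<le> 2 * sqn v + 2 * sqn w"
proof -
  have "sqn f \<le> (\<integral>\<^sup>+x. 2 * ennreal ((v x)\<^sup>2) + 2 * ennreal ((w x)\<^sup>2) \<partial>lborel)"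
    unfolding sqn_def
  proof (rule nn_integral_mono)
    fix x
    have "(f x)\<^sup>2 \<le> (v x + w x)\<^sup>2" using le[of x] by (simp add: abs_le_square_iff)
    also have "\<dots> \<le> 2 * (v x)\<^sup>2 + 2 * (w x)\<^sup>2" by (rule square_add_le)
    finally have "ennreal ((f x)\<^sup>2) \<le> ennreal (2 * (v x)\<^sup>2 + 2 * (w x)\<^sup>2)" by (rule ennreal_leI)
    then show "ennreal ((f x)\<^sup>2) \<le> 2 * ennreal ((v x)\<^sup>2) + 2 * ennreal ((w x)\<^sup>2)"
      by (simp add: ennreal_mult')
  qed
  also have "\<dots> = 2 * sqn v + 2 * sqn w"
    unfolding sqn_def by (simp add: nn_integral_add nn_integral_cmult)
  finally show ?thesis .
qed

lemma sqn_fdiff_le: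
  assumes "v \<in> borel_measurable borel" shows "sqn (fdiff h v) \<le> 4 * sqn v"
proof -
  have "sqn (fdiff h v) \<le> 2 * sqn (\<lambda>x. v (x + h)) + 2 * sqn (\<lambda>x. - v x)"
    using assms by (intro sqn_le_add) (auto simp: fdiff_def)
  also have "\<dots> = 4 * sqn v" using assms by (simp add: sqn_minus flip: distrib_right)
  finally show ?thesis .
qed

lemma AE_shift:
  fixes P :: "'a::euclidean_space \<Rightarrow> bool"
  assumes "AE x in lborel. P x" shows "AE x in lborel. P (x + h)"
proof -
  obtain N where N: "{x. \<not> P x} \<subseteq> N" "N \<in> sets borel" "emeasure lborel N = 0"
    using assms by (auto elim!: AE_E)
  have "(\<integral>\<^sup>+x. indicator N (x + h) \<partial>lborel) = (0::ennreal)"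
    using N by (subst nn_integral_shift[of "indicator N"]) auto
  then have "AE x in lborel. x + h \<notin> N"
    using N(2) by (subst (asm) nn_integral_0_iff_AE) (auto simp: indicator_def)
  then show ?thesis by (rule AE_mp) (use N(1) in auto)
qed

lemma fdiff_cong_AE:
  assumes "AE x in lborel. v x = w x" shows "AE x in lborel. fdiff h v x = fdiff h w x"
  using assms AE_shift[OF assms, of h] by eventually_elim (simp add: fdiff_def)

section \<open>The Gagliardo seminorm as an integral over increments\<close>

text \<open>At \<open>z = 0\<close> the value is \<open>0\<close>, since
  \<open>0 powr p = 0\<close>; the diagonal contributes nothing, as in the quotient that defines the
  seminorm.\<close>

definition gker :: "real \<Rightarrow> real^'n \<Rightarrow> real" where
  "gker s z = norm z powr - (real CARD('n) + 2 * s)"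

lemma gker_nonneg [simp]: "0 \<le> gker s z" by (simp add: gker_def)
lemma gker_measurable [measurable]: "gker s \<in> borel_measurable borel"
  unfolding gker_def[abs_def] by measurable

lemma gagliardo_sq_kernel:
  "gagliardo_sq s v = (\<integral>\<^sup>+p. ennreal ((v (fst p) - v (snd p))\<^sup>2 * gker s (fst p - snd p)) \<partial>(lborel \<Otimes>\<^sub>M lborel))"
  unfolding gagliardo_sq_def gker_def powr_minus divide_inverse ..

lemma nn_integral_pair_diff:
  fixes f :: "real^'n \<Rightarrow> real^'n \<Rightarrow> ennreal"
  assumes [measurable]: "(\<lambda>p. f (fst p) (snd p)) \<in> borel_measurable (lborel \<Otimes>\<^sub>M lborel)"
  shows "(\<integral>\<^sup>+p. f (fst p) (snd p) \<partial>(lborel \<Otimes>\<^sub>M lborel)) = (\<integral>\<^sup>+z. \<integral>\<^sup>+x. f (x + z) x \<partial>lborel \<partial>lborel)"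
proof -
  have m: "(\<lambda>x. f x y) \<in> borel_measurable borel" for y
    using measurable_compose[OF measurable_Pair1'[of y lborel lborel] measurable_pair_swap[OF assms]] by simp
  have [measurable]: "(\<lambda>p. f (g p) (h p)) \<in> borel_measurable M" if [measurable]: "g \<in> M \<rightarrow>\<^sub>M borel" "h \<in> M \<rightarrow>\<^sub>M borel" for g h M
    using measurable_compose[OF _ assms, of "\<lambda>p. (g p, h p)" M] by simp
  have "(\<integral>\<^sup>+p. f (fst p) (snd p) \<partial>(lborel \<Otimes>\<^sub>M lborel)) = (\<integral>\<^sup>+y. \<integral>\<^sup>+x. f x y \<partial>lborel \<partial>lborel)"
    by (subst lborel_pair.nn_integral_snd[symmetric]) auto
  also have "\<dots> = (\<integral>\<^sup>+y. \<integral>\<^sup>+z. f (y + z) y \<partial>lborel \<partial>lborel)"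
    using nn_integral_shift[OF m] by (simp add: add.commute)
  also have "\<dots> = (\<integral>\<^sup>+z. \<integral>\<^sup>+x. f (x + z) x \<partial>lborel \<partial>lborel)"
    by (rule lborel_pair.Fubini'[of "\<lambda>y z. f (y + z) y", symmetric]) measurable
  finally show ?thesis .
qed

text \<open>The form in which the seminorm is used from here on: any bound on
  \<open>sqn (fdiff z v)\<close> for a fixed increment \<open>z\<close> can be integrated against
  the kernel.\<close>

lemma gagliardo_sq_fdiff:
  assumes [measurable]: "v \<in> borel_measurable borel"
  shows "gagliardo_sq s v = (\<integral>\<^sup>+z. ennreal (gker s z) * sqn (fdiff z v) \<partial>lborel)"
proof -
  have "gagliardo_sq s v = (\<integral>\<^sup>+z. \<integral>\<^sup>+x. ennreal ((v (x + z) - v x)\<^sup>2 * gker s (x + z - x)) \<partial>lborel \<partial>lborel)"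
    unfolding gagliardo_sq_kernel by (rule nn_integral_pair_diff[of "\<lambda>x y. ennreal ((v x - v y)\<^sup>2 * gker s (x - y))"]) measurable
  also have "\<dots> = (\<integral>\<^sup>+z. ennreal (gker s z) * sqn (fdiff z v) \<partial>lborel)"
    unfolding sqn_def fdiff_def
    by (intro nn_integral_cong, subst nn_integral_cmult[symmetric])
       (auto intro!: nn_integral_cong simp: ennreal_mult' mult.commute)
  finally show ?thesis .
qed

lemma sqn_fdiff_measurable [measurable]:
  assumes [measurable]: "v \<in> borel_measurable borel"
  shows "(\<lambda>z. sqn (fdiff z v)) \<in> borel_measurable borel"
  unfolding sqn_def by measurable

lemma lborel_integral_shift:
  fixes f :: "'a::euclidean_space \<Rightarrow> 'b::{banach, second_countable_topology}"
  assumes "integrable lborel f"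
  shows "integrable lborel (\<lambda>x. f (x + h))" and "(\<integral>x. f (x + h) \<partial>lborel) = (\<integral>x. f x \<partial>lborel)"
proof -
  have [measurable]: "f \<in> borel_measurable borel" using assms by auto
  have i: "integrable (distr lborel borel ((+) h)) f" using assms by (simp only: lborel_distr_plus)
  then show "integrable lborel (\<lambda>x. f (x + h))"
    by (subst (asm) integrable_distr_eq) (auto simp: add.commute)
  have "(\<integral>x. f x \<partial>lborel) = (\<integral>x. f x \<partial>distr lborel borel ((+) h))"
    by (simp only: lborel_distr_plus)
  also have "\<dots> = (\<integral>x. f (h + x) \<partial>lborel)" by (rule integral_distr) auto
  finally show "(\<integral>x. f (x + h) \<partial>lborel) = (\<integral>x. f x \<partial>lborel)" by (simp add: add.commute)
qed

lemma lborel_integral_scale: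
  fixes f :: "'a::euclidean_space \<Rightarrow> 'b::{banach, second_countable_topology}"
  assumes [measurable]: "f \<in> borel_measurable borel" and c: "c \<noteq> 0"
  shows "(\<integral>x. f x \<partial>lborel) = (\<bar>c\<bar> ^ DIM('a)) *\<^sub>R (\<integral>x. f (c *\<^sub>R x) \<partial>lborel)"
    and "integrable lborel f \<Longrightarrow> integrable lborel (\<lambda>x. f (c *\<^sub>R x))"
proof -
  show "(\<integral>x. f x \<partial>lborel) = (\<bar>c\<bar> ^ DIM('a)) *\<^sub>R (\<integral>x. f (c *\<^sub>R x) \<partial>lborel)"
    by (subst lborel_affine[OF c, of 0]) (simp add: integral_density integral_distr)
  assume "integrable lborel f"
  then have "integrable lborel (\<lambda>x. \<bar>c\<bar> ^ DIM('a) *\<^sub>R f (c *\<^sub>R x))"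
    by (subst (asm) lborel_affine[OF c, of 0]) (simp add: integrable_density integrable_distr_eq)
  then have "integrable lborel (\<lambda>x. (1 / \<bar>c\<bar> ^ DIM('a)) *\<^sub>R (\<bar>c\<bar> ^ DIM('a) *\<^sub>R f (c *\<^sub>R x)))"
    by (rule integrable_scaleR_right)
  then show "integrable lborel (\<lambda>x. f (c *\<^sub>R x))" using c by simp
qed

section \<open>The Gaussian\<close>

definition gauss :: "real^'n \<Rightarrow> real" where
  "gauss x = exp (- (norm x)\<^sup>2 / 2)"

lemma cis_measurable [measurable]: "cis \<in> borel_measurable borel"
  by (intro borel_measurable_continuous_onI continuous_intros)

text \<open>Up to the factor \<open>sqrt (2 * pi)\<close> this is the characteristic function of the
  standard normal distribution.\<close>

lemma gauss_1d:
  fixes \<tau> :: real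
  shows "integrable lborel (\<lambda>y::real. cis (\<tau> * y) * of_real (exp (- (y\<^sup>2 / 2))))"
    and "(\<integral>y. cis (\<tau> * y) * of_real (exp (- (y\<^sup>2 / 2))) \<partial>lborel) = of_real (sqrt (2 * pi) * exp (- \<tau>\<^sup>2 / 2))"
proof -
  have e: "exp (- (y\<^sup>2 / 2)) = sqrt (2 * pi) * std_normal_density y" for y
    by (simp add: std_normal_density_def)
  have "integrable lborel (\<lambda>y::real. exp (- (y\<^sup>2 / 2)))"
    unfolding e by (intro integrable_mult_right integrable_normal_density) simp
  then show "integrable lborel (\<lambda>y::real. cis (\<tau> * y) * of_real (exp (- (y\<^sup>2 / 2))))"
    by (rule Bochner_Integration.integrable_bound) (auto simp: norm_mult)
  have "char std_normal_distribution \<tau> = (\<integral>y. std_normal_density y *\<^sub>R cis (\<tau> * y) \<partial>lborel)"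
    unfolding char_def by (subst integral_density) (auto simp: cis_conv_exp)
  then have c: "(\<integral>y. std_normal_density y *\<^sub>R cis (\<tau> * y) \<partial>lborel) = of_real (exp (- \<tau>\<^sup>2 / 2))"
    by (simp add: char_std_normal_distribution)
  have "(\<integral>y. cis (\<tau> * y) * of_real (exp (- (y\<^sup>2 / 2))) \<partial>lborel)
      = (\<integral>y. of_real (sqrt (2 * pi)) * (std_normal_density y *\<^sub>R cis (\<tau> * y)) \<partial>lborel)"
    unfolding e by (intro Bochner_Integration.integral_cong) (auto simp: scaleR_conv_of_real)
  also have "\<dots> = of_real (sqrt (2 * pi)) * (\<integral>y. std_normal_density y *\<^sub>R cis (\<tau> * y) \<partial>lborel)"
    by (rule integral_mult_right_zero)
  finally show "(\<integral>y. cis (\<tau> * y) * of_real (exp (- (y\<^sup>2 / 2))) \<partial>lborel) = of_real (sqrt (2 * pi) * exp (- \<tau>\<^sup>2 / 2))"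
    by (simp add: c)
qed

lemma gauss_measurable [measurable]: "gauss \<in> borel_measurable borel"
  unfolding gauss_def[abs_def] by measurable

lemma cis_sum: "finite I \<Longrightarrow> cis (\<Sum>i\<in>I. f i) = (\<Prod>i\<in>I. cis (f i))"
  by (induction I rule: finite_induct) (simp_all flip: cis_mult)

text \<open>Gaussian and character both factor over the coordinates, and \<open>lborel\<close> is
  the image of a product of copies of the line, so the one-dimensional integral suffices.\<close>

lemma gauss_fourier:
  fixes t :: "real^'n"
  shows "integrable lborel (\<lambda>x::real^'n. cis (t \<bullet> x) * of_real (gauss x))" (is ?I)
    and "(\<integral>x. cis (t \<bullet> x) * of_real (gauss x) \<partial>lborel) = of_real (sqrt (2 * pi) ^ CARD('n) * gauss t)" (is ?E)
proof -
  let ?B = "Basis :: (real^'n) set"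
  interpret product_sigma_finite "\<lambda>_::real^'n. lborel :: real measure" by standard
  let ?f = "\<lambda>x::real^'n. cis (t \<bullet> x) * of_real (gauss x)"
  let ?T = "\<lambda>y. \<Sum>b\<in>?B. y b *\<^sub>R b"
  have norm2: "(norm x)\<^sup>2 = (\<Sum>b\<in>?B. (x \<bullet> b)\<^sup>2)" for x :: "real^'n"
    by (subst power2_norm_eq_inner, subst euclidean_inner) (simp add: power2_eq_square)
  have g: "gauss x = (\<Prod>b\<in>?B. exp (- (x \<bullet> b)\<^sup>2 / 2))" for x :: "real^'n"
    by (simp add: gauss_def norm2 sum_negf sum_divide_distrib flip: exp_sum)
  have f: "?f (?T y) = (\<Prod>b\<in>?B. cis ((t \<bullet> b) * y b) * of_real (exp (- ((y b)\<^sup>2 / 2))))" for y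
  proof -
    have "t \<bullet> ?T y = (\<Sum>b\<in>?B. (t \<bullet> b) * y b)"
      by (simp add: inner_sum_right mult.commute)
    moreover have "gauss (?T y) = (\<Prod>b\<in>?B. exp (- ((y b)\<^sup>2 / 2)))"
      unfolding g by (intro prod.cong) (auto simp: inner_sum_left inner_Basis if_distrib cong: if_cong)
    ultimately show ?thesis
      by (simp add: cis_sum prod.distrib)
  qed
  have T [measurable]: "?T \<in> (\<Pi>\<^sub>M b\<in>?B. lborel) \<rightarrow>\<^sub>M borel" by measurable
  have m [measurable]: "?f \<in> borel_measurable borel" by measurable
  have "integrable (\<Pi>\<^sub>M b\<in>?B. lborel) (\<lambda>y. ?f (?T y))"
    unfolding f by (intro product_integrable_prod gauss_1d finite_Basis)
  then show ?I
    by (subst lborel_eq, subst integrable_distr_eq) auto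
  have "(\<integral>x. ?f x \<partial>lborel) = (\<integral>y. ?f (?T y) \<partial>(\<Pi>\<^sub>M b\<in>?B. lborel))"
    by (subst lborel_eq, subst integral_distr) auto
  also have "\<dots> = (\<Prod>b\<in>?B. of_real (sqrt (2 * pi) * exp (- (t \<bullet> b)\<^sup>2 / 2)))"
    unfolding f by (subst product_integral_prod) (simp_all only: gauss_1d finite_Basis)
  also have "\<dots> = of_real (sqrt (2 * pi) ^ CARD('n) * gauss t)"
    by (simp add: g prod.distrib)
  finally show ?E .
qed

lemma gauss_integrable: "integrable lborel (gauss :: real^'n \<Rightarrow> real)"
    and gauss_integral: "integral\<^sup>L lborel (gauss :: real^'n \<Rightarrow> real) = sqrt (2 * pi) ^ CARD('n)"
proof -
  have i: "integrable lborel (\<lambda>x::real^'n. complex_of_real (gauss x))"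
    using gauss_fourier(1)[of "0::real^'n"] by simp
  then show "integrable lborel (gauss :: real^'n \<Rightarrow> real)"
    by (simp only: complex_of_real_integrable_eq)
  have "complex_of_real (integral\<^sup>L lborel (gauss :: real^'n \<Rightarrow> real)) = of_real (sqrt (2 * pi) ^ CARD('n))"
    using gauss_fourier(2)[of "0::real^'n"] by (simp add: gauss_def flip: integral_complex_of_real)
  then show "integral\<^sup>L lborel (gauss :: real^'n \<Rightarrow> real) = sqrt (2 * pi) ^ CARD('n)"
    by (simp only: of_real_eq_iff)
qed

lemma gauss_fourier_scaled:
  fixes z :: "real^'n"
  assumes "0 < e"
  shows "integrable lborel (\<lambda>\<xi>::real^'n. gauss (e *\<^sub>R \<xi>))"
    and "(\<integral>\<xi>. cis (\<xi> \<bullet> z) * of_real (gauss (e *\<^sub>R \<xi>)) \<partial>lborel)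
      = of_real (sqrt (2 * pi) ^ CARD('n) * (1 / e) ^ CARD('n) * gauss ((1 / e) *\<^sub>R z))"
proof -
  show "integrable lborel (\<lambda>\<xi>::real^'n. gauss (e *\<^sub>R \<xi>))"
    using assms gauss_integrable by (intro lborel_integral_scale(2)) auto
  have "(\<integral>\<xi>. cis (\<xi> \<bullet> z) * of_real (gauss (e *\<^sub>R \<xi>)) \<partial>lborel)
      = ((1 / e) ^ CARD('n)) *\<^sub>R (\<integral>\<xi>. cis (((1 / e) *\<^sub>R z) \<bullet> \<xi>) * of_real (gauss \<xi>) \<partial>lborel)"
    using assms by (subst lborel_integral_scale(1)[where c = "1 / e"]) (auto simp: inner_commute)
  then show "(\<integral>\<xi>. cis (\<xi> \<bullet> z) * of_real (gauss (e *\<^sub>R \<xi>)) \<partial>lborel)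
      = of_real (sqrt (2 * pi) ^ CARD('n) * (1 / e) ^ CARD('n) * gauss ((1 / e) *\<^sub>R z))"
    unfolding gauss_fourier by (simp add: scaleR_conv_of_real)
qed

section \<open>Continuity of translations\<close>

text \<open>Translation is an isometry of \<open>L1\<close>, so the translation errors of
  \<open>f\<close> and of an approximant \<open>g\<close> differ by at most twice their
  \<open>L1\<close> distance.\<close>

lemma L1_shift_tendsto_approx:
  fixes f :: "real^'n \<Rightarrow> real"
  assumes f: "integrable lborel f"
    and approx: "\<And>e. 0 < e \<Longrightarrow> \<exists>g. integrable lborel g \<and> (\<integral>x. \<bar>f x - g x\<bar> \<partial>lborel) < e \<and>
      (\<lambda>n. \<integral>x. \<bar>g (x + h n) - g x\<bar> \<partial>lborel) \<longlonglongrightarrow> 0"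
  shows "(\<lambda>n. \<integral>x. \<bar>f (x + h n) - f x\<bar> \<partial>lborel) \<longlonglongrightarrow> 0"
proof (rule LIMSEQ_I)
  fix r :: real assume "0 < r"
  then obtain g where g: "integrable lborel g" and fg: "(\<integral>x. \<bar>f x - g x\<bar> \<partial>lborel) < r / 4"
    and lim: "(\<lambda>n. \<integral>x. \<bar>g (x + h n) - g x\<bar> \<partial>lborel) \<longlonglongrightarrow> 0"
    using approx[of "r / 4"] by auto
  obtain N where N: "\<bar>\<integral>x. \<bar>g (x + h n) - g x\<bar> \<partial>lborel\<bar> < r / 2" if "n \<ge> N" for n
    using LIMSEQ_D[OF lim, of "r / 2"] \<open>0 < r\<close> by auto
  have "(\<integral>x. \<bar>f (x + h n) - f x\<bar> \<partial>lborel) < r" if n: "n \<ge> N" for n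
  proof -
    note i = f g lborel_integral_shift(1)[OF f] lborel_integral_shift(1)[OF g]
    have d: "integrable lborel (\<lambda>x. \<bar>f x - g x\<bar>)" using i by auto
    have ds: "integrable lborel (\<lambda>x. \<bar>f (x + h n) - g (x + h n)\<bar>)" using i by auto
    have "(\<integral>x. \<bar>f (x + h n) - f x\<bar> \<partial>lborel)
        \<le> (\<integral>x. \<bar>f (x + h n) - g (x + h n)\<bar> + \<bar>f x - g x\<bar> + \<bar>g (x + h n) - g x\<bar> \<partial>lborel)"
      using i d ds by (intro integral_mono) auto
    also have "\<dots> = (\<integral>x. \<bar>f (x + h n) - g (x + h n)\<bar> \<partial>lborel) + (\<integral>x. \<bar>f x - g x\<bar> \<partial>lborel)
        + (\<integral>x. \<bar>g (x + h n) - g x\<bar> \<partial>lborel)"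
      using i d ds by (simp add: Bochner_Integration.integral_add)
    also have "(\<integral>x. \<bar>f (x + h n) - g (x + h n)\<bar> \<partial>lborel) = (\<integral>x. \<bar>f x - g x\<bar> \<partial>lborel)"
      using lborel_integral_shift(2)[OF d, of "h n"] by simp
    finally show ?thesis using fg N[OF n] by simp
  qed
  then show "\<exists>N. \<forall>n\<ge>N. norm ((\<integral>x. \<bar>f (x + h n) - f x\<bar> \<partial>lborel) - 0) < r"
    by (intro exI[of _ N]) auto
qed

text \<open>Openness gives pointwise convergence at the points of \<open>U\<close> only: they stay
  in \<open>U\<close> after a small shift. The points that enter \<open>U\<close> need no separate
  argument, because \<open>U\<close> and its translates have the same finite measure.\<close>

lemma L1_shift_tendsto_open:
  fixes U :: "(real^'n) set"
  assumes U: "open U" "emeasure lborel U < \<infinity>" and h: "h \<longlonglongrightarrow> 0"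
  shows "(\<lambda>n. \<integral>x. \<bar>indicator U (x + h n) * c - indicator U x * c\<bar> \<partial>lborel) \<longlonglongrightarrow> (0::real)"
proof -
  let ?i = "indicator U :: real^'n \<Rightarrow> real"
  have i: "integrable lborel ?i" using U by (simp add: integrable_indicator_iff)
  note i_shift = lborel_integral_shift[OF i]
  let ?p = "\<lambda>n x. ?i x * (1 - ?i (x + h n))"
  have [measurable]: "U \<in> sets borel" using U by auto
  have "(\<lambda>n. \<integral>x. ?p n x \<partial>lborel) \<longlonglongrightarrow> (\<integral>x. 0 \<partial>(lborel :: (real^'n) measure))"
  proof (rule integral_dominated_convergence[where w = ?i])
    show "AE x in lborel. (\<lambda>n. ?p n x) \<longlonglongrightarrow> 0"
    proof (rule AE_I2)
      fix x :: "real^'n"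
      show "(\<lambda>n. ?p n x) \<longlonglongrightarrow> 0"
      proof (cases "x \<in> U")
        case True
        have "(\<lambda>n. x + h n) \<longlonglongrightarrow> x" using tendsto_add[OF tendsto_const h, of x] by simp
        then have "\<forall>\<^sub>F n in sequentially. x + h n \<in> U" using U(1) True by (rule topological_tendstoD)
        then have "\<forall>\<^sub>F n in sequentially. ?p n x = 0" by eventually_elim simp
        then show ?thesis by (rule tendsto_eventually)
      qed simp
    qed
  qed (use i in \<open>auto simp: indicator_def\<close>)
  then have lim: "(\<lambda>n. \<bar>c\<bar> * (2 * (\<integral>x. ?p n x \<partial>lborel))) \<longlonglongrightarrow> 0" by (auto intro!: tendsto_eq_intros)
  have "(\<integral>x. \<bar>?i (x + h n) * c - ?i x * c\<bar> \<partial>lborel) = \<bar>c\<bar> * (2 * (\<integral>x. ?p n x \<partial>lborel))" for n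
  proof -
    have ip: "integrable lborel (?p n)"
      by (rule Bochner_Integration.integrable_bound[OF i]) (auto simp: indicator_def)
    \<comment> \<open>For \<open>a, b\<close> in \<open>{0, 1}\<close> one has
      \<open>|b - a| = 2 * a * (1 - b) + (b - a)\<close>, and the integral of the last bracket
      vanishes by translation invariance.\<close>
    have "(\<integral>x. \<bar>?i (x + h n) * c - ?i x * c\<bar> \<partial>lborel) = (\<integral>x. \<bar>c\<bar> * (2 * ?p n x + (?i (x + h n) - ?i x)) \<partial>lborel)"
      by (intro Bochner_Integration.integral_cong) (auto simp: indicator_def)
    also have "\<dots> = \<bar>c\<bar> * (2 * (\<integral>x. ?p n x \<partial>lborel))"
      using ip i i_shift by simp
    finally show ?thesis .
  qed
  then show ?thesis using lim by simp
qed

text \<open>Induction over integrable functions; outer regularity replaces the indicator of a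
  measurable set by that of an open one.\<close>

lemma L1_shift_tendsto:
  fixes f :: "real^'n \<Rightarrow> real"
  assumes "integrable lborel f" and h: "h \<longlonglongrightarrow> 0"
  shows "(\<lambda>n. \<integral>x. \<bar>f (x + h n) - f x\<bar> \<partial>lborel) \<longlonglongrightarrow> 0"
  using assms(1)
proof (induction f rule: integrable_induct)
  case (base A c)
  have [measurable]: "A \<in> sets borel" using base by simp
  show ?case
  proof (rule L1_shift_tendsto_approx)
    show "integrable lborel (\<lambda>x. indicator A x *\<^sub>R c)" using base by auto
    fix e :: real assume "0 < e"
    \<comment> \<open>The \<open>+ 1\<close> keeps the quotient meaningful for
      \<open>c = 0\<close>.\<close>
    then have "0 < e / (\<bar>c\<bar> + 1)" by simp
    then obtain U where U: "open U" "A \<subseteq> U" "emeasure lborel (U - A) < ennreal (e / (\<bar>c\<bar> + 1))"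
      using outer_regular_lborel[of A] base by auto
    have [measurable]: "U \<in> sets borel" using U by auto
    have "emeasure lborel U \<le> emeasure lborel A + emeasure lborel (U - A)"
      by (rule order_trans[OF _ emeasure_subadditive]) (use U in \<open>auto intro!: emeasure_mono\<close>)
    also have "\<dots> < \<infinity>" using base less_trans[OF U(3) ennreal_less_top] by simp
    finally have fin: "emeasure lborel U < \<infinity>" .
    have "(\<integral>x. \<bar>indicator A x *\<^sub>R c - indicator U x *\<^sub>R c\<bar> \<partial>lborel) = (\<integral>x. \<bar>c\<bar> * indicator (U - A) x \<partial>lborel)"
      using U by (intro Bochner_Integration.integral_cong) (auto simp: indicator_def)
    also have "\<dots> = \<bar>c\<bar> * measure lborel (U - A)" by simp
    also have "\<dots> < e"
    proof -
      have "emeasure lborel (U - A) \<noteq> \<infinity>" using less_trans[OF U(3) ennreal_less_top] by simp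
      then have m: "measure lborel (U - A) < e / (\<bar>c\<bar> + 1)"
        using U(3) \<open>0 < e\<close> by (simp add: emeasure_eq_ennreal_measure ennreal_less_iff)
      have "\<bar>c\<bar> * measure lborel (U - A) \<le> (\<bar>c\<bar> + 1) * measure lborel (U - A)" by (intro mult_right_mono) auto
      also have "\<dots> < e" using m by (simp add: field_simps)
      finally show ?thesis .
    qed
    finally have lt: "(\<integral>x. \<bar>indicator A x *\<^sub>R c - indicator U x *\<^sub>R c\<bar> \<partial>lborel) < e" .
    show "\<exists>g. integrable lborel g \<and> (\<integral>x. \<bar>indicator A x *\<^sub>R c - g x\<bar> \<partial>lborel) < e \<and>
       (\<lambda>n. \<integral>x. \<bar>g (x + h n) - g x\<bar> \<partial>lborel) \<longlonglongrightarrow> 0"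
      using lt fin L1_shift_tendsto_open[OF U(1) fin h, of c]
      by (intro exI[of _ "\<lambda>x. indicator U x *\<^sub>R c"]) (auto simp: integrable_indicator_iff)
  qed
next
  case (add f g)
  show ?case
  proof (rule tendsto_sandwich[OF _ _ tendsto_const])
    have i: "integrable lborel (\<lambda>x. \<bar>f (x + h n) - f x\<bar>)" "integrable lborel (\<lambda>x. \<bar>g (x + h n) - g x\<bar>)"
      "integrable lborel (\<lambda>x. \<bar>f (x + h n) + g (x + h n) - (f x + g x)\<bar>)" for n
      using add(1,2) lborel_integral_shift(1)[OF add(1)] lborel_integral_shift(1)[OF add(2)] by auto
    have "(\<integral>x. \<bar>f (x + h n) + g (x + h n) - (f x + g x)\<bar> \<partial>lborel)
      \<le> (\<integral>x. \<bar>f (x + h n) - f x\<bar> + \<bar>g (x + h n) - g x\<bar> \<partial>lborel)" for n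
      by (rule integral_mono[OF i(3) Bochner_Integration.integrable_add[OF i(1,2)]]) simp
    then have "(\<integral>x. \<bar>f (x + h n) + g (x + h n) - (f x + g x)\<bar> \<partial>lborel)
      \<le> (\<integral>x. \<bar>f (x + h n) - f x\<bar> \<partial>lborel) + (\<integral>x. \<bar>g (x + h n) - g x\<bar> \<partial>lborel)" for n
      by (simp only: Bochner_Integration.integral_add[OF i(1,2)])
    then show "\<forall>\<^sub>F n in sequentially. (\<integral>x. \<bar>f (x + h n) + g (x + h n) - (f x + g x)\<bar> \<partial>lborel)
      \<le> (\<integral>x. \<bar>f (x + h n) - f x\<bar> \<partial>lborel) + (\<integral>x. \<bar>g (x + h n) - g x\<bar> \<partial>lborel)" by simp
    show "(\<lambda>n. (\<integral>x. \<bar>f (x + h n) - f x\<bar> \<partial>lborel) + (\<integral>x. \<bar>g (x + h n) - g x\<bar> \<partial>lborel)) \<longlonglongrightarrow> 0"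
      using tendsto_add[OF add(3,4)] by simp
  qed simp
next
  case (lim f s)
  show ?case
  proof (rule L1_shift_tendsto_approx)
    fix e :: real assume "0 < e"
    have "(\<lambda>i. \<integral>x. \<bar>f x - s i x\<bar> \<partial>lborel) \<longlonglongrightarrow> (\<integral>x. 0 \<partial>(lborel :: (real^'n) measure))"
    proof (rule integral_dominated_convergence[where w = "\<lambda>x. 3 * \<bar>f x\<bar>"])
      show "AE x in lborel. (\<lambda>i. \<bar>f x - s i x\<bar>) \<longlonglongrightarrow> 0"
      proof (rule AE_I2)
        fix x show "(\<lambda>i. \<bar>f x - s i x\<bar>) \<longlonglongrightarrow> 0"
          using tendsto_rabs[OF tendsto_diff[OF tendsto_const lim(2)], of x "f x"] by simp
      qed
      show "AE x in lborel. norm \<bar>f x - s i x\<bar> \<le> 3 * \<bar>f x\<bar>" for i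
      proof (rule AE_I2)
        fix x show "norm \<bar>f x - s i x\<bar> \<le> 3 * \<bar>f x\<bar>" using lim(3)[of x i] by simp
      qed
    qed (use lim in auto)
    then have "\<forall>\<^sub>F i in sequentially. (\<integral>x. \<bar>f x - s i x\<bar> \<partial>lborel) < e"
      using \<open>0 < e\<close> by (intro order_tendstoD(2)) auto
    then obtain i where "(\<integral>x. \<bar>f x - s i x\<bar> \<partial>lborel) < e" by (auto simp: eventually_sequentially)
    then show "\<exists>g. integrable lborel g \<and> (\<integral>x. \<bar>f x - g x\<bar> \<partial>lborel) < e \<and>
       (\<lambda>n. \<integral>x. \<bar>g (x + h n) - g x\<bar> \<partial>lborel) \<longlonglongrightarrow> 0"
      using lim(1,5) by (intro exI[of _ "s i"]) auto
  qed (use lim in auto)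
qed

lemma tendsto_0_ennreal_mono:
  fixes f g :: "'a \<Rightarrow> ennreal"
  assumes "\<And>n. f n \<le> g n" "(g \<longlongrightarrow> 0) F"
  shows "(f \<longlongrightarrow> 0) F"
  by (rule tendsto_sandwich[OF _ _ tendsto_const assms(2)]) (simp_all add: assms(1))

text \<open>For nonnegative numbers \<open>(a - b)^2 \<le> |a^2 - b^2|\<close>, so continuity in
  \<open>L1\<close> for \<open>v^2\<close> gives continuity in \<open>L2\<close> for
  \<open>v\<close>.\<close>

lemma L2_shift_tendsto_nonneg:
  fixes v :: "real^'n \<Rightarrow> real"
  assumes v: "v \<in> L2_space" and nonneg: "\<And>x. 0 \<le> v x" and h: "h \<longlonglongrightarrow> 0"
  shows "(\<lambda>n. sqn (fdiff (h n) v)) \<longlonglongrightarrow> 0"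
proof -
  have [measurable]: "v \<in> borel_measurable borel" using v by (rule L2_spaceD)
  have i: "integrable lborel (\<lambda>x. (v x)\<^sup>2)" using v by (simp add: L2_space_def)
  have id: "integrable lborel (\<lambda>x. \<bar>(v (x + h n))\<^sup>2 - (v x)\<^sup>2\<bar>)" for n
    using i lborel_integral_shift(1)[OF i] by auto
  have le: "sqn (fdiff (h n) v) \<le> ennreal (\<integral>x. \<bar>(v (x + h n))\<^sup>2 - (v x)\<^sup>2\<bar> \<partial>lborel)" for n
  proof -
    have "(a - b)\<^sup>2 \<le> \<bar>a\<^sup>2 - b\<^sup>2\<bar>" if "0 \<le> a" "0 \<le> b" for a b :: real
    proof -
      have "(a - b)\<^sup>2 = \<bar>a - b\<bar> * \<bar>a - b\<bar>" by (simp add: power2_eq_square flip: abs_mult)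
      also have "\<dots> \<le> \<bar>a - b\<bar> * \<bar>a + b\<bar>" using that by (intro mult_left_mono) auto
      also have "\<dots> = \<bar>a\<^sup>2 - b\<^sup>2\<bar>" by (simp add: power2_eq_square algebra_simps flip: abs_mult)
      finally show ?thesis .
    qed
    then have "sqn (fdiff (h n) v) \<le> (\<integral>\<^sup>+x. ennreal \<bar>(v (x + h n))\<^sup>2 - (v x)\<^sup>2\<bar> \<partial>lborel)"
      unfolding sqn_def fdiff_def using nonneg by (intro nn_integral_mono ennreal_leI) auto
    also have "\<dots> = ennreal (\<integral>x. \<bar>(v (x + h n))\<^sup>2 - (v x)\<^sup>2\<bar> \<partial>lborel)"
      by (rule nn_integral_eq_integral[OF id]) auto
    finally show ?thesis .
  qed
  have "(\<lambda>n. ennreal (\<integral>x. \<bar>(v (x + h n))\<^sup>2 - (v x)\<^sup>2\<bar> \<partial>lborel)) \<longlonglongrightarrow> ennreal 0"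
    by (intro tendsto_ennrealI L1_shift_tendsto[OF i h])
  then show ?thesis by (intro tendsto_0_ennreal_mono[OF le]) simp
qed

lemma L2_shift_tendsto:
  fixes v :: "real^'n \<Rightarrow> real"
  assumes v: "v \<in> L2_space" and h: "h \<longlonglongrightarrow> 0"
  shows "(\<lambda>n. sqn (fdiff (h n) v)) \<longlonglongrightarrow> 0"
proof -
  have [measurable]: "v \<in> borel_measurable borel" using v by (rule L2_spaceD)
  define p where "p x = max 0 (v x)" for x
  define m where "m x = max 0 (- v x)" for x
  have [measurable]: "p \<in> borel_measurable borel" "m \<in> borel_measurable borel"
    unfolding p_def[abs_def] m_def[abs_def] by measurable
  have "sqn p \<le> sqn v" "sqn m \<le> sqn v" by (auto intro!: sqn_mono simp: p_def m_def)
  then have L2: "p \<in> L2_space" "m \<in> L2_space" using v by (auto simp: L2_space_iff)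
  have lim: "(\<lambda>n. 2 * sqn (fdiff (h n) p) + 2 * sqn (fdiff (h n) m)) \<longlonglongrightarrow> 2 * 0 + 2 * 0"
    by (intro tendsto_add tendsto_mult_ennreal tendsto_const L2_shift_tendsto_nonneg L2 h)
       (auto simp: p_def m_def)
  have le: "sqn (fdiff (h n) v) \<le> 2 * sqn (fdiff (h n) p) + 2 * sqn (fdiff (h n) m)" for n
  proof -
    have "sqn (fdiff (h n) v) \<le> 2 * sqn (fdiff (h n) p) + 2 * sqn (\<lambda>x. - fdiff (h n) m x)"
      by (rule sqn_le_add) (auto simp: fdiff_def p_def m_def)
    then show ?thesis by (simp add: sqn_minus)
  qed
  show ?thesis by (rule tendsto_0_ennreal_mono[OF le]) (use lim in simp)
qed

section \<open>Plancherel's identity\<close>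

lemma integrable_pair_mult:
  fixes f g :: "real^'n \<Rightarrow> 'b::{real_normed_field, banach, second_countable_topology}"
  assumes f: "integrable lborel f" and g: "integrable lborel g"
  shows "integrable (lborel \<Otimes>\<^sub>M lborel) (\<lambda>p. f (fst p) * g (snd p))"
proof (rule lborel_pair.Fubini_integrable)
  have [measurable]: "f \<in> borel_measurable borel" "g \<in> borel_measurable borel" using f g by auto
  show "(\<lambda>p. f (fst p) * g (snd p)) \<in> borel_measurable (lborel \<Otimes>\<^sub>M lborel)" by measurable
  show "integrable lborel (\<lambda>x. LINT y|lborel. norm (f (fst (x, y)) * g (snd (x, y))))"
    using f by (simp add: norm_mult)
  show "AE x in lborel. integrable lborel (\<lambda>y. f (fst (x, y)) * g (snd (x, y)))"
    using g by simp
qed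

lemma integrable_pair_autocorrelation:
  fixes g :: "real^'n \<Rightarrow> real"
  assumes g: "integrable lborel g"
  shows "integrable (lborel \<Otimes>\<^sub>M lborel) (\<lambda>p. g (fst p) * g (fst p + snd p))"
proof (rule lborel_pair.Fubini_integrable)
  have [measurable]: "g \<in> borel_measurable borel" using g by auto
  show "(\<lambda>p. g (fst p) * g (fst p + snd p)) \<in> borel_measurable (lborel \<Otimes>\<^sub>M lborel)" by measurable
  have i: "integrable lborel (\<lambda>x. norm (g x))" using g by simp
  have "(LINT y|lborel. norm (g (x + y))) = (LINT y|lborel. norm (g y))" for x
    using lborel_integral_shift(2)[OF i, of x] by (simp add: add.commute)
  then show "integrable lborel (\<lambda>x. LINT y|lborel. norm (g (fst (x, y)) * g (fst (x, y) + snd (x, y))))"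
    using g by (simp add: abs_mult)
  have "integrable lborel (\<lambda>y. g (x + y))" for x
    using lborel_integral_shift(1)[OF g, of x] by (simp add: add.commute)
  then show "AE x in lborel. integrable lborel (\<lambda>y. g (fst (x, y)) * g (fst (x, y) + snd (x, y)))"
    by simp
qed

lemma integrable_cis_mult:
  fixes f :: "real^'n \<Rightarrow> complex"
  assumes f: "integrable lborel f" and [measurable]: "\<phi> \<in> borel_measurable borel"
  shows "integrable lborel (\<lambda>x. cis (\<phi> x) * f x)"
proof -
  have [measurable]: "f \<in> borel_measurable borel" using f by auto
  show ?thesis by (rule Bochner_Integration.integrable_bound[OF f]) (auto simp: norm_mult)
qed

lemma fourier_integral_measurable [measurable]:
  assumes [measurable]: "f \<in> borel_measurable borel"
  shows "fourier_integral f \<in> borel_measurable borel"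
  unfolding fourier_integral_def[abs_def] by measurable

text \<open>Write \<open>|F|^2 = F * cnj F\<close> as a double integral and substitute
  \<open>y = x + z\<close>: for real \<open>g\<close> the result is the transform of the
  autocorrelation of \<open>g\<close>.\<close>

lemma norm_fourier_integral_sq:
  fixes g :: "real^'n \<Rightarrow> real"
  assumes g: "integrable lborel g"
  shows "complex_of_real ((norm (fourier_integral (\<lambda>x. of_real (g x)) \<xi>))\<^sup>2)
    = (\<integral>z. cis (\<xi> \<bullet> z) * of_real (\<integral>x. g x * g (x + z) \<partial>lborel) \<partial>lborel)"
proof -
  have [measurable]: "g \<in> borel_measurable borel" using g by auto
  let ?F = "fourier_integral (\<lambda>x. complex_of_real (g x)) \<xi>"
  have gc: "integrable lborel (\<lambda>x. complex_of_real (g x))" using g by simp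
  have cF: "cnj ?F = (\<integral>y. cis (\<xi> \<bullet> y) * of_real (g y) \<partial>lborel)"
    unfolding fourier_integral_def by (simp add: cis_cnj flip: Bochner_Integration.integral_cnj)
  have shift: "cnj ?F = (\<integral>z. cis (\<xi> \<bullet> (x + z)) * of_real (g (x + z)) \<partial>lborel)" for x
    unfolding cF
    by (subst lborel_integral_shift(2)[OF integrable_cis_mult[OF gc], symmetric, of _ x])
       (auto simp: add.commute)
  have ip: "integrable (lborel \<Otimes>\<^sub>M lborel)
      (\<lambda>p. cis (\<xi> \<bullet> snd p) * complex_of_real (g (fst p) * g (fst p + snd p)))"
    by (rule Bochner_Integration.integrable_bound[OF integrable_pair_autocorrelation[OF g]])
       (auto simp: norm_mult)
  have "complex_of_real ((norm ?F)\<^sup>2) = ?F * cnj ?F" by (rule complex_norm_square)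
  also have "\<dots> = (\<integral>x. cis (- (\<xi> \<bullet> x)) * of_real (g x) * cnj ?F \<partial>lborel)"
    unfolding fourier_integral_def[of _ \<xi>] by simp
  also have "\<dots> = (\<integral>x. \<integral>z. cis (\<xi> \<bullet> z) * of_real (g x * g (x + z)) \<partial>lborel \<partial>lborel)"
  proof (rule Bochner_Integration.integral_cong[OF refl])
    fix x :: "real^'n"
    have "cis (- (\<xi> \<bullet> x)) * of_real (g x) * cnj ?F
      = (\<integral>z. cis (- (\<xi> \<bullet> x)) * of_real (g x) * (cis (\<xi> \<bullet> (x + z)) * of_real (g (x + z))) \<partial>lborel)"
      unfolding shift[of x] by simp
    also have "\<dots> = (\<integral>z. cis (\<xi> \<bullet> z) * of_real (g x * g (x + z)) \<partial>lborel)"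
    proof (rule Bochner_Integration.integral_cong[OF refl])
      fix z
      have "cis (- (\<xi> \<bullet> x)) * cis (\<xi> \<bullet> (x + z)) = cis (\<xi> \<bullet> z)"
        by (simp add: cis_mult inner_add_right)
      moreover have "cis (- (\<xi> \<bullet> x)) * of_real (g x) * (cis (\<xi> \<bullet> (x + z)) * of_real (g (x + z)))
        = cis (- (\<xi> \<bullet> x)) * cis (\<xi> \<bullet> (x + z)) * of_real (g x * g (x + z))"
        unfolding of_real_mult by (simp only: mult_ac)
      ultimately show "cis (- (\<xi> \<bullet> x)) * of_real (g x) * (cis (\<xi> \<bullet> (x + z)) * of_real (g (x + z)))
        = cis (\<xi> \<bullet> z) * of_real (g x * g (x + z))"
        by simp
    qed
    finally show "cis (- (\<xi> \<bullet> x)) * of_real (g x) * cnj ?F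
      = (\<integral>z. cis (\<xi> \<bullet> z) * of_real (g x * g (x + z)) \<partial>lborel)" .
  qed
  also have "\<dots> = (\<integral>z. \<integral>x. cis (\<xi> \<bullet> z) * of_real (g x * g (x + z)) \<partial>lborel \<partial>lborel)"
    using ip by (subst lborel_pair.Fubini_integral) (auto simp: case_prod_beta')
  also have "\<dots> = (\<integral>z. cis (\<xi> \<bullet> z) * of_real (\<integral>x. g x * g (x + z) \<partial>lborel) \<partial>lborel)"
    by (simp only: integral_mult_right_zero integral_complex_of_real)
  finally show ?thesis .
qed

text \<open>The Gaussian weight makes the double integral absolutely convergent, so Fubini applies
  although \<open>|F|^2\<close> is not yet known to be integrable. The transform of the weight is a
  Gaussian of width \<open>e\<close>, and rescaling moves \<open>e\<close> into the argument of
  \<open>A\<close>.\<close>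

lemma gauss_weighted_plancherel:
  fixes g :: "real^'n \<Rightarrow> real"
  assumes g: "integrable lborel g" and e: "0 < e"
  defines "A \<equiv> \<lambda>z. \<integral>x. g x * g (x + z) \<partial>lborel"
  shows "(\<integral>\<xi>. gauss (e *\<^sub>R \<xi>) * (norm (fourier_integral (\<lambda>x. of_real (g x)) \<xi>))\<^sup>2 \<partial>lborel)
    = sqrt (2 * pi) ^ CARD('n) * (\<integral>z. gauss z * A (e *\<^sub>R z) \<partial>lborel)"
proof -
  have [measurable]: "g \<in> borel_measurable borel" using g by auto
  have [measurable]: "A \<in> borel_measurable borel" unfolding A_def by measurable
  have iA: "integrable lborel A"
    using lborel_pair.integrable_snd[of "\<lambda>x z. g x * g (x + z)"] integrable_pair_autocorrelation[OF g]
    by (simp add: A_def case_prod_beta')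
  let ?F = "fourier_integral (\<lambda>x. complex_of_real (g x))"
  let ?g = "\<lambda>\<xi>::real^'n. gauss (e *\<^sub>R \<xi>)"
  have ip: "integrable (lborel \<Otimes>\<^sub>M lborel)
      (\<lambda>p. of_real (?g (fst p)) * (cis (fst p \<bullet> snd p) * complex_of_real (A (snd p))))"
    by (rule Bochner_Integration.integrable_bound[OF integrable_pair_mult[OF gauss_fourier_scaled(1)[OF e] iA]])
       (auto simp: norm_mult)
  have "complex_of_real (\<integral>\<xi>. ?g \<xi> * (norm (?F \<xi>))\<^sup>2 \<partial>lborel)
      = (\<integral>\<xi>. of_real (?g \<xi>) * complex_of_real ((norm (?F \<xi>))\<^sup>2) \<partial>lborel)"
    by (simp flip: integral_complex_of_real)
  also have "\<dots> = (\<integral>\<xi>. \<integral>z. of_real (?g \<xi>) * (cis (\<xi> \<bullet> z) * of_real (A z)) \<partial>lborel \<partial>lborel)"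
    unfolding norm_fourier_integral_sq[OF g] A_def by simp
  also have "\<dots> = (\<integral>z. \<integral>\<xi>. of_real (?g \<xi>) * (cis (\<xi> \<bullet> z) * of_real (A z)) \<partial>lborel \<partial>lborel)"
    using ip by (subst lborel_pair.Fubini_integral) (auto simp: case_prod_beta')
  also have "\<dots> = (\<integral>z. of_real (A z) * (\<integral>\<xi>. cis (\<xi> \<bullet> z) * of_real (?g \<xi>) \<partial>lborel) \<partial>lborel)"
    unfolding integral_mult_right_zero[symmetric]
    by (intro Bochner_Integration.integral_cong refl) (simp only: mult_ac)
  also have "\<dots> = of_real (\<integral>z. A z * (sqrt (2 * pi) ^ CARD('n) * (1 / e) ^ CARD('n) * gauss ((1 / e) *\<^sub>R z)) \<partial>lborel)"
    unfolding gauss_fourier_scaled(2)[OF e] by (simp flip: integral_complex_of_real)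
  finally have "(\<integral>\<xi>. ?g \<xi> * (norm (?F \<xi>))\<^sup>2 \<partial>lborel)
      = (\<integral>z. A z * (sqrt (2 * pi) ^ CARD('n) * (1 / e) ^ CARD('n) * gauss ((1 / e) *\<^sub>R z)) \<partial>lborel)"
    by (simp only: of_real_eq_iff)
  also have "\<dots> = sqrt (2 * pi) ^ CARD('n) * (1 / e) ^ CARD('n) * (\<integral>z. A z * gauss ((1 / e) *\<^sub>R z) \<partial>lborel)"
    unfolding integral_mult_right_zero[symmetric]
    by (intro Bochner_Integration.integral_cong refl) (simp only: mult_ac)
  also have "(\<integral>z. A z * gauss ((1 / e) *\<^sub>R z) \<partial>lborel) = (e ^ CARD('n)) * (\<integral>z. gauss z * A (e *\<^sub>R z) \<partial>lborel)"
    using e by (subst lborel_integral_scale(1)[where c = e]) (auto simp: mult.commute)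
  finally show ?thesis using e by (simp add: power_divide)
qed

text \<open>Polarisation \<open>2 a b = a^2 + b^2 - (a - b)^2\<close>. It reduces continuity of
  \<open>A\<close> at \<open>0\<close> to continuity of translations, and the bound to
  \<open>0 \<le> sqn (fdiff z g) \<le> 4 * sqn g\<close>.\<close>

lemma autocorrelation_L2:
  fixes g :: "real^'n \<Rightarrow> real"
  assumes g: "g \<in> L2_space"
  defines "A \<equiv> \<lambda>z. \<integral>x. g x * g (x + z) \<partial>lborel"
  shows "A z = (L2_norm g)\<^sup>2 - enn2real (sqn (fdiff z g)) / 2"
    and "\<bar>A z\<bar> \<le> (L2_norm g)\<^sup>2"
proof -
  have [measurable]: "g \<in> borel_measurable borel" using g by (rule L2_spaceD)
  have i: "integrable lborel (\<lambda>x. (g x)\<^sup>2)" using g by (simp add: L2_space_def)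
  have i_shift: "integrable lborel (\<lambda>x. (g (x + z))\<^sup>2)" "(\<integral>x. (g (x + z))\<^sup>2 \<partial>lborel) = (\<integral>x. (g x)\<^sup>2 \<partial>lborel)"
    using lborel_integral_shift[OF i, of z] by auto
  have L: "(L2_norm g)\<^sup>2 = (\<integral>x. (g x)\<^sup>2 \<partial>lborel)" by (simp add: L2_norm_def)
  have le4: "sqn (fdiff z g) \<le> ennreal (4 * (L2_norm g)\<^sup>2)"
    using sqn_fdiff_le[of g z] sqn_eq_L2_norm[OF g] by (simp add: ennreal_mult')
  have "fdiff z g \<in> L2_space"
    using le4 by (auto simp: L2_space_iff intro: le_less_trans)
  then have id: "integrable lborel (\<lambda>x. (fdiff z g x)\<^sup>2)" and
    d: "sqn (fdiff z g) = ennreal (\<integral>x. (fdiff z g x)\<^sup>2 \<partial>lborel)"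
    by (simp_all add: L2_space_def sqn_def nn_integral_eq_integral)
  have "A z = (\<integral>x. ((g x)\<^sup>2 + (g (x + z))\<^sup>2 - (fdiff z g x)\<^sup>2) / 2 \<partial>lborel)"
    unfolding A_def fdiff_def by (intro Bochner_Integration.integral_cong) (auto simp: power2_diff)
  also have "\<dots> = (L2_norm g)\<^sup>2 - enn2real (sqn (fdiff z g)) / 2"
    using i i_shift id by (simp add: L d)
  finally show *: "A z = (L2_norm g)\<^sup>2 - enn2real (sqn (fdiff z g)) / 2" .
  have "enn2real (sqn (fdiff z g)) \<le> 4 * (L2_norm g)\<^sup>2"
    using enn2real_mono[OF le4] by simp
  then show "\<bar>A z\<bar> \<le> (L2_norm g)\<^sup>2"
    unfolding * using enn2real_nonneg[of "sqn (fdiff z g)"] by linarith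
qed

text \<open>Let \<open>e\<close> decrease to \<open>0\<close> in the weighted identity. In physical
  space \<open>A (e *\<^sub>R z)\<close> tends to \<open>A 0\<close>, the squared norm, with
  dominated convergence; in frequency space the weights increase to \<open>1\<close>, and monotone
  convergence needs no integrability of \<open>|F|^2\<close>.\<close>

theorem plancherel:
  fixes g :: "real^'n \<Rightarrow> real"
  assumes g: "integrable lborel g" and L2: "g \<in> L2_space"
  shows "(\<integral>\<^sup>+\<xi>. ennreal ((norm (fourier_integral (\<lambda>x. of_real (g x)) \<xi>))\<^sup>2) \<partial>lborel)
    = ennreal ((2 * pi) ^ CARD('n)) * sqn g"
proof -
  have [measurable]: "g \<in> borel_measurable borel" using g by auto
  let ?F = "fourier_integral (\<lambda>x. complex_of_real (g x))"
  define A where "A z = (\<integral>x. g x * g (x + z) \<partial>lborel)" for z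
  have [measurable]: "A \<in> borel_measurable borel" unfolding A_def[abs_def] by measurable
  have A: "A z = (L2_norm g)\<^sup>2 - enn2real (sqn (fdiff z g)) / 2" "\<bar>A z\<bar> \<le> (L2_norm g)\<^sup>2" for z
    using autocorrelation_L2[OF L2] by (simp_all add: A_def)
  define e :: "nat \<Rightarrow> real" where "e n = 1 / real (Suc n)" for n
  have e: "0 < e n" for n by (simp add: e_def)
  have e0: "e \<longlonglongrightarrow> 0" unfolding e_def[abs_def] using LIMSEQ_inverse_real_of_nat by (simp add: inverse_eq_divide)
  have Ftop: "norm (?F \<xi>) \<le> (\<integral>x. \<bar>g x\<bar> \<partial>lborel)" for \<xi>
    unfolding fourier_integral_def by (rule order_trans[OF integral_norm_bound]) (simp add: norm_mult)
  have iF: "integrable lborel (\<lambda>\<xi>. gauss (e n *\<^sub>R \<xi>) * (norm (?F \<xi>))\<^sup>2)" for n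
  proof (rule Bochner_Integration.integrable_bound)
    show "integrable lborel (\<lambda>\<xi>::real^'n. gauss (e n *\<^sub>R \<xi>) * (\<integral>x. \<bar>g x\<bar> \<partial>lborel)\<^sup>2)"
      by (intro integrable_mult_left gauss_fourier_scaled e)
    show "AE \<xi> in lborel. norm (gauss (e n *\<^sub>R \<xi>) * (norm (?F \<xi>))\<^sup>2)
        \<le> norm (gauss (e n *\<^sub>R \<xi>) * (\<integral>x. \<bar>g x\<bar> \<partial>lborel)\<^sup>2)"
      using Ftop by (intro AE_I2) (auto simp: abs_mult gauss_def intro!: mult_left_mono power_mono)
  qed measurable
  have "(\<lambda>n. \<integral>z. gauss z * A (e n *\<^sub>R z) \<partial>lborel) \<longlonglongrightarrow> (\<integral>z. gauss (z :: real^'n) * (L2_norm g)\<^sup>2 \<partial>lborel)"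
  proof (rule integral_dominated_convergence[where w = "\<lambda>z :: real^'n. gauss z * (L2_norm g)\<^sup>2"])
    show "AE z in lborel. (\<lambda>n. gauss z * A (e n *\<^sub>R z)) \<longlonglongrightarrow> gauss z * (L2_norm g)\<^sup>2"
    proof (rule AE_I2)
      fix z :: "real^'n"
      have "(\<lambda>n. e n *\<^sub>R z) \<longlonglongrightarrow> 0" using tendsto_scaleR[OF e0 tendsto_const, of z] by simp
      then have "(\<lambda>n. sqn (fdiff (e n *\<^sub>R z) g)) \<longlonglongrightarrow> ennreal 0"
        using L2_shift_tendsto[OF L2] by simp
      then have "(\<lambda>n. enn2real (sqn (fdiff (e n *\<^sub>R z) g))) \<longlonglongrightarrow> 0" by (rule tendsto_enn2real) simp
      then have "(\<lambda>n. gauss z * A (e n *\<^sub>R z)) \<longlonglongrightarrow> gauss z * ((L2_norm g)\<^sup>2 - 0 / 2)"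
        unfolding A(1) by (intro tendsto_mult_left tendsto_diff tendsto_const tendsto_divide) auto
      then show "(\<lambda>n. gauss z * A (e n *\<^sub>R z)) \<longlonglongrightarrow> gauss z * (L2_norm g)\<^sup>2" by simp
    qed
    show "AE z in lborel. norm (gauss z * A (e n *\<^sub>R z)) \<le> gauss z * (L2_norm g)\<^sup>2" for n
      using A(2) by (intro AE_I2) (auto simp: abs_mult gauss_def intro!: mult_left_mono)
  qed (use gauss_integrable in auto)
  then have "(\<lambda>n. sqrt (2 * pi) ^ CARD('n) * (\<integral>z. gauss z * A (e n *\<^sub>R z) \<partial>lborel))
      \<longlonglongrightarrow> sqrt (2 * pi) ^ CARD('n) * (sqrt (2 * pi) ^ CARD('n) * (L2_norm g)\<^sup>2)"
    by (intro tendsto_mult_left) (simp add: gauss_integral)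
  moreover have "sqrt (2 * pi) ^ CARD('n) * (sqrt (2 * pi) ^ CARD('n) * (L2_norm g)\<^sup>2) = (2 * pi) ^ CARD('n) * (L2_norm g)\<^sup>2"
    unfolding mult.assoc[symmetric] power_mult_distrib[symmetric] by simp
  ultimately have "(\<lambda>n. \<integral>\<xi>. gauss (e n *\<^sub>R \<xi>) * (norm (?F \<xi>))\<^sup>2 \<partial>lborel) \<longlonglongrightarrow> (2 * pi) ^ CARD('n) * (L2_norm g)\<^sup>2"
    unfolding gauss_weighted_plancherel[OF g e] A_def by simp
  then have lim: "(\<lambda>n. \<integral>\<^sup>+\<xi>. ennreal (gauss (e n *\<^sub>R \<xi>) * (norm (?F \<xi>))\<^sup>2) \<partial>lborel)
      \<longlonglongrightarrow> ennreal ((2 * pi) ^ CARD('n) * (L2_norm g)\<^sup>2)"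
    by (subst nn_integral_eq_integral[OF iF]) (simp_all add: gauss_def tendsto_ennrealI)
  have "(\<lambda>n. \<integral>\<^sup>+\<xi>. ennreal (gauss (e n *\<^sub>R \<xi>) * (norm (?F \<xi>))\<^sup>2) \<partial>lborel) \<longlonglongrightarrow> (\<integral>\<^sup>+\<xi>. ennreal ((norm (?F \<xi>))\<^sup>2) \<partial>lborel)"
  proof (rule nn_integral_LIMSEQ)
    show "incseq (\<lambda>n \<xi>. ennreal (gauss (e n *\<^sub>R \<xi>) * (norm (?F \<xi>))\<^sup>2))"
    proof (intro monoI le_funI ennreal_leI mult_right_mono)
      fix m n :: nat and \<xi> :: "real^'n" assume "m \<le> n"
      then have "e n \<le> e m" by (simp add: e_def frac_le)
      then have "e n * norm \<xi> \<le> e m * norm \<xi>" by (intro mult_right_mono) auto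
      then have "(e n * norm \<xi>)\<^sup>2 \<le> (e m * norm \<xi>)\<^sup>2" using e[of n] by (intro power_mono) auto
      then show "gauss (e m *\<^sub>R \<xi>) \<le> gauss (e n *\<^sub>R \<xi>)" by (simp add: gauss_def power_mult_distrib)
    qed auto
    show "(\<lambda>n. ennreal (gauss (e n *\<^sub>R \<xi>) * (norm (?F \<xi>))\<^sup>2)) \<longlonglongrightarrow> ennreal ((norm (?F \<xi>))\<^sup>2)" for \<xi>
      unfolding gauss_def by (intro tendsto_ennrealI) (auto intro!: tendsto_eq_intros e0)
  qed measurable
  from LIMSEQ_unique[OF this lim] show ?thesis
    by (simp add: sqn_eq_L2_norm[OF L2] ennreal_mult')
qed

lemma nn_integral_square_limit:
  fixes f :: "'a \<Rightarrow> 'b::{real_normed_vector, second_countable_topology}"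
  assumes [measurable]: "f \<in> borel_measurable M" "\<And>n. F n \<in> borel_measurable M"
    and conv: "(\<lambda>n. \<integral>\<^sup>+x. ennreal ((norm (f x - F n x))\<^sup>2) \<partial>M) \<longlonglongrightarrow> 0"
    and L: "(\<lambda>n. \<integral>\<^sup>+x. ennreal ((norm (F n x))\<^sup>2) \<partial>M) \<longlonglongrightarrow> L"
  shows "(\<integral>\<^sup>+x. ennreal ((norm (f x))\<^sup>2) \<partial>M) = L"
proof -
  have le: "(\<integral>\<^sup>+x. ennreal ((norm (a x))\<^sup>2) \<partial>M) \<le> ennreal (1 + d) * (\<integral>\<^sup>+x. ennreal ((norm (b x))\<^sup>2) \<partial>M)
      + ennreal (1 + 1 / d) * (\<integral>\<^sup>+x. ennreal ((norm (a x - b x))\<^sup>2) \<partial>M)"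
    if [measurable]: "a \<in> borel_measurable M" "b \<in> borel_measurable M" and d: "0 < d" for a b :: "'a \<Rightarrow> 'b" and d :: real
  proof -
    have "(\<integral>\<^sup>+x. ennreal ((norm (a x))\<^sup>2) \<partial>M) \<le> (\<integral>\<^sup>+x. ennreal (1 + d) * ennreal ((norm (b x))\<^sup>2)
      + ennreal (1 + 1 / d) * ennreal ((norm (a x - b x))\<^sup>2) \<partial>M)"
    proof (rule nn_integral_mono)
      fix x
      let ?p = "norm (b x)" and ?q = "norm (a x - b x)"
      have "norm (a x) \<le> ?p + ?q" using norm_triangle_ineq[of "b x" "a x - b x"] by simp
      then have "(norm (a x))\<^sup>2 \<le> (?p + ?q)\<^sup>2" by (intro power_mono) auto
      also have "(?p + ?q)\<^sup>2 \<le> (1 + d) * ?p\<^sup>2 + (1 + 1 / d) * ?q\<^sup>2"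
      proof -
        have "0 \<le> (d * ?p - ?q)\<^sup>2 / d" using d by simp
        also have "(d * ?p - ?q)\<^sup>2 / d = d * ?p\<^sup>2 + ?q\<^sup>2 / d - 2 * ?p * ?q"
          using d by (simp add: field_simps power2_eq_square)
        finally show ?thesis by (simp add: algebra_simps power2_sum)
      qed
      finally have "ennreal ((norm (a x))\<^sup>2) \<le> ennreal ((1 + d) * ?p\<^sup>2 + (1 + 1 / d) * ?q\<^sup>2)" by (rule ennreal_leI)
      then show "ennreal ((norm (a x))\<^sup>2) \<le> ennreal (1 + d) * ennreal (?p\<^sup>2) + ennreal (1 + 1 / d) * ennreal (?q\<^sup>2)"
        using d by (simp add: ennreal_mult')
    qed
    also have "\<dots> = ennreal (1 + d) * (\<integral>\<^sup>+x. ennreal ((norm (b x))\<^sup>2) \<partial>M)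
      + ennreal (1 + 1 / d) * (\<integral>\<^sup>+x. ennreal ((norm (a x - b x))\<^sup>2) \<partial>M)"
      by (simp add: nn_integral_add nn_integral_cmult)
    finally show ?thesis .
  qed
  let ?S = "\<integral>\<^sup>+x. ennreal ((norm (f x))\<^sup>2) \<partial>M"
  have eps: "X \<le> Y" if "\<And>d::real. 0 < d \<Longrightarrow> X \<le> ennreal (1 + d) * Y" for X Y :: ennreal
  proof (rule LIMSEQ_le_const)
    have "(\<lambda>n. 1 + 1 / real (Suc n)) \<longlonglongrightarrow> 1 + 0"
      using LIMSEQ_inverse_real_of_nat by (intro tendsto_add) (simp_all add: inverse_eq_divide)
    then have "(\<lambda>n. ennreal (1 + 1 / real (Suc n))) \<longlonglongrightarrow> ennreal (1 + 0)" by (rule tendsto_ennrealI)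
    then have "(\<lambda>n. ennreal (1 + 1 / real (Suc n)) * Y) \<longlonglongrightarrow> ennreal (1 + 0) * Y"
      by (intro tendsto_mult_ennreal tendsto_const) auto
    then show "(\<lambda>n. ennreal (1 + 1 / real (Suc n)) * Y) \<longlonglongrightarrow> Y" by simp
    show "\<exists>N. \<forall>n\<ge>N. X \<le> ennreal (1 + 1 / real (Suc n)) * Y" using that by (intro exI allI impI) simp
  qed
  have tail: "(\<lambda>n. Y n + ennreal (1 + 1 / d) * (\<integral>\<^sup>+x. ennreal ((norm (f x - F n x))\<^sup>2) \<partial>M)) \<longlonglongrightarrow> y"
    if "Y \<longlonglongrightarrow> y" for Y y and d :: real
  proof -
    have "(\<lambda>n. Y n + ennreal (1 + 1 / d) * (\<integral>\<^sup>+x. ennreal ((norm (f x - F n x))\<^sup>2) \<partial>M)) \<longlonglongrightarrow> y + ennreal (1 + 1 / d) * 0"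
      using that conv by (intro tendsto_add tendsto_mult_ennreal tendsto_const) auto
    then show ?thesis by simp
  qed
  have 1: "?S \<le> L"
  proof (rule eps)
    fix d :: real assume d: "0 < d"
    have "(\<lambda>n. ennreal (1 + d) * (\<integral>\<^sup>+x. ennreal ((norm (F n x))\<^sup>2) \<partial>M)) \<longlonglongrightarrow> ennreal (1 + d) * L"
      using L d by (intro tendsto_mult_ennreal tendsto_const) auto
    from LIMSEQ_le_const[OF tail[OF this, of d]] show "?S \<le> ennreal (1 + d) * L"
      using le[of f "F _" d] d by auto
  qed
  have 2: "L \<le> ?S"
  proof (rule eps)
    fix d :: real assume d: "0 < d"
    have "(\<integral>\<^sup>+x. ennreal ((norm (F n x))\<^sup>2) \<partial>M) \<le> ennreal (1 + d) * ?S
      + ennreal (1 + 1 / d) * (\<integral>\<^sup>+x. ennreal ((norm (f x - F n x))\<^sup>2) \<partial>M)" for n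
      using le[of "F n" f d] d by (simp add: norm_minus_commute)
    then show "L \<le> ennreal (1 + d) * ?S"
      by (intro LIMSEQ_le[OF L tail[OF tendsto_const, of "ennreal (1 + d) * ?S" d]]) auto
  qed
  from 1 2 show ?thesis by (rule antisym)
qed

lemma ball_borel [measurable]: "ball c r \<in> sets borel"
  by simp

lemma integrable_of_bounded_support:
  fixes g :: "real^'n \<Rightarrow> real"
  assumes g: "g \<in> L2_space" and supp: "AE x in lborel. x \<notin> ball 0 R \<longrightarrow> g x = 0"
  shows "integrable lborel g"
proof (rule Bochner_Integration.integrable_bound)
  show "integrable lborel (\<lambda>x. indicator (ball 0 R) x + (g x)\<^sup>2)"
    using g emeasure_bounded_finite[of "ball 0 R"]
    by (intro Bochner_Integration.integrable_add integrable_real_indicator) (auto simp: L2_space_def)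
  show "g \<in> borel_measurable lborel" using g by (simp add: L2_space_def)
  show "AE x in lborel. norm (g x) \<le> norm (indicator (ball 0 R) x + (g x)\<^sup>2)"
    using supp
  proof eventually_elim
    fix x assume "x \<notin> ball 0 R \<longrightarrow> g x = 0"
    moreover have "2 * \<bar>g x\<bar> \<le> 1 + (g x)\<^sup>2" using sum_squares_bound[of "\<bar>g x\<bar>" 1] by simp
    ultimately show "norm (g x) \<le> norm (indicator (ball 0 R) x + (g x)\<^sup>2)"
      by (cases "x \<in> ball 0 R") auto
  qed
qed

lemma truncate_L2_space:
  fixes g :: "real^'n \<Rightarrow> real"
  assumes g: "g \<in> L2_space"
  shows "(\<lambda>x. indicator (ball 0 R) x * g x) \<in> L2_space"
proof -
  have [measurable]: "g \<in> borel_measurable borel" using g by (rule L2_spaceD)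
  have "sqn (\<lambda>x. indicator (ball 0 R) x * g x) \<le> sqn g"
    by (intro sqn_mono) (auto simp: indicator_def)
  also have "\<dots> < \<infinity>" using g by (simp add: L2_space_iff)
  finally show ?thesis unfolding L2_space_iff by (intro conjI) measurable
qed

lemma truncate_integrable:
  fixes g :: "real^'n \<Rightarrow> real"
  assumes "g \<in> L2_space"
  shows "integrable lborel (\<lambda>x. indicator (ball 0 R) x * g x)"
  by (rule integrable_of_bounded_support[OF truncate_L2_space[OF assms], where R = R]) auto

lemma of_real_truncate:
  "(\<lambda>x. indicator A x * complex_of_real (g x)) = (\<lambda>x. complex_of_real (indicator A x * g x))"
  by (auto simp: indicator_def fun_eq_iff)

lemma of_real_L2_spaceD:
  fixes g :: "real^'n \<Rightarrow> real"
  assumes "(\<lambda>x. complex_of_real (g x)) \<in> L2_space"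
  shows "g \<in> L2_space"
proof -
  have "(\<lambda>x. Re (complex_of_real (g x))) \<in> borel_measurable lborel"
    using assms by (intro measurable_compose[OF _ borel_measurable_Re]) (simp add: L2_space_def)
  then show ?thesis using assms by (simp add: L2_space_def)
qed

text \<open>Truncations to balls lie in both \<open>L1\<close> and \<open>L2\<close>, so the
  classical identity holds for each of them; both sides pass to the limit along integer
  radii.\<close>

lemma fourier_transform_plancherel:
  fixes g :: "real^'n \<Rightarrow> real"
  assumes ft: "(\<lambda>x. complex_of_real (g x)) has_fourier_transform F"
  shows "(\<integral>\<^sup>+\<xi>. ennreal ((norm (F \<xi>))\<^sup>2) \<partial>lborel) = ennreal ((2 * pi) ^ CARD('n)) * sqn g"
proof -
  have g: "g \<in> L2_space" using ft by (auto simp: has_fourier_transform_def intro: of_real_L2_spaceD)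
  have [measurable]: "g \<in> borel_measurable borel" using g by (rule L2_spaceD)
  have [measurable]: "F \<in> borel_measurable borel" using ft by (simp add: has_fourier_transform_def L2_space_def)
  define G where "G n = (\<lambda>x. indicator (ball 0 (real n)) x * g x)" for n
  have G: "G n \<in> L2_space" "integrable lborel (G n)" for n
    unfolding G_def using g by (simp_all add: truncate_L2_space truncate_integrable)
  have [measurable]: "G n \<in> borel_measurable borel" for n using G(1) by (rule L2_spaceD)
  show ?thesis
  proof (rule nn_integral_square_limit)
    let ?F = "\<lambda>n. fourier_integral (\<lambda>x. complex_of_real (G n x))"
    show "F \<in> borel_measurable lborel" by simp
    show "?F n \<in> borel_measurable lborel" for n by simp
    have "((\<lambda>R. \<integral>\<^sup>+\<xi>. ennreal ((norm (F \<xi> - fourier_integral (\<lambda>x. complex_of_real (indicator (ball 0 R) x * g x)) \<xi>))\<^sup>2)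
        \<partial>lborel) \<longlongrightarrow> 0) at_top"
      using ft unfolding has_fourier_transform_def of_real_truncate by simp
    from filterlim_compose[OF this filterlim_real_sequentially]
    show "(\<lambda>n. \<integral>\<^sup>+\<xi>. ennreal ((norm (F \<xi> - ?F n \<xi>))\<^sup>2) \<partial>lborel) \<longlonglongrightarrow> 0" by (simp only: G_def)
    have "(\<lambda>n. sqn (G n)) \<longlonglongrightarrow> sqn g"
      unfolding sqn_def
    proof (rule nn_integral_LIMSEQ)
      show "incseq (\<lambda>n x. ennreal ((G n x)\<^sup>2))"
        by (intro monoI le_funI ennreal_leI) (auto simp: G_def indicator_def)
      show "(\<lambda>n. ennreal ((G n x)\<^sup>2)) \<longlonglongrightarrow> ennreal ((g x)\<^sup>2)" for x
      proof (rule tendsto_eventually)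
        obtain m where "norm x < real m" using reals_Archimedean2 by blast
        then show "\<forall>\<^sub>F n in sequentially. ennreal ((G n x)\<^sup>2) = ennreal ((g x)\<^sup>2)"
          by (intro eventually_sequentiallyI[of m]) (auto simp: G_def indicator_def)
      qed
    qed measurable
    then have "(\<lambda>n. ennreal ((2 * pi) ^ CARD('n)) * sqn (G n)) \<longlonglongrightarrow> ennreal ((2 * pi) ^ CARD('n)) * sqn g"
      by (intro tendsto_mult_ennreal tendsto_const) auto
    then show "(\<lambda>n. \<integral>\<^sup>+\<xi>. ennreal ((norm (?F n \<xi>))\<^sup>2) \<partial>lborel) \<longlonglongrightarrow> ennreal ((2 * pi) ^ CARD('n)) * sqn g"
      by (simp only: plancherel[OF G(2,1)])
  qed
qed

text \<open>Once the ball contains the support, the truncation no longer changes the integral, so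
  the distance that tends to \<open>0\<close> is eventually constant.\<close>

lemma fourier_transform_bounded_support:
  fixes v :: "real^'n \<Rightarrow> real"
  assumes v: "v \<in> L2_space" and supp: "AE x in lborel. x \<notin> ball 0 R \<longrightarrow> v x = 0"
    and ft: "(\<lambda>x. complex_of_real (v x)) has_fourier_transform F"
  shows "AE \<xi> in lborel. F \<xi> = fourier_integral (\<lambda>x. of_real (v x)) \<xi>"
proof -
  have [measurable]: "v \<in> borel_measurable borel" using v by (rule L2_spaceD)
  have [measurable]: "F \<in> borel_measurable borel" using ft by (simp add: has_fourier_transform_def L2_space_def)
  let ?I = "\<lambda>r. \<integral>\<^sup>+\<xi>. ennreal ((norm (F \<xi> - fourier_integral (\<lambda>x. indicator (ball 0 r) x * complex_of_real (v x)) \<xi>))\<^sup>2) \<partial>lborel"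
  let ?X = "\<integral>\<^sup>+\<xi>. ennreal ((norm (F \<xi> - fourier_integral (\<lambda>x. complex_of_real (v x)) \<xi>))\<^sup>2) \<partial>lborel"
  have "?I r = ?X" if "r \<ge> R" for r
  proof -
    have "fourier_integral (\<lambda>x. indicator (ball 0 r) x * complex_of_real (v x)) \<xi> = fourier_integral (\<lambda>x. complex_of_real (v x)) \<xi>" for \<xi>
      unfolding fourier_integral_def
    proof (rule integral_cong_AE)
      show "AE x in lborel. cis (- (\<xi> \<bullet> x)) * (indicator (ball 0 r) x * complex_of_real (v x)) = cis (- (\<xi> \<bullet> x)) * complex_of_real (v x)"
        using supp by eventually_elim (use that in \<open>auto simp: indicator_def\<close>)
    qed measurable
    then show ?thesis by simp
  qed
  then have "\<forall>\<^sub>F r in at_top. ?I r = ?X" by (rule eventually_at_top_linorderI)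
  moreover have "(?I \<longlongrightarrow> 0) at_top" using ft by (simp add: has_fourier_transform_def)
  ultimately have "((\<lambda>r::real. ?X) \<longlongrightarrow> 0) at_top" by (rule Lim_transform_eventually[rotated])
  then have "?X = 0" by (simp add: tendsto_const_iff)
  then show ?thesis by (subst (asm) nn_integral_0_iff_AE) auto
qed

lemma fourier_integral_fdiff:
  fixes v :: "real^'n \<Rightarrow> real"
  assumes v: "integrable lborel v"
  shows "fourier_integral (\<lambda>x. of_real (fdiff h v x)) \<xi> = (cis (\<xi> \<bullet> h) - 1) * fourier_integral (\<lambda>x. of_real (v x)) \<xi>"
proof -
  have vc: "integrable lborel (\<lambda>x. complex_of_real (v x))" using v by simp
  have vs: "integrable lborel (\<lambda>x. complex_of_real (v (x + h)))"
    using lborel_integral_shift(1)[OF vc] by simp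
  have i: "integrable lborel (\<lambda>x. cis (- (\<xi> \<bullet> x)) * complex_of_real (v x))"
    "integrable lborel (\<lambda>x. cis (- (\<xi> \<bullet> x)) * complex_of_real (v (x + h)))"
    by (intro integrable_cis_mult vc vs; measurable)+
  have "(\<integral>x. cis (- (\<xi> \<bullet> x)) * complex_of_real (v (x + h)) \<partial>lborel)
      = (\<integral>x. cis (\<xi> \<bullet> h) * (cis (- (\<xi> \<bullet> (x + h))) * complex_of_real (v (x + h))) \<partial>lborel)"
  proof (rule Bochner_Integration.integral_cong[OF refl])
    fix x
    have "cis (\<xi> \<bullet> h) * cis (- (\<xi> \<bullet> (x + h))) = cis (- (\<xi> \<bullet> x))"
      by (simp add: cis_mult inner_add_right)
    then show "cis (- (\<xi> \<bullet> x)) * complex_of_real (v (x + h))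
        = cis (\<xi> \<bullet> h) * (cis (- (\<xi> \<bullet> (x + h))) * complex_of_real (v (x + h)))"
      by (simp only: mult.assoc[symmetric])
  qed
  also have "\<dots> = cis (\<xi> \<bullet> h) * (\<integral>x. cis (- (\<xi> \<bullet> x)) * complex_of_real (v x) \<partial>lborel)"
    using lborel_integral_shift(2)[OF i(1), of h] by (simp only: integral_mult_right_zero)
  finally have *: "(\<integral>x. cis (- (\<xi> \<bullet> x)) * complex_of_real (v (x + h)) \<partial>lborel)
      = cis (\<xi> \<bullet> h) * (\<integral>x. cis (- (\<xi> \<bullet> x)) * complex_of_real (v x) \<partial>lborel)" .
  show ?thesis
    using i unfolding fourier_integral_def fdiff_def of_real_diff right_diff_distrib left_diff_distrib
    by (simp add: *)
qed

section \<open>The Gagliardo kernel\<close>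

text \<open>A replacement for polar coordinates: a bound \<open>b k\<close> that holds on one shell
  is charged to the whole ball around it. For geometric radii this overcounting costs a constant
  factor only.\<close>

lemma nn_integral_shells_finite:
  fixes f :: "real^'n \<Rightarrow> ennreal"
  assumes shell: "\<And>z. f z \<noteq> 0 \<Longrightarrow> \<exists>k. norm z < R k \<and> f z \<le> ennreal (b k)"
    and nonneg: "\<And>k. 0 \<le> b k" "\<And>k. 0 \<le> R k"
    and sum: "summable (\<lambda>k::nat. b k * R k ^ CARD('n))"
  shows "(\<integral>\<^sup>+z. f z \<partial>lborel) < \<infinity>"
proof -
  let ?g = "\<lambda>k z::real^'n. ennreal (b k) * indicator (ball 0 (R k)) z"
  have "f z \<le> (\<Sum>k. ?g k z)" for z
  proof (cases "f z = 0")
    case False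
    then obtain k where k: "norm z < R k" "f z \<le> ennreal (b k)" using shell by blast
    then have "f z \<le> (\<Sum>j\<in>{k}. ?g j z)" by simp
    also have "\<dots> \<le> (\<Sum>k. ?g k z)" by (intro sum_le_suminf) auto
    finally show ?thesis .
  qed simp
  then have "(\<integral>\<^sup>+z. f z \<partial>lborel) \<le> (\<integral>\<^sup>+z. (\<Sum>k. ?g k z) \<partial>lborel)" by (intro nn_integral_mono)
  also have "\<dots> = (\<Sum>k. \<integral>\<^sup>+z. ?g k z \<partial>lborel)" by (intro nn_integral_suminf) measurable
  also have "\<dots> = (\<Sum>k. ennreal (unit_ball_vol (real CARD('n)) * (b k * R k ^ CARD('n))))"
    using nonneg by (simp add: nn_integral_cmult_indicator emeasure_ball ennreal_mult'[symmetric] mult_ac)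
  also have "\<dots> < \<infinity>"
  proof -
    have "(\<Sum>k. ennreal (unit_ball_vol (real CARD('n)) * (b k * R k ^ CARD('n)))) \<noteq> top"
      using nonneg by (intro ennreal_suminf_neq_top summable_mult sum) auto
    then show ?thesis by (simp add: less_top)
  qed
  finally show ?thesis .
qed

text \<open>Dyadic shells give geometric series: outside the unit ball the ratio is
  \<open>2 powr (- 2 * s)\<close>, below \<open>1\<close> since \<open>s > 0\<close>; inside, the
  factor \<open>|z|^2\<close> turns it into \<open>2 powr (2 * s - 2)\<close>, below
  \<open>1\<close> since \<open>s < 1\<close>.\<close>

lemma gker_min_integrable:
  assumes "0 < s" "s < 1"
  shows "(\<integral>\<^sup>+z. ennreal (gker s (z :: real^'n) * min 1 ((norm z)\<^sup>2)) \<partial>lborel) < \<infinity>"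
proof -
  let ?N = "real CARD('n)"
  let ?p = "?N + 2 * s"
  have anti: "a powr - ?p \<le> b powr - ?p" if "0 < b" "b \<le> a" for a b
    using that assms by (intro powr_mono2') auto
  have out: "(\<integral>\<^sup>+z. ennreal (gker s (z :: real^'n)) * indicator {z. 1 \<le> norm z} z \<partial>lborel) < \<infinity>"
  proof (rule nn_integral_shells_finite)
    fix z :: "real^'n" assume "ennreal (gker s z) * indicator {z. 1 \<le> norm z} z \<noteq> 0"
    then have z: "1 \<le> norm z" by (auto simp: indicator_def split: if_splits)
    \<comment> \<open>The index with \<open>2^k \<le> |z| < 2^(k + 1)\<close>.\<close>
    define k where "k = nat \<lfloor>log 2 (norm z)\<rfloor>"
    have "real k \<le> log 2 (norm z)" "log 2 (norm z) < real (Suc k)"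
    proof -
      have "log 2 1 \<le> log 2 (norm z)" using z by (intro log_mono) auto
      then have "0 \<le> log 2 (norm z)" by simp
      then show "real k \<le> log 2 (norm z)" "log 2 (norm z) < real (Suc k)"
        unfolding k_def by linarith+
    qed
    then have k: "2 ^ k \<le> norm z" "norm z < 2 ^ Suc k"
    proof -
      have "z \<noteq> 0" using z by auto
      then have "2 powr real k \<le> norm z" "norm z < 2 powr real (Suc k)"
        using z \<open>real k \<le> _\<close> \<open>_ < real (Suc k)\<close> le_log_iff[of 2 "norm z" "real k"] log_less_iff[of 2 "norm z" "real (Suc k)"]
        by auto
      then show "2 ^ k \<le> norm z" "norm z < 2 ^ Suc k" by (simp_all only: powr_realpow zero_less_numeral)
    qed
    show "\<exists>k. norm z < 2 ^ Suc k \<and> ennreal (gker s z) * indicator {z. 1 \<le> norm z} z \<le> ennreal ((2 ^ k) powr - ?p)"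
      using k anti[of "2 ^ k" "norm z"] by (intro exI[of _ k]) (auto simp: gker_def indicator_def intro!: ennreal_leI)
  next
    have "(2 ^ k) powr - ?p * (2 ^ Suc k) ^ CARD('n) = 2 powr ?N * (2 powr (- 2 * s)) ^ k" for k :: nat
      by (simp add: powr_realpow[symmetric] powr_powr powr_add[symmetric] powr_mult algebra_simps)
    moreover have "summable (\<lambda>k. 2 powr ?N * (2 powr (- 2 * s)) ^ k)"
      using assms by (intro summable_mult summable_geometric) (simp add: powr_less_one)
    ultimately show "summable (\<lambda>k. (2 ^ k) powr - ?p * (2 ^ Suc k) ^ CARD('n))" by simp
  qed auto
  have inn: "(\<integral>\<^sup>+z. ennreal (gker s (z :: real^'n) * (norm z)\<^sup>2) * indicator {z. norm z < 1} z \<partial>lborel) < \<infinity>"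
  proof (rule nn_integral_shells_finite)
    fix z :: "real^'n" assume "ennreal (gker s z * (norm z)\<^sup>2) * indicator {z. norm z < 1} z \<noteq> 0"
    then have z: "norm z < 1" "0 < norm z" by (auto simp: indicator_def split: if_splits)
    \<comment> \<open>Ceiling minus one rather than floor: it yields
      \<open>2^-(k + 1) \<le> |z| < 2^-k\<close> with the strict inequality on the side of the open
      ball.\<close>
    define k where "k = nat (\<lceil>- log 2 (norm z)\<rceil> - 1)"
    have "- log 2 (norm z) > 0" using z by simp
    then have "real k < - log 2 (norm z)" "- log 2 (norm z) \<le> real (Suc k)"
      unfolding k_def by linarith+
    then have "log 2 (norm z) < - real k" "- real (Suc k) \<le> log 2 (norm z)" by auto
    then have k: "norm z < 2 powr (- real k)" "2 powr (- real (Suc k)) \<le> norm z"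
      using z by (simp_all only: le_log_iff log_less_iff)
    have "gker s z * (norm z)\<^sup>2 \<le> (2 powr (- real (Suc k))) powr - ?p * (2 powr (- real k))\<^sup>2"
      unfolding gker_def using k anti[of "2 powr (- real (Suc k))" "norm z"]
      by (intro mult_mono power_mono) auto
    then show "\<exists>k. norm z < 2 powr (- real k) \<and> ennreal (gker s z * (norm z)\<^sup>2) * indicator {z. norm z < 1} z
        \<le> ennreal ((2 powr (- real (Suc k))) powr - ?p * (2 powr (- real k))\<^sup>2)"
      using k by (intro exI[of _ k]) (auto simp: indicator_def intro!: ennreal_leI)
  next
    have "(2 powr (- real (Suc k))) powr - ?p * (2 powr (- real k))\<^sup>2 * (2 powr (- real k)) ^ CARD('n)
        = 2 powr ?p * (2 powr (2 * s - 2)) ^ k" for k :: nat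
      by (simp add: powr_realpow[symmetric] powr_powr powr_add[symmetric] algebra_simps)
    moreover have "summable (\<lambda>k. 2 powr ?p * (2 powr (2 * s - 2)) ^ k)"
      using assms by (intro summable_mult summable_geometric) (simp add: powr_less_one)
    ultimately show "summable (\<lambda>k. (2 powr (- real (Suc k))) powr - ?p * (2 powr (- real k))\<^sup>2 * (2 powr (- real k)) ^ CARD('n))"
      by simp
  qed auto
  have "(\<integral>\<^sup>+z. ennreal (gker s (z :: real^'n) * min 1 ((norm z)\<^sup>2)) \<partial>lborel) \<le>
    (\<integral>\<^sup>+z. ennreal (gker s (z :: real^'n)) * indicator {z. 1 \<le> norm z} z
      + ennreal (gker s z * (norm z)\<^sup>2) * indicator {z. norm z < 1} z \<partial>lborel)"
    by (intro nn_integral_mono) (auto simp: indicator_def intro!: ennreal_leI mult_left_mono mult_left_le)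
  also have "\<dots> < \<infinity>" using out inn by (subst nn_integral_add) auto
  finally show ?thesis .
qed

text \<open>The total weight for the oscillation of a cut-off, whose square is at most a constant
  times \<open>min 1 (|z|^2)\<close>.\<close>

definition gker_mass :: "'n::finite itself \<Rightarrow> real \<Rightarrow> real" where
  "gker_mass _ s = enn2real (\<integral>\<^sup>+z. ennreal (gker s (z :: real^'n) * min 1 ((norm z)\<^sup>2)) \<partial>lborel)"

text \<open>The Fourier symbol of the squared seminorm: taking the difference with increment
  \<open>h\<close> multiplies \<open>|F \<xi>|^2\<close> by the squared modulus of
  \<open>cis (\<xi> \<bullet> h) - 1\<close>.\<close>

definition gker_symbol :: "real \<Rightarrow> real^'n \<Rightarrow> ennreal" where
  "gker_symbol s \<xi> = (\<integral>\<^sup>+h. ennreal (gker s h * (norm (cis (\<xi> \<bullet> h) - 1))\<^sup>2) \<partial>lborel)"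

lemma norm_cis_minus_1_sq_le: "(norm (cis t - 1))\<^sup>2 \<le> 4 * min 1 (t\<^sup>2)"
proof -
  have "norm (cis t - 1) \<le> 2" using norm_triangle_ineq4[of "cis t" 1] by simp
  then have "(norm (cis t - 1))\<^sup>2 \<le> 2\<^sup>2" by (intro power_mono) auto
  moreover have "norm (cis t - 1) \<le> \<bar>t\<bar>" using iexp_approx1[of t 0] by (simp add: cis_conv_exp)
  then have "(norm (cis t - 1))\<^sup>2 \<le> \<bar>t\<bar>\<^sup>2" by (intro power_mono) auto
  then have "(norm (cis t - 1))\<^sup>2 \<le> 4 * t\<^sup>2" by (rule order_trans) simp
  ultimately show ?thesis by (auto simp: min_def)
qed

lemma gker_symbol_finite:
  fixes \<xi> :: "real^'n"
  assumes s: "0 < s" "s < 1" and \<xi>: "norm \<xi> = 1"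
  shows "gker_symbol s \<xi> < \<infinity>"
proof -
  have "gker_symbol s \<xi> \<le> (\<integral>\<^sup>+h. 4 * ennreal (gker s (h :: real^'n) * min 1 ((norm h)\<^sup>2)) \<partial>lborel)"
    unfolding gker_symbol_def
  proof (rule nn_integral_mono)
    fix h :: "real^'n"
    have "(\<xi> \<bullet> h)\<^sup>2 \<le> (norm h)\<^sup>2"
      using Cauchy_Schwarz_ineq2[of \<xi> h] \<xi> by (intro abs_le_square_iff[THEN iffD1]) simp
    then have "(norm (cis (\<xi> \<bullet> h) - 1))\<^sup>2 \<le> 4 * min 1 ((norm h)\<^sup>2)"
      by (intro order_trans[OF norm_cis_minus_1_sq_le]) auto
    then have "gker s h * (norm (cis (\<xi> \<bullet> h) - 1))\<^sup>2 \<le> gker s h * (4 * min 1 ((norm h)\<^sup>2))"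
      by (intro mult_left_mono) auto
    then have "ennreal (gker s h * (norm (cis (\<xi> \<bullet> h) - 1))\<^sup>2) \<le> ennreal (4 * (gker s h * min 1 ((norm h)\<^sup>2)))"
      by (intro ennreal_leI) (simp add: mult_ac)
    then show "ennreal (gker s h * (norm (cis (\<xi> \<bullet> h) - 1))\<^sup>2) \<le> 4 * ennreal (gker s h * min 1 ((norm h)\<^sup>2))"
      by (simp add: ennreal_mult')
  qed
  also have "\<dots> < \<infinity>"
    using gker_min_integrable[OF s, where 'n='n] by (subst nn_integral_cmult) (auto simp: ennreal_mult_less_top)
  finally show ?thesis .
qed

text \<open>Rotate \<open>\<xi>\<close> to \<open>|\<xi>| e\<close>, then rescale \<open>h\<close>.\<close>

lemma gker_symbol_homogeneous:
  fixes \<xi> e :: "real^'n"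
  assumes e: "norm e = 1"
  shows "gker_symbol s \<xi> = ennreal (norm \<xi> powr (2 * s)) * gker_symbol s e"
proof (cases "\<xi> = 0")
  case False
  define a where "a = norm \<xi>"
  have a: "0 < a" using False by (simp add: a_def)
  obtain T where T: "orthogonal_transformation T" "T e = (1 / a) *\<^sub>R \<xi>"
    using orthogonal_transformation_exists[of e "(1 / a) *\<^sub>R \<xi>"] e a by (auto simp: a_def)
  have in_T: "\<xi> \<bullet> T h = a * (e \<bullet> h)" for h
  proof -
    have "\<xi> = a *\<^sub>R T e" using T a by simp
    then show ?thesis using T(1) by (simp add: orthogonal_transformation_def)
  qed
  have nT: "norm (T h) = norm h" for h using T(1) by (rule orthogonal_transformation_norm)
  have "gker_symbol s \<xi> = (\<integral>\<^sup>+h. ennreal (gker s (T h) * (norm (cis (\<xi> \<bullet> T h) - 1))\<^sup>2) \<partial>lborel)"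
    unfolding gker_symbol_def by (rule nn_integral_orthogonal[OF _ T(1), symmetric]) measurable
  also have "\<dots> = (\<integral>\<^sup>+h. ennreal (gker s h * (norm (cis (a * (e \<bullet> h)) - 1))\<^sup>2) \<partial>lborel)"
    by (simp add: in_T gker_def nT)
  \<comment> \<open>The kernel is homogeneous of degree \<open>- (N + 2 * s)\<close>. Of the
    compensating factor, \<open>a ^ N\<close> is the Jacobian of the dilation and
    \<open>a powr (2 * s)\<close> remains.\<close>
  also have "\<dots> = (\<integral>\<^sup>+h. ennreal (a powr (real CARD('n) + 2 * s)) * ennreal (gker s (a *\<^sub>R h) * (norm (cis (e \<bullet> (a *\<^sub>R h)) - 1))\<^sup>2) \<partial>lborel)"
    using a by (intro nn_integral_cong, subst ennreal_mult'[symmetric])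
      (simp_all add: gker_def powr_mult mult.assoc[symmetric] powr_add[symmetric])
  also have "\<dots> = ennreal (a powr (2 * s)) * (ennreal (\<bar>a\<bar> ^ CARD('n)) * (\<integral>\<^sup>+h. ennreal (gker s (a *\<^sub>R h) * (norm (cis (e \<bullet> (a *\<^sub>R h)) - 1))\<^sup>2) \<partial>lborel))"
  proof -
    have "ennreal (a powr (real CARD('n) + 2 * s)) = ennreal (a powr (2 * s)) * ennreal (\<bar>a\<bar> ^ CARD('n))"
      using a by (simp add: powr_add powr_realpow ennreal_mult'[symmetric] mult.commute)
    then show ?thesis by (subst nn_integral_cmult) (measurable, simp only: mult.assoc)
  qed
  also have "ennreal (\<bar>a\<bar> ^ CARD('n)) * (\<integral>\<^sup>+h. ennreal (gker s (a *\<^sub>R h) * (norm (cis (e \<bullet> (a *\<^sub>R h)) - 1))\<^sup>2) \<partial>lborel)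
      = gker_symbol s e"
    unfolding gker_symbol_def using a
    by (subst nn_integral_scale[of "\<lambda>h. ennreal (gker s h * (norm (cis (e \<bullet> h) - 1))\<^sup>2)" a]) simp_all
  finally show ?thesis by (simp add: a_def)
qed (simp add: gker_symbol_def)

text \<open>The constant \<open>\<kappa>\<close> of the overview. Every unit vector gives the same
  value, by \<open>gker_symbol_homogeneous\<close>, so the choice of the coordinate is
  immaterial.\<close>

definition gker_const :: "'n::finite itself \<Rightarrow> real \<Rightarrow> real" where
  "gker_const _ s = enn2real (gker_symbol s (axis (SOME i. True) 1 :: real^'n))"

lemma gker_const_nonneg [simp]: "0 \<le> gker_const T s"
  by (simp add: gker_const_def)

lemma gker_symbol_eq:
  fixes \<xi> :: "real^'n"
  assumes "0 < s" "s < 1"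
  shows "gker_symbol s \<xi> = ennreal (gker_const TYPE('n) s * norm \<xi> powr (2 * s))"
proof -
  let ?e = "axis (SOME i. True) 1 :: real^'n"
  have e: "norm ?e = 1" by simp
  have "gker_symbol s ?e = ennreal (gker_const TYPE('n) s)"
    unfolding gker_const_def using gker_symbol_finite[OF assms e] by (simp add: less_top)
  then show ?thesis
    using gker_symbol_homogeneous[OF e, of s \<xi>] by (simp add: ennreal_mult mult.commute)
qed

text \<open>Plancherel for each difference, integrated against the kernel, produces
  \<open>gker_symbol\<close>, which is \<open>\<kappa> |\<xi>|^(2 s)\<close>; a second use of
  Plancherel returns to \<open>w\<close>. Bounded support makes \<open>v\<close> integrable, so that
  \<open>F\<close> is a genuine Fourier integral and a translation becomes a factor
  \<open>cis (\<xi> \<bullet> h)\<close>.\<close>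

lemma gagliardo_sq_half_laplacian:
  fixes v :: "real^'n \<Rightarrow> real"
  assumes s: "0 < s" "s < 1"
    and v: "v \<in> L2_space" and supp: "AE x in lborel. x \<notin> ball 0 R \<longrightarrow> v x = 0"
    and w: "has_half_laplacian s v w"
  shows "gagliardo_sq s v = ennreal (gker_const TYPE('n) s) * sqn w"
proof -
  let ?P = "ennreal ((2 * pi) ^ CARD('n))"
  let ?F = "fourier_integral (\<lambda>x. complex_of_real (v x))"
  have [measurable]: "v \<in> borel_measurable borel" using v by (rule L2_spaceD)
  obtain F where F: "(\<lambda>x. complex_of_real (v x)) has_fourier_transform F"
    "(\<lambda>x. complex_of_real (w x)) has_fourier_transform (\<lambda>\<xi>. of_real (norm \<xi> powr s) * F \<xi>)"
    using w by (auto simp: has_half_laplacian_def)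
  have [measurable]: "F \<in> borel_measurable borel"
    using F(1) by (simp add: has_fourier_transform_def L2_space_def)
  have iv: "integrable lborel v" by (rule integrable_of_bounded_support[OF v supp])
  have ae: "AE \<xi> in lborel. F \<xi> = ?F \<xi>" by (rule fourier_transform_bounded_support[OF v supp F(1)])
  have diff: "?P * sqn (fdiff h v) = (\<integral>\<^sup>+\<xi>. ennreal ((norm (cis (\<xi> \<bullet> h) - 1))\<^sup>2 * (norm (?F \<xi>))\<^sup>2) \<partial>lborel)" for h
  proof -
    have "sqn (fdiff h v) \<le> 4 * sqn v" by (rule sqn_fdiff_le) simp
    also have "\<dots> < \<infinity>" using v by (simp add: L2_space_iff ennreal_mult_less_top)
    finally have L2: "fdiff h v \<in> L2_space" unfolding L2_space_iff by (intro conjI) measurable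
    have "integrable lborel (fdiff h v)"
      using iv lborel_integral_shift(1)[OF iv, of h] by (simp add: fdiff_def[abs_def])
    from plancherel[OF this L2] show ?thesis
      by (simp add: fourier_integral_fdiff[OF iv] norm_mult power_mult_distrib)
  qed
  have "?P * gagliardo_sq s v = (\<integral>\<^sup>+h. ennreal (gker s h) * (?P * sqn (fdiff h v)) \<partial>lborel)"
    unfolding gagliardo_sq_fdiff[OF \<open>v \<in> borel_measurable borel\<close>]
    by (subst nn_integral_cmult[symmetric]) (auto intro!: nn_integral_cong simp: mult_ac)
  also have "\<dots> = (\<integral>\<^sup>+h. \<integral>\<^sup>+\<xi>. ennreal (gker s h * (norm (cis (\<xi> \<bullet> h) - 1))\<^sup>2) * ennreal ((norm (?F \<xi>))\<^sup>2) \<partial>lborel \<partial>lborel)"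
    unfolding diff
    by (intro nn_integral_cong, subst nn_integral_cmult[symmetric])
      (auto intro!: nn_integral_cong simp: ennreal_mult' mult.assoc)
  also have "\<dots> = (\<integral>\<^sup>+\<xi>. \<integral>\<^sup>+h. ennreal (gker s h * (norm (cis (\<xi> \<bullet> h) - 1))\<^sup>2) * ennreal ((norm (?F \<xi>))\<^sup>2) \<partial>lborel \<partial>lborel)"
    by (rule lborel_pair.Fubini') measurable
  also have "\<dots> = (\<integral>\<^sup>+\<xi>. gker_symbol s \<xi> * ennreal ((norm (?F \<xi>))\<^sup>2) \<partial>lborel)"
    unfolding gker_symbol_def by (intro nn_integral_cong nn_integral_multc) measurable
  also have "\<dots> = (\<integral>\<^sup>+\<xi>. ennreal (gker_const TYPE('n) s) * ennreal ((norm (of_real (norm \<xi> powr s) * F \<xi>))\<^sup>2) \<partial>lborel)"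
  proof (rule nn_integral_cong_AE)
    show "AE \<xi> in lborel. gker_symbol s \<xi> * ennreal ((norm (?F \<xi>))\<^sup>2)
      = ennreal (gker_const TYPE('n) s) * ennreal ((norm (of_real (norm \<xi> powr s) * F \<xi>))\<^sup>2)"
      using ae
    proof eventually_elim
      fix \<xi> :: "real^'n" assume "F \<xi> = ?F \<xi>"
      moreover have "norm \<xi> powr (2 * s) = (norm \<xi> powr s)\<^sup>2"
        by (simp add: power2_eq_square flip: powr_add)
      ultimately show "gker_symbol s \<xi> * ennreal ((norm (?F \<xi>))\<^sup>2)
        = ennreal (gker_const TYPE('n) s) * ennreal ((norm (of_real (norm \<xi> powr s) * F \<xi>))\<^sup>2)"
        by (simp add: gker_symbol_eq[OF s] norm_mult power_mult_distrib ennreal_mult mult.assoc)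
    qed
  qed
  also have "\<dots> = ennreal (gker_const TYPE('n) s) * (\<integral>\<^sup>+\<xi>. ennreal ((norm (of_real (norm \<xi> powr s) * F \<xi>))\<^sup>2) \<partial>lborel)"
    by (intro nn_integral_cmult) measurable
  also have "\<dots> = ?P * (ennreal (gker_const TYPE('n) s) * sqn w)"
    unfolding fourier_transform_plancherel[OF F(2)] by (simp only: mult_ac)
  finally show ?thesis by (simp add: ennreal_mult_cancel_left)
qed

section \<open>Pairings in \<open>L2\<close> and additivity of the half-Laplacian\<close>

lemma L2_space_add:
  fixes f g :: "real^'n \<Rightarrow> 'b::{banach, second_countable_topology}"
  assumes "f \<in> L2_space" "g \<in> L2_space"
  shows "(\<lambda>x. f x + g x) \<in> L2_space"
proof -
  have [measurable]: "f \<in> borel_measurable borel" "g \<in> borel_measurable borel"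
    using assms by (simp_all add: L2_space_def)
  have "integrable lborel (\<lambda>x. (norm (f x + g x))\<^sup>2)"
  proof (rule Bochner_Integration.integrable_bound)
    show "integrable lborel (\<lambda>x. 2 * (norm (f x))\<^sup>2 + 2 * (norm (g x))\<^sup>2)"
      using assms by (simp add: L2_space_def)
    have "(norm (f x + g x))\<^sup>2 \<le> 2 * (norm (f x))\<^sup>2 + 2 * (norm (g x))\<^sup>2" for x
      by (rule order_trans[OF power_mono[OF norm_triangle_ineq] square_add_le]) simp
    then show "AE x in lborel. norm ((norm (f x + g x))\<^sup>2) \<le> norm (2 * (norm (f x))\<^sup>2 + 2 * (norm (g x))\<^sup>2)"
      by simp
  qed measurable
  then show ?thesis by (simp add: L2_space_def)
qed

lemma L2_space_integrable_mult:
  fixes f g :: "real^'n \<Rightarrow> real"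
  assumes "f \<in> L2_space" "g \<in> L2_space"
  shows "integrable lborel (\<lambda>x. f x * g x)"
proof (rule Bochner_Integration.integrable_bound)
  have [measurable]: "f \<in> borel_measurable borel" "g \<in> borel_measurable borel"
    using assms by (simp_all add: L2_space_def)
  show "(\<lambda>x. f x * g x) \<in> borel_measurable lborel" by measurable
  show "integrable lborel (\<lambda>x. (f x)\<^sup>2 + (g x)\<^sup>2)" using assms by (simp add: L2_space_def)
  have "\<bar>f x * g x\<bar> \<le> (f x)\<^sup>2 + (g x)\<^sup>2" for x
  proof -
    have "2 * (\<bar>f x\<bar> * \<bar>g x\<bar>) \<le> (f x)\<^sup>2 + (g x)\<^sup>2" using sum_squares_bound[of "\<bar>f x\<bar>" "\<bar>g x\<bar>"] by simp
    moreover have "0 \<le> \<bar>f x\<bar> * \<bar>g x\<bar>" by simp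
    ultimately show ?thesis unfolding abs_mult by linarith
  qed
  then show "AE x in lborel. norm (f x * g x) \<le> norm ((f x)\<^sup>2 + (g x)\<^sup>2)" by simp
qed

lemma L2_norm_sq: "(L2_norm f)\<^sup>2 = (\<integral>x. (norm (f x))\<^sup>2 \<partial>lborel)"
  by (simp add: L2_norm_def)

lemma L2_norm_sq_add:
  fixes f g :: "real^'n \<Rightarrow> real"
  assumes f: "f \<in> L2_space" and g: "g \<in> L2_space"
  shows "(L2_norm (\<lambda>x. f x + g x))\<^sup>2 = (L2_norm f)\<^sup>2 + 2 * L2_pairing f g + (L2_norm g)\<^sup>2"
proof -
  have i: "integrable lborel (\<lambda>x. (f x)\<^sup>2)" "integrable lborel (\<lambda>x. (g x)\<^sup>2)" "integrable lborel (\<lambda>x. f x * g x)"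
    using f g L2_space_integrable_mult[OF f g] by (simp_all add: L2_space_def)
  have "(\<integral>x. (f x + g x)\<^sup>2 \<partial>lborel) = (\<integral>x. (f x)\<^sup>2 + 2 * (f x * g x) + (g x)\<^sup>2 \<partial>lborel)"
    by (intro Bochner_Integration.integral_cong) (auto simp: power2_sum)
  then show ?thesis using i by (simp add: L2_norm_sq L2_pairing_def)
qed

lemma L2_Cauchy_Schwarz:
  fixes f g :: "real^'n \<Rightarrow> real"
  assumes f: "f \<in> L2_space" and g: "g \<in> L2_space"
  shows "\<bar>L2_pairing f g\<bar> \<le> L2_norm f * L2_norm g"
proof -
  have i: "integrable lborel (\<lambda>x. (f x)\<^sup>2)" "integrable lborel (\<lambda>x. (g x)\<^sup>2)" "integrable lborel (\<lambda>x. f x * g x)"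
    using f g L2_space_integrable_mult[OF f g] by (simp_all add: L2_space_def)
  have quad: "0 \<le> (L2_norm f)\<^sup>2 + 2 * t * L2_pairing f g + t\<^sup>2 * (L2_norm g)\<^sup>2" for t
  proof -
    have "0 \<le> (\<integral>x. (f x + t * g x)\<^sup>2 \<partial>lborel)" by simp
    also have "\<dots> = (\<integral>x. (f x)\<^sup>2 + 2 * t * (f x * g x) + t\<^sup>2 * (g x)\<^sup>2 \<partial>lborel)"
      by (intro Bochner_Integration.integral_cong) (auto simp: power2_sum power_mult_distrib)
    also have "\<dots> = (L2_norm f)\<^sup>2 + 2 * t * L2_pairing f g + t\<^sup>2 * (L2_norm g)\<^sup>2"
      using i by (simp add: L2_norm_sq L2_pairing_def)
    finally show ?thesis .
  qed
  let ?p = "L2_pairing f g"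
  have "?p\<^sup>2 \<le> (L2_norm f * L2_norm g)\<^sup>2"
  proof (cases "L2_norm g = 0")
    case True
    have "?p = 0"
    proof (rule ccontr)
      assume p: "?p \<noteq> 0"
      \<comment> \<open>With \<open>L2_norm g = 0\<close> the quadratic is affine in
        \<open>t\<close>; this choice makes it \<open>- (L2_norm f)^2 - 2\<close>, which is
        negative.\<close>
      define t where "t = - ((L2_norm f)\<^sup>2 + 1) / ?p"
      have "t * ?p = - ((L2_norm f)\<^sup>2 + 1)" using p by (simp add: t_def)
      moreover have "0 \<le> (L2_norm f)\<^sup>2 + 2 * (t * ?p)" using quad[of t] True by simp
      ultimately show False using zero_le_power2[of "L2_norm f"] by linarith
    qed
    then show ?thesis by simp
  next
    case False
    then have g2: "0 < (L2_norm g)\<^sup>2" by simp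
    \<comment> \<open>The minimiser of the quadratic.\<close>
    define G t where "G = (L2_norm g)\<^sup>2" and "t = - ?p / G"
    have "t * ?p = - (?p\<^sup>2 / G)" "t\<^sup>2 * G = ?p\<^sup>2 / G"
      using g2 by (simp_all add: t_def G_def power2_eq_square)
    then have "0 \<le> ((L2_norm f)\<^sup>2 - ?p\<^sup>2 / (L2_norm g)\<^sup>2)"
      using quad[of t] by (simp add: G_def)
    then show ?thesis using g2 by (simp add: field_simps power_mult_distrib)
  qed
  then have "\<bar>?p\<bar> \<le> \<bar>L2_norm f * L2_norm g\<bar>" by (simp only: abs_le_square_iff)
  then show ?thesis by (simp add: abs_mult)
qed

lemma of_real_truncate_eq:
  "indicator A x * complex_of_real a = complex_of_real (indicator A x * a)"
  by (simp add: indicator_def)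

lemma has_fourier_transform_add:
  fixes u v :: "real^'n \<Rightarrow> real"
  assumes u: "(\<lambda>x. complex_of_real (u x)) has_fourier_transform F"
    and v: "(\<lambda>x. complex_of_real (v x)) has_fourier_transform G"
  shows "(\<lambda>x. complex_of_real (u x + v x)) has_fourier_transform (\<lambda>\<xi>. F \<xi> + G \<xi>)"
proof -
  have L2: "u \<in> L2_space" "v \<in> L2_space"
    using u v by (auto simp: has_fourier_transform_def intro: of_real_L2_spaceD)
  have [measurable]: "u \<in> borel_measurable borel" "v \<in> borel_measurable borel"
    using L2 by (simp_all add: L2_spaceD)
  have FG: "F \<in> L2_space" "G \<in> L2_space" using u v by (simp_all add: has_fourier_transform_def)
  have [measurable]: "F \<in> borel_measurable borel" "G \<in> borel_measurable borel"
    using FG by (simp_all add: L2_space_def)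
  let ?T = "\<lambda>R w. fourier_integral (\<lambda>x. indicator (ball 0 R) x * complex_of_real (w x))"
  let ?E = "\<lambda>H w R. \<integral>\<^sup>+\<xi>. ennreal ((norm (H \<xi> - ?T R w \<xi>))\<^sup>2) \<partial>lborel"
  have add: "?T R (\<lambda>x. u x + v x) \<xi> = ?T R u \<xi> + ?T R v \<xi>" for R \<xi>
  proof -
    have i: "integrable lborel (\<lambda>x. cis (- (\<xi> \<bullet> x)) * (indicator (ball 0 R) x * complex_of_real (w x)))"
      if "w \<in> L2_space" for w
      unfolding of_real_truncate_eq
      by (rule integrable_cis_mult[OF integrable_of_real[OF truncate_integrable[OF that]]]) measurable
    show ?thesis
      unfolding fourier_integral_def of_real_add distrib_left
      by (rule Bochner_Integration.integral_add[OF i[OF L2(1)] i[OF L2(2)]])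
  qed
  have le: "?E (\<lambda>\<xi>. F \<xi> + G \<xi>) (\<lambda>x. u x + v x) R \<le> 2 * ?E F u R + 2 * ?E G v R" for R
  proof -
    have "?E (\<lambda>\<xi>. F \<xi> + G \<xi>) (\<lambda>x. u x + v x) R
      \<le> (\<integral>\<^sup>+\<xi>. 2 * ennreal ((norm (F \<xi> - ?T R u \<xi>))\<^sup>2) + 2 * ennreal ((norm (G \<xi> - ?T R v \<xi>))\<^sup>2) \<partial>lborel)"
    proof (rule nn_integral_mono)
      fix \<xi> :: "real^'n"
      let ?a = "F \<xi> - ?T R u \<xi>" and ?b = "G \<xi> - ?T R v \<xi>"
      have "F \<xi> + G \<xi> - ?T R (\<lambda>x. u x + v x) \<xi> = ?a + ?b" unfolding add by simp
      moreover have "(norm (?a + ?b))\<^sup>2 \<le> 2 * (norm ?a)\<^sup>2 + 2 * (norm ?b)\<^sup>2"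
        by (rule order_trans[OF power_mono[OF norm_triangle_ineq] square_add_le]) simp
      ultimately have "ennreal ((norm (F \<xi> + G \<xi> - ?T R (\<lambda>x. u x + v x) \<xi>))\<^sup>2)
          \<le> ennreal (2 * (norm ?a)\<^sup>2 + 2 * (norm ?b)\<^sup>2)" by (intro ennreal_leI) (simp only:)
      then show "ennreal ((norm (F \<xi> + G \<xi> - ?T R (\<lambda>x. u x + v x) \<xi>))\<^sup>2)
          \<le> 2 * ennreal ((norm ?a)\<^sup>2) + 2 * ennreal ((norm ?b)\<^sup>2)" by (simp add: ennreal_mult')
    qed
    also have "\<dots> = 2 * ?E F u R + 2 * ?E G v R"
      by (subst nn_integral_add, measurable, subst (1 2) nn_integral_cmult, measurable)
    finally show ?thesis .
  qed
  have "((\<lambda>R. 2 * ?E F u R + 2 * ?E G v R) \<longlongrightarrow> 2 * 0 + 2 * 0) at_top"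
    using u v unfolding has_fourier_transform_def
    by (intro tendsto_add tendsto_mult_ennreal tendsto_const) auto
  then have "(?E (\<lambda>\<xi>. F \<xi> + G \<xi>) (\<lambda>x. u x + v x) \<longlongrightarrow> 0) at_top"
    by (intro tendsto_0_ennreal_mono[OF le]) simp
  moreover have "(\<lambda>x. complex_of_real (u x + v x)) \<in> L2_space"
    using L2_space_add[OF L2] by (simp add: L2_space_def del: of_real_add)
  ultimately show ?thesis
    using L2_space_add[OF FG] unfolding has_fourier_transform_def by blast
qed

text \<open>It lets the energy of a sum be expanded as the square of a sum in
  \<open>L2\<close>.\<close>

lemma has_half_laplacian_add:
  fixes u v :: "real^'n \<Rightarrow> real"
  assumes "has_half_laplacian s u U" "has_half_laplacian s v V"
  shows "has_half_laplacian s (\<lambda>x. u x + v x) (\<lambda>x. U x + V x)"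
proof -
  obtain F G where F: "(\<lambda>x. complex_of_real (u x)) has_fourier_transform F"
      "(\<lambda>x. complex_of_real (U x)) has_fourier_transform (\<lambda>\<xi>. of_real (norm \<xi> powr s) * F \<xi>)"
    and G: "(\<lambda>x. complex_of_real (v x)) has_fourier_transform G"
      "(\<lambda>x. complex_of_real (V x)) has_fourier_transform (\<lambda>\<xi>. of_real (norm \<xi> powr s) * G \<xi>)"
    using assms unfolding has_half_laplacian_def by blast
  show ?thesis
    unfolding has_half_laplacian_def
    using has_fourier_transform_add[OF F(1) G(1)] has_fourier_transform_add[OF F(2) G(2)]
    by (intro exI[of _ "\<lambda>\<xi>. F \<xi> + G \<xi>"]) (simp add: distrib_left)
qed

lemma has_half_laplacian_L2:
  fixes u :: "real^'n \<Rightarrow> real"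
  assumes "has_half_laplacian s u U"
  shows "U \<in> L2_space"
  using assms unfolding has_half_laplacian_def has_fourier_transform_def by (auto intro: of_real_L2_spaceD)

section \<open>The energy identity\<close>

text \<open>The squared seminorm as a real number. An infinite seminorm would be sent to
  \<open>0\<close>, so the value carries information on \<open>Hs_space\<close> only.\<close>

definition gagl :: "real \<Rightarrow> (real^'n \<Rightarrow> real) \<Rightarrow> real" where
  "gagl s v = enn2real (gagliardo_sq s v)"

lemma gagl_nonneg [simp]: "0 \<le> gagl s v" by (simp add: gagl_def)

lemma Hs_spaceD:
  assumes "v \<in> Hs_space s"
  shows "v \<in> L2_space" "gagliardo_sq s v = ennreal (gagl s v)"
  using assms by (simp_all add: Hs_space_def gagl_def less_top)

lemma X0_space_bounded_support:
  assumes "v \<in> X0_space s \<Omega>" "\<Omega> \<subseteq> ball 0 R"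
  shows "AE x in lborel. x \<notin> ball 0 R \<longrightarrow> v x = 0"
proof -
  have "AE x in lborel. x \<notin> \<Omega> \<longrightarrow> v x = 0" using assms by (simp add: X0_space_def)
  then show ?thesis by eventually_elim (use assms in auto)
qed

text \<open>Polarisation is carried out on the Fourier side, where the squared seminorm is
  \<open>\<kappa>\<close> times a squared \<open>L2\<close> norm: the cross term is then exactly the
  left side of the weak equation tested with \<open>v\<close>. In terms of the energy,
  \<open>gagl s v / 2\<close> is the excess of \<open>u + v\<close> over \<open>u\<close>.\<close>

lemma weak_solution_energy:
  fixes u v :: "real^'n \<Rightarrow> real"
  assumes s: "0 < s" "s < 1" and \<Omega>: "bounded \<Omega>"
    and u: "weak_solution s \<Omega> f u" and v: "v \<in> X0_space s \<Omega>"
  shows "gagl s (\<lambda>x. u x + v x) = gagl s u + 2 * gker_const TYPE('n) s * L2_pairing f v + gagl s v"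
proof -
  let ?k = "gker_const TYPE('n) s"
  have k: "0 \<le> ?k" by (simp add: gker_const_def)
  obtain R where R: "\<Omega> \<subseteq> ball 0 R" using bounded_subset_ballD[OF \<Omega>] by blast
  have uX: "u \<in> X0_space s \<Omega>" using u by (simp add: weak_solution_def)
  obtain U V where U: "has_half_laplacian s u U" and V: "has_half_laplacian s v V"
    and eq: "L2_pairing U V = L2_pairing f v"
    using u v by (auto simp: weak_solution_def)
  have L2: "u \<in> L2_space" "v \<in> L2_space" using uX v by (auto simp: X0_space_def Hs_spaceD)
  have UV: "U \<in> L2_space" "V \<in> L2_space" using U V by (auto intro: has_half_laplacian_L2)
  have g: "gagl s w = ?k * (L2_norm W)\<^sup>2"
    if "w \<in> L2_space" "AE x in lborel. x \<notin> ball 0 R \<longrightarrow> w x = 0" "has_half_laplacian s w W" for w W :: "real^'n \<Rightarrow> real"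
    using gagliardo_sq_half_laplacian[OF s that] sqn_eq_L2_norm[OF has_half_laplacian_L2[OF that(3)]] k
    by (simp add: gagl_def enn2real_mult)
  have suppu: "AE x in lborel. x \<notin> ball 0 R \<longrightarrow> u x = 0" and suppv: "AE x in lborel. x \<notin> ball 0 R \<longrightarrow> v x = 0"
    by (rule X0_space_bounded_support[OF uX R] X0_space_bounded_support[OF v R])+
  then have supp: "AE x in lborel. x \<notin> ball 0 R \<longrightarrow> u x + v x = 0" by eventually_elim auto
  show ?thesis
    unfolding g[OF L2(1) suppu U] g[OF L2(2) suppv V] g[OF L2_space_add[OF L2] supp has_half_laplacian_add[OF U V]]
      L2_norm_sq_add[OF UV] eq by (simp add: algebra_simps)
qed

section \<open>Differences in \<open>L2\<close> controlled by the seminorm\<close>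

text \<open>Two terms with factor \<open>2\<close> give the \<open>4\<close>; the power of
  \<open>2\<close> arises since increments up to length \<open>2 |h|\<close> occur, where the kernel
  is at least \<open>(2 |h|) powr - (N + 2 s)\<close>; the volume comes from averaging over a
  ball.\<close>

definition shift_const :: "'n::finite itself \<Rightarrow> real \<Rightarrow> real" where
  "shift_const _ s = 4 * 2 powr (real CARD('n) + 2 * s) / unit_ball_vol (real CARD('n))"

lemma shift_const_pos: "0 < shift_const T s"
  unfolding shift_const_def by (intro divide_pos_pos mult_pos_pos unit_ball_vol_pos) auto

text \<open>
  Average the triangle inequality \<open>D h v = D (h - z) v (\<cdot> + z) + D z v\<close> over \<open>|z| < |h|\<close>.
\<close>

lemma sqn_fdiff_le_gagliardo:
  fixes v :: "real^'n \<Rightarrow> real"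
  assumes s: "0 < s" and [measurable]: "v \<in> borel_measurable borel"
  shows "sqn (fdiff h v) \<le> ennreal (shift_const TYPE('n) s * norm h powr (2 * s)) * gagliardo_sq s v"
proof (cases "h = 0")
  case True
  then show ?thesis by (simp add: sqn_def fdiff_def)
next
  case False
  define r where "r = norm h"
  have r: "0 < r" using False by (simp add: r_def)
  let ?N = "real CARD('n)"
  let ?p = "?N + 2 * s"
  let ?V = "unit_ball_vol ?N"
  have V: "0 < ?V" by (rule unit_ball_vol_pos) simp
  \<comment> \<open>At \<open>z = 0\<close> the kernel has the value \<open>0\<close> and bounds
    nothing, but there the difference vanishes as well.\<close>
  have weight: "ennreal (indicator A z) * sqn (fdiff z v) \<le> ennreal ((2 * r) powr ?p) * (ennreal (gker s z) * sqn (fdiff z v))"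
    if "A \<subseteq> ball 0 (2 * r)" for A and z :: "real^'n"
  proof (cases "z \<in> A \<and> z \<noteq> 0")
    case True
    then have z: "0 < norm z" "norm z < 2 * r" using that by auto
    then have "norm z powr ?p \<le> (2 * r) powr ?p" using s by (intro powr_mono2) auto
    then have "1 \<le> (2 * r) powr ?p * gker s z"
      using z unfolding gker_def powr_minus by (simp add: field_simps)
    then have "ennreal 1 * sqn (fdiff z v) \<le> ennreal ((2 * r) powr ?p * gker s z) * sqn (fdiff z v)"
      by (intro mult_right_mono ennreal_leI) auto
    then show ?thesis using True by (simp add: ennreal_mult' mult.assoc)
  next
    case False
    moreover have "sqn (fdiff 0 v) = 0" by (simp add: sqn_def fdiff_def)
    ultimately show ?thesis by (cases "z = 0") (auto simp: indicator_def)
  qed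
  have bound: "(\<integral>\<^sup>+z. ennreal (indicator A z) * sqn (fdiff z v) \<partial>lborel) \<le> ennreal ((2 * r) powr ?p) * gagliardo_sq s v"
    if "A \<subseteq> ball 0 (2 * r)" for A :: "(real^'n) set"
    unfolding gagliardo_sq_fdiff[OF assms(2)]
    by (subst nn_integral_cmult[symmetric]) (measurable, rule nn_integral_mono[OF weight[OF that]])
  have tri: "sqn (fdiff h v) \<le> 2 * sqn (fdiff (h - z) v) + 2 * sqn (fdiff z v)" for z
  proof -
    have "sqn (fdiff h v) \<le> 2 * sqn (\<lambda>x. fdiff (h - z) v (x + z)) + 2 * sqn (fdiff z v)"
      by (intro sqn_le_add) (auto simp: fdiff_def algebra_simps)
    then show ?thesis by simp
  qed
  let ?B = "ball (0::real^'n) r"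
  let ?C = "ball h r"
  have "ennreal (?V * r ^ CARD('n)) * sqn (fdiff h v) = (\<integral>\<^sup>+z. ennreal (indicator ?B z) * sqn (fdiff h v) \<partial>lborel)"
    using r by (subst nn_integral_multc) (auto simp: emeasure_ball ennreal_indicator)
  also have "\<dots> \<le> (\<integral>\<^sup>+z. 2 * (ennreal (indicator ?B z) * sqn (fdiff (h - z) v)) + 2 * (ennreal (indicator ?B z) * sqn (fdiff z v)) \<partial>lborel)"
  proof (rule nn_integral_mono)
    fix z
    show "ennreal (indicator ?B z) * sqn (fdiff h v)
      \<le> 2 * (ennreal (indicator ?B z) * sqn (fdiff (h - z) v)) + 2 * (ennreal (indicator ?B z) * sqn (fdiff z v))"
      using tri[of z] by (auto simp: indicator_def)
  qed
  also have "\<dots> = 2 * (\<integral>\<^sup>+z. ennreal (indicator ?B z) * sqn (fdiff (h - z) v) \<partial>lborel)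
      + 2 * (\<integral>\<^sup>+z. ennreal (indicator ?B z) * sqn (fdiff z v) \<partial>lborel)"
    by (subst nn_integral_add, measurable, subst (1 2) nn_integral_cmult, measurable)
  \<comment> \<open>The reflection \<open>z \<mapsto> h - z\<close> carries the ball around
    \<open>0\<close> to the ball of the same radius around \<open>h\<close>; both lie in the ball of
    radius \<open>2 |h|\<close>.\<close>
  also have "(\<integral>\<^sup>+z. ennreal (indicator ?B z) * sqn (fdiff (h - z) v) \<partial>lborel)
      = (\<integral>\<^sup>+z. ennreal (indicator ?C (h - z)) * sqn (fdiff (h - z) v) \<partial>lborel)"
    by (intro nn_integral_cong) (auto simp: indicator_def dist_norm)
  also have "\<dots> = (\<integral>\<^sup>+z. ennreal (indicator ?C z) * sqn (fdiff z v) \<partial>lborel)"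
    by (rule nn_integral_reflect[of "\<lambda>z. ennreal (indicator ?C z) * sqn (fdiff z v)"]) measurable
  also have "2 * \<dots> + 2 * (\<integral>\<^sup>+z. ennreal (indicator ?B z) * sqn (fdiff z v) \<partial>lborel)
      \<le> 2 * (ennreal ((2 * r) powr ?p) * gagliardo_sq s v) + 2 * (ennreal ((2 * r) powr ?p) * gagliardo_sq s v)"
  proof (intro add_mono mult_left_mono bound)
    show "?C \<subseteq> ball 0 (2 * r)"
    proof
      fix z assume "z \<in> ?C"
      then show "z \<in> ball 0 (2 * r)"
        using norm_triangle_ineq[of h "z - h"] by (simp add: dist_norm r_def norm_minus_commute)
    qed
    show "?B \<subseteq> ball 0 (2 * r)" using r by auto
  qed auto
  also have "\<dots> = ennreal (4 * (2 * r) powr ?p) * gagliardo_sq s v"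
    by (simp add: ennreal_mult' mult.assoc flip: distrib_right)
  finally have le: "ennreal (?V * r ^ CARD('n)) * sqn (fdiff h v) \<le> ennreal (4 * (2 * r) powr ?p) * gagliardo_sq s v" .
  define c where "c = ?V * r ^ CARD('n)"
  have c: "0 < c" using V r by (simp add: c_def)
  have "ennreal (1 / c) * ennreal c = 1" using c by (simp flip: ennreal_mult')
  then have "sqn (fdiff h v) = ennreal (1 / c) * (ennreal c * sqn (fdiff h v))"
    by (simp flip: mult.assoc)
  also have "\<dots> \<le> ennreal (1 / c) * (ennreal (4 * (2 * r) powr ?p) * gagliardo_sq s v)"
    using le by (intro mult_left_mono) (simp_all add: c_def)
  also have "\<dots> = ennreal (1 / c * (4 * (2 * r) powr ?p)) * gagliardo_sq s v"
  proof -
    have "ennreal (1 / c) * ennreal X = ennreal (1 / c * X)" for X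
      by (rule ennreal_mult'[symmetric]) (use c in simp)
    then show ?thesis by (simp only: mult.assoc[symmetric])
  qed
  also have "1 / c * (4 * (2 * r) powr ?p) = shift_const TYPE('n) s * r powr (2 * s)"
    using r V by (simp add: c_def shift_const_def powr_mult powr_add powr_realpow field_simps)
  finally show ?thesis by (simp add: r_def)
qed

lemma gagl_fdiff_le:
  fixes v :: "real^'n \<Rightarrow> real"
  assumes s: "0 < s" and v: "v \<in> Hs_space s"
  shows "sqn (fdiff h v) \<le> ennreal (shift_const TYPE('n) s * norm h powr (2 * s) * gagl s v)"
  using sqn_fdiff_le_gagliardo[OF s L2_spaceD[OF Hs_spaceD(1)[OF v]], of h]
  by (simp add: Hs_spaceD(2)[OF v] ennreal_mult'[symmetric] less_imp_le[OF shift_const_pos])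

section \<open>Localized translations\<close>

text \<open>
  Splitting \<open>w (x + z) - w x\<close> into the convex combination of \<open>D z u (x + h)\<close> and \<open>D z u x\<close> with
  weight \<open>\<phi> x\<close>, and the rest \<open>(\<phi> (x + z) - \<phi> x) * D h u (x + z)\<close>.
\<close>

lemma sqn_fdiff_localized_shift:
  fixes u \<phi> :: "real^'n \<Rightarrow> real" and h :: "real^'n"
  assumes [measurable]: "u \<in> borel_measurable borel" "\<phi> \<in> borel_measurable borel"
    and \<phi>: "\<And>x. 0 \<le> \<phi> x" "\<And>x. \<phi> x \<le> 1"
    and lip: "\<And>x y. \<bar>\<phi> x - \<phi> y\<bar> \<le> L * norm (x - y)" and d: "0 < d" and L: "0 \<le> L"
  defines "w \<equiv> \<lambda>x. \<phi> x * u (x + h) + (1 - \<phi> x) * u x"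
  shows "sqn (fdiff z w) \<le> ennreal ((1 + d) * (1 + L * norm h)) * sqn (fdiff z u)
    + ennreal ((1 + 1 / d) * (max 1 (L\<^sup>2) * min 1 ((norm z)\<^sup>2))) * sqn (fdiff h u)"
proof -
  let ?D = "fdiff z u"
  let ?M = "max 1 (L\<^sup>2) * min 1 ((norm z)\<^sup>2)"
  have osc: "(\<phi> (x + z) - \<phi> x)\<^sup>2 \<le> ?M" for x
  proof -
    have a: "\<bar>\<phi> (x + z) - \<phi> x\<bar> \<le> 1" using \<phi>[of x] \<phi>[of "x + z"] by linarith
    have b: "\<bar>\<phi> (x + z) - \<phi> x\<bar> \<le> L * norm z" using lip[of "x + z" x] by simp
    have a2: "(\<phi> (x + z) - \<phi> x)\<^sup>2 \<le> 1" using power_mono[OF a, of 2] by simp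
    have b2: "(\<phi> (x + z) - \<phi> x)\<^sup>2 \<le> L\<^sup>2 * (norm z)\<^sup>2" using power_mono[OF b, of 2] by (simp add: power_mult_distrib)
    show ?thesis
    proof (cases "1 \<le> (norm z)\<^sup>2")
      case True then show ?thesis using a2 by simp
    next
      case False
      have "L\<^sup>2 * (norm z)\<^sup>2 \<le> max 1 (L\<^sup>2) * (norm z)\<^sup>2" by (intro mult_right_mono) auto
      then show ?thesis using b2 False by simp
    qed
  qed
  have pt: "(fdiff z w x)\<^sup>2 \<le> (1 + d) * (\<phi> x * (?D (x + h))\<^sup>2 + (1 - \<phi> x) * (?D x)\<^sup>2)
      + (1 + 1 / d) * (?M * (fdiff h u (x + z))\<^sup>2)" for x
  proof -
    define a b c e where "a = ?D (x + h)" and "b = ?D x" and "c = \<phi> x" and "e = (\<phi> (x + z) - \<phi> x) * fdiff h u (x + z)"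
    have "fdiff z w x = (c * a + (1 - c) * b) + e"
      by (simp add: a_def b_def c_def e_def fdiff_def w_def algebra_simps)
    \<comment> \<open>Young's inequality with a free weight \<open>d\<close>: the main part keeps a
      coefficient close to \<open>1\<close>, and the cut-off error pays
      \<open>1 + 1 / d\<close>.\<close>
    moreover have "((c * a + (1 - c) * b) + e)\<^sup>2 \<le> (1 + d) * (c * a + (1 - c) * b)\<^sup>2 + (1 + 1 / d) * e\<^sup>2"
    proof -
      define q where "q = c * a + (1 - c) * b"
      have "0 \<le> (d * q - e)\<^sup>2 / d" using d by simp
      also have "(d * q - e)\<^sup>2 / d = d * q\<^sup>2 + e\<^sup>2 / d - 2 * q * e"
        using d by (simp add: field_simps power2_eq_square)
      finally show ?thesis unfolding q_def[symmetric] by (simp add: algebra_simps power2_sum)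
    qed
    moreover have "(c * a + (1 - c) * b)\<^sup>2 \<le> c * a\<^sup>2 + (1 - c) * b\<^sup>2"
    proof -
      have "c * a\<^sup>2 + (1 - c) * b\<^sup>2 - (c * a + (1 - c) * b)\<^sup>2 = c * (1 - c) * (a - b)\<^sup>2"
        by (simp add: algebra_simps power2_eq_square)
      moreover have "0 \<le> c * (1 - c) * (a - b)\<^sup>2" using \<phi>[of x] by (simp add: c_def)
      ultimately show ?thesis by linarith
    qed
    moreover have "e\<^sup>2 \<le> ?M * (fdiff h u (x + z))\<^sup>2"
      unfolding e_def power_mult_distrib using osc[of x] by (intro mult_right_mono) auto
    ultimately have "(fdiff z w x)\<^sup>2 \<le> (1 + d) * (c * a\<^sup>2 + (1 - c) * b\<^sup>2) + (1 + 1 / d) * (?M * (fdiff h u (x + z))\<^sup>2)"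
      using d by (smt (verit) mult_left_mono divide_nonneg_nonneg)
    then show ?thesis by (simp add: a_def b_def c_def)
  qed
  have nn: "0 \<le> 1 - \<phi> x" for x using \<phi>[of x] by simp
  have nnM: "0 \<le> ?M" by simp
  have [measurable]: "w \<in> borel_measurable borel" unfolding w_def by measurable
  have "sqn (fdiff z w) \<le> (\<integral>\<^sup>+x. ennreal (1 + d) * (ennreal (\<phi> x * (?D (x + h))\<^sup>2) + ennreal ((1 - \<phi> x) * (?D x)\<^sup>2))
      + ennreal ((1 + 1 / d) * ?M) * ennreal ((fdiff h u (x + z))\<^sup>2) \<partial>lborel)"
    unfolding sqn_def
  proof (rule nn_integral_mono)
    fix x
    have "ennreal ((fdiff z w x)\<^sup>2) \<le> ennreal ((1 + d) * (\<phi> x * (?D (x + h))\<^sup>2 + (1 - \<phi> x) * (?D x)\<^sup>2)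
      + (1 + 1 / d) * ?M * (fdiff h u (x + z))\<^sup>2)" using pt[of x] by (intro ennreal_leI) (simp only: mult.assoc)
    also have "\<dots> = ennreal (1 + d) * (ennreal (\<phi> x * (?D (x + h))\<^sup>2) + ennreal ((1 - \<phi> x) * (?D x)\<^sup>2))
      + ennreal ((1 + 1 / d) * ?M) * ennreal ((fdiff h u (x + z))\<^sup>2)"
      using d \<phi>(1)[of x] nn[of x] nnM
      by (subst ennreal_plus, simp, simp, subst (1 2) ennreal_mult, simp_all del: ennreal_plus, simp add: ennreal_plus)
    finally show "ennreal ((fdiff z w x)\<^sup>2) \<le> ennreal (1 + d) * (ennreal (\<phi> x * (?D (x + h))\<^sup>2) + ennreal ((1 - \<phi> x) * (?D x)\<^sup>2))
      + ennreal ((1 + 1 / d) * ?M) * ennreal ((fdiff h u (x + z))\<^sup>2)" .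
  qed
  also have "\<dots> = ennreal (1 + d) * ((\<integral>\<^sup>+x. ennreal (\<phi> x * (?D (x + h))\<^sup>2) \<partial>lborel) + (\<integral>\<^sup>+x. ennreal ((1 - \<phi> x) * (?D x)\<^sup>2) \<partial>lborel))
      + ennreal ((1 + 1 / d) * ?M) * sqn (\<lambda>x. fdiff h u (x + z))"
    unfolding sqn_def
    by (subst nn_integral_add, measurable, subst (1 2) nn_integral_cmult, measurable, subst nn_integral_add, measurable)
  \<comment> \<open>Translating the first integral moves its weight to
    \<open>\<phi> (x - h)\<close>. The two weights no longer add up to \<open>1\<close>, but by the
    Lipschitz bound exceed it by at most \<open>L |h|\<close>.\<close>
  also have "(\<integral>\<^sup>+x. ennreal (\<phi> x * (?D (x + h))\<^sup>2) \<partial>lborel) = (\<integral>\<^sup>+x. ennreal (\<phi> (x - h) * (?D x)\<^sup>2) \<partial>lborel)"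
    using nn_integral_shift[of "\<lambda>x. ennreal (\<phi> (x - h) * (?D x)\<^sup>2)" h] by simp
  also have "(\<integral>\<^sup>+x. ennreal (\<phi> (x - h) * (?D x)\<^sup>2) \<partial>lborel) + (\<integral>\<^sup>+x. ennreal ((1 - \<phi> x) * (?D x)\<^sup>2) \<partial>lborel)
      = (\<integral>\<^sup>+x. ennreal (\<phi> (x - h) * (?D x)\<^sup>2) + ennreal ((1 - \<phi> x) * (?D x)\<^sup>2) \<partial>lborel)"
    by (rule nn_integral_add[symmetric]) measurable
  also have "\<dots> \<le> (\<integral>\<^sup>+x. ennreal (1 + L * norm h) * ennreal ((?D x)\<^sup>2) \<partial>lborel)"
  proof (rule nn_integral_mono)
    fix x
    have "\<phi> (x - h) - \<phi> x \<le> L * norm h" using lip[of "x - h" x] by simp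
    then have "(\<phi> (x - h) + (1 - \<phi> x)) * (?D x)\<^sup>2 \<le> (1 + L * norm h) * (?D x)\<^sup>2" by (intro mult_right_mono) auto
    then have "ennreal (\<phi> (x - h) * (?D x)\<^sup>2 + (1 - \<phi> x) * (?D x)\<^sup>2) \<le> ennreal ((1 + L * norm h) * (?D x)\<^sup>2)"
      by (intro ennreal_leI) (simp only: distrib_right)
    then show "ennreal (\<phi> (x - h) * (?D x)\<^sup>2) + ennreal ((1 - \<phi> x) * (?D x)\<^sup>2) \<le> ennreal (1 + L * norm h) * ennreal ((?D x)\<^sup>2)"
      using \<phi>(1)[of "x - h"] nn[of x] L by (simp add: ennreal_plus[symmetric] ennreal_mult[symmetric] del: ennreal_plus)
  qed
  also have "\<dots> = ennreal (1 + L * norm h) * sqn ?D"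
    unfolding sqn_def by (rule nn_integral_cmult) measurable
  also have "ennreal (1 + d) * (ennreal (1 + L * norm h) * sqn ?D) = ennreal ((1 + d) * (1 + L * norm h)) * sqn ?D"
    using d L by (simp add: ennreal_mult mult.assoc)
  also have "sqn (\<lambda>x. fdiff h u (x + z)) = sqn (fdiff h u)" by simp
  finally show ?thesis by (simp add: add_mono mult_left_mono)
qed

text \<open>With \<open>d = |h|^s\<close> and \<open>|h| \<le> d \<le> 1\<close>, the product
  \<open>(1 + d) * (1 + L * |h|)\<close> is at most \<open>1 + (1 + 2 * L) * d\<close>, and
  \<open>(1 + 1 / d) * d^2 \<le> 2 * d\<close> produces the last summand.\<close>

definition loc_const :: "'n::finite itself \<Rightarrow> real \<Rightarrow> real \<Rightarrow> real" where
  "loc_const T s L = 1 + 2 * L + 2 * max 1 (L\<^sup>2) * gker_mass T s * shift_const T s"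

lemma loc_const_nonneg: "0 \<le> L \<Longrightarrow> 0 \<le> loc_const T s L"
  unfolding loc_const_def gker_mass_def
  by (intro add_nonneg_nonneg mult_nonneg_nonneg) (auto simp: less_imp_le[OF shift_const_pos])

lemma Hs_space_diff:
  fixes v w :: "real^'n \<Rightarrow> real"
  assumes v: "v \<in> Hs_space s" and w: "w \<in> Hs_space s"
  shows "(\<lambda>x. v x - w x) \<in> Hs_space s"
    and "gagl s (\<lambda>x. v x - w x) \<le> 2 * gagl s v + 2 * gagl s w"
proof -
  have [measurable]: "v \<in> borel_measurable borel" "w \<in> borel_measurable borel"
    using v w by (auto intro: L2_spaceD Hs_spaceD)
  have "sqn (\<lambda>x. v x - w x) \<le> 2 * sqn v + 2 * sqn (\<lambda>x. - w x)"
    by (intro sqn_le_add) auto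
  also have "\<dots> < \<infinity>"
    using v w by (simp add: sqn_minus Hs_space_def L2_space_iff ennreal_mult_less_top)
  finally have 1: "(\<lambda>x. v x - w x) \<in> L2_space" unfolding L2_space_iff by (intro conjI) measurable
  have le: "sqn (fdiff z (\<lambda>x. v x - w x)) \<le> 2 * sqn (fdiff z v) + 2 * sqn (fdiff z w)" for z
  proof -
    have "sqn (fdiff z (\<lambda>x. v x - w x)) \<le> 2 * sqn (fdiff z v) + 2 * sqn (\<lambda>x. - fdiff z w x)"
      by (intro sqn_le_add) (auto simp: fdiff_def)
    then show ?thesis by (simp add: sqn_minus)
  qed
  have [measurable]: "(\<lambda>x. v x - w x) \<in> borel_measurable borel" by measurable
  have "gagliardo_sq s (\<lambda>x. v x - w x) \<le> (\<integral>\<^sup>+z. 2 * (ennreal (gker s z) * sqn (fdiff z v)) + 2 * (ennreal (gker s z) * sqn (fdiff z w)) \<partial>lborel)"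
    unfolding gagliardo_sq_fdiff[OF \<open>(\<lambda>x. v x - w x) \<in> borel_measurable borel\<close>]
  proof (rule nn_integral_mono)
    fix z :: "real^'n"
    have "ennreal (gker s z) * sqn (fdiff z (\<lambda>x. v x - w x)) \<le> ennreal (gker s z) * (2 * sqn (fdiff z v) + 2 * sqn (fdiff z w))"
      by (intro mult_left_mono le) simp
    then show "ennreal (gker s z) * sqn (fdiff z (\<lambda>x. v x - w x)) \<le> 2 * (ennreal (gker s z) * sqn (fdiff z v)) + 2 * (ennreal (gker s z) * sqn (fdiff z w))"
      by (simp add: distrib_left mult.left_commute)
  qed
  also have "\<dots> = 2 * gagliardo_sq s v + 2 * gagliardo_sq s w"
    by (subst nn_integral_add, measurable, subst (1 2) nn_integral_cmult, measurable)
      (simp add: gagliardo_sq_fdiff)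
  also have "\<dots> = ennreal (2 * gagl s v + 2 * gagl s w)"
    using v w by (simp add: Hs_spaceD ennreal_mult)
  finally have le: "gagliardo_sq s (\<lambda>x. v x - w x) \<le> ennreal (2 * gagl s v + 2 * gagl s w)" .
  then show "(\<lambda>x. v x - w x) \<in> Hs_space s" using 1 by (simp add: Hs_space_def le_less_trans[OF le])
  show "gagl s (\<lambda>x. v x - w x) \<le> 2 * gagl s v + 2 * gagl s w"
    using enn2real_mono[OF le] by (simp add: gagl_def[of s "\<lambda>x. v x - w x"] del: ennreal_plus)
qed

text \<open>The weight in the localized estimate is taken as \<open>d = |h|^s\<close>. It balances
  the loss \<open>d\<close> in the main term against the cut-off error, which is
  \<open>1 / d\<close> times the order \<open>|h|^(2 s)\<close> of the squared difference of
  \<open>u\<close>.\<close>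

lemma localized_shift_Hs:
  fixes u \<phi> :: "real^'n \<Rightarrow> real" and h :: "real^'n"
  assumes s: "0 < s" "s < 1" and u: "u \<in> Hs_space s"
    and [measurable]: "\<phi> \<in> borel_measurable borel"
    and \<phi>: "\<And>x. 0 \<le> \<phi> x" "\<And>x. \<phi> x \<le> 1"
    and lip: "\<And>x y. \<bar>\<phi> x - \<phi> y\<bar> \<le> L * norm (x - y)" and L: "0 \<le> L"
    and h: "norm h \<le> 1" "h \<noteq> 0"
  defines "w \<equiv> \<lambda>x. \<phi> x * u (x + h) + (1 - \<phi> x) * u x"
  shows "w \<in> Hs_space s"
    and "gagl s w \<le> (1 + loc_const TYPE('n) s L * norm h powr s) * gagl s u"
proof -
  have uL2: "u \<in> L2_space" using u by (rule Hs_spaceD)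
  then have [measurable]: "u \<in> borel_measurable borel" by (rule L2_spaceD)
  have wm [measurable]: "w \<in> borel_measurable borel" unfolding w_def by measurable
  have "sqn w \<le> 2 * sqn (\<lambda>x. \<phi> x * u (x + h)) + 2 * sqn (\<lambda>x. (1 - \<phi> x) * u x)"
    unfolding w_def by (intro sqn_le_add) auto
  also have "\<dots> \<le> 2 * sqn (\<lambda>x. u (x + h)) + 2 * sqn u"
    using \<phi> by (intro add_mono mult_left_mono sqn_mono) (auto simp: abs_mult intro!: mult_left_le_one_le)
  also have "\<dots> < \<infinity>" using uL2 by (simp add: L2_space_iff ennreal_mult_less_top)
  finally have wL2: "w \<in> L2_space" unfolding L2_space_iff by (intro conjI wm)
  define d where "d = norm h powr s"
  define g where "g = gagl s u"
  define M where "M = max 1 (L\<^sup>2)"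
  define J where "J = gker_mass TYPE('n) s"
  define K where "K = shift_const TYPE('n) s"
  have d: "0 < d" "d \<le> 1" "norm h \<le> d"
  proof -
    show "0 < d" using h by (simp add: d_def)
    show "d \<le> 1" unfolding d_def using powr_mono2[of s "norm h" 1] h s by simp
    show "norm h \<le> d" unfolding d_def using powr_mono'[of s 1 "norm h"] h s by simp
  qed
  have nn: "0 \<le> g" "1 \<le> M" "0 \<le> J" "0 \<le> K"
    by (auto simp: g_def M_def J_def K_def gker_mass_def less_imp_le[OF shift_const_pos])
  have g: "gagliardo_sq s u = ennreal g" unfolding g_def using u by (rule Hs_spaceD)
  have J: "(\<integral>\<^sup>+z. ennreal (gker s (z :: real^'n) * min 1 ((norm z)\<^sup>2)) \<partial>lborel) = ennreal J"
    unfolding J_def gker_mass_def using gker_min_integrable[OF s, where 'n='n] by (simp add: less_top)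
  have Dh: "sqn (fdiff h u) \<le> ennreal (K * d\<^sup>2 * g)"
  proof -
    have "norm h powr (2 * s) = d\<^sup>2" by (simp add: d_def power2_eq_square flip: powr_add)
    then show ?thesis using gagl_fdiff_le[OF s(1) u, of h] by (simp add: K_def g_def)
  qed
  let ?a = "(1 + d) * (1 + L * norm h)" and ?b = "1 + 1 / d"
  have a0: "0 \<le> ?a" using d L by simp
  have "gagliardo_sq s w \<le> (\<integral>\<^sup>+z. ennreal ?a * (ennreal (gker s z) * sqn (fdiff z u))
      + ennreal (?b * M) * sqn (fdiff h u) * ennreal (gker s z * min 1 ((norm z)\<^sup>2)) \<partial>lborel)"
    unfolding gagliardo_sq_fdiff[OF wm]
  proof (rule nn_integral_mono)
    fix z :: "real^'n"
    have "ennreal (gker s z) * sqn (fdiff z w) \<le> ennreal (gker s z) * (ennreal ?a * sqn (fdiff z u)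
      + ennreal (?b * (M * min 1 ((norm z)\<^sup>2))) * sqn (fdiff h u))"
      unfolding w_def M_def
      by (intro mult_left_mono sqn_fdiff_localized_shift \<phi> lip d(1) L) auto
    also have "ennreal (?b * (M * min 1 ((norm z)\<^sup>2))) = ennreal (?b * M) * ennreal (min 1 ((norm z)\<^sup>2))"
      using d nn by (simp add: mult.assoc[symmetric] ennreal_mult del: ennreal_plus)
    finally show "ennreal (gker s z) * sqn (fdiff z w) \<le> ennreal ?a * (ennreal (gker s z) * sqn (fdiff z u))
      + ennreal (?b * M) * sqn (fdiff h u) * ennreal (gker s z * min 1 ((norm z)\<^sup>2))"
      by (simp add: distrib_left ennreal_mult mult_ac)
  qed
  also have "\<dots> = ennreal ?a * ennreal g + ennreal (?b * M) * sqn (fdiff h u) * ennreal J"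
    unfolding g[symmetric] J[symmetric] gagliardo_sq_fdiff[OF \<open>u \<in> borel_measurable borel\<close>]
    by (subst nn_integral_add, measurable, subst (1 2) nn_integral_cmult, measurable)
  also have "\<dots> \<le> ennreal ?a * ennreal g + ennreal (?b * M) * ennreal (K * d\<^sup>2 * g) * ennreal J"
    by (intro add_mono mult_right_mono mult_left_mono Dh) auto
  also have "\<dots> = ennreal (?a * g + ?b * M * (K * d\<^sup>2 * g) * J)"
    using a0 d nn by (simp add: ennreal_mult ennreal_plus del: ennreal_plus[symmetric])
  also have "\<dots> \<le> ennreal ((1 + loc_const TYPE('n) s L * d) * g)"
  proof (rule ennreal_leI)
    have "L * norm h \<le> L * d" using d L by (intro mult_left_mono) auto
    moreover have "d * (L * norm h) \<le> 1 * (L * d)" using d L by (intro mult_mono) auto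
    ultimately have a: "?a \<le> 1 + (1 + 2 * L) * d" by (simp add: algebra_simps)
    have "?b * d\<^sup>2 = d\<^sup>2 + d" using d by (simp add: field_simps power2_eq_square)
    also have "\<dots> \<le> 2 * d" using d by (simp add: power2_eq_square mult_left_le_one_le)
    finally have b: "?b * d\<^sup>2 \<le> 2 * d" .
    have "?a * g + ?b * M * (K * d\<^sup>2 * g) * J = (?a + (?b * d\<^sup>2) * (M * K * J)) * g"
      by (simp add: algebra_simps)
    also have "\<dots> \<le> ((1 + (1 + 2 * L) * d) + (2 * d) * (M * K * J)) * g"
      using a b nn by (intro mult_right_mono add_mono) auto
    also have "\<dots> = (1 + loc_const TYPE('n) s L * d) * g"
      by (simp add: loc_const_def M_def K_def J_def algebra_simps)
    finally show "?a * g + ?b * M * (K * d\<^sup>2 * g) * J \<le> (1 + loc_const TYPE('n) s L * d) * g" .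
  qed
  finally have le: "gagliardo_sq s w \<le> ennreal ((1 + loc_const TYPE('n) s L * d) * g)" .
  have nn2: "0 \<le> (1 + loc_const TYPE('n) s L * d) * g"
    using loc_const_nonneg[OF L] d nn by (intro mult_nonneg_nonneg add_nonneg_nonneg) auto
  show "w \<in> Hs_space s" using le wL2 by (simp add: Hs_space_def le_less_trans[OF le])
  show "gagl s w \<le> (1 + loc_const TYPE('n) s L * norm h powr s) * gagl s u"
    using enn2real_mono[OF le] nn2 by (simp add: gagl_def[of s w] d_def g_def)
qed

text \<open>Near \<open>x0\<close> the cone condition keeps \<open>x + h\<close> outside
  \<open>\<Omega>\<close> whenever \<open>x\<close> is, so both values of \<open>u\<close> vanish
  there; farther away the cut-off vanishes. Adding this function to \<open>u\<close> gives the
  competitor.\<close>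

lemma localized_difference_X0:
  fixes u \<phi> :: "real^'n \<Rightarrow> real" and h :: "real^'n"
  assumes s: "0 < s" "s < 1" and u: "u \<in> X0_space s \<Omega>"
    and m: "\<phi> \<in> borel_measurable borel"
    and \<phi>: "\<And>x. 0 \<le> \<phi> x" "\<And>x. \<phi> x \<le> 1"
    and lip: "\<And>x y. \<bar>\<phi> x - \<phi> y\<bar> \<le> L * norm (x - y)" and L: "0 \<le> L"
    and supp: "\<And>x. x \<notin> ball x\<^sub>0 (3 * \<rho>) \<Longrightarrow> \<phi> x = 0"
    and n: "n \<in> cone_directions \<rho> \<theta> x\<^sub>0 \<Omega>" and h: "h \<in> cone \<rho> \<theta> n" "norm h \<le> 1"
  shows "(\<lambda>x. \<phi> x * fdiff h u x) \<in> X0_space s \<Omega>"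
proof -
  have h0: "h \<noteq> 0" using h by (auto simp: cone_def)
  have uH: "u \<in> Hs_space s" and ae: "AE x in lborel. x \<notin> \<Omega> \<longrightarrow> u x = 0"
    using u by (simp_all add: X0_space_def)
  have "(\<lambda>x. (\<phi> x * u (x + h) + (1 - \<phi> x) * u x) - u x) \<in> Hs_space s"
    by (rule Hs_space_diff(1)[OF localized_shift_Hs(1)[OF s uH m \<phi> lip L h(2) h0] uH])
  also have "(\<lambda>x. (\<phi> x * u (x + h) + (1 - \<phi> x) * u x) - u x) = (\<lambda>x. \<phi> x * fdiff h u x)"
    by (auto simp: fdiff_def algebra_simps)
  finally have 1: "(\<lambda>x. \<phi> x * fdiff h u x) \<in> Hs_space s" .
  have "AE x in lborel. x \<notin> \<Omega> \<longrightarrow> \<phi> x * fdiff h u x = 0"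
    using ae AE_shift[OF ae, of h]
  proof eventually_elim
    fix x assume x: "x \<notin> \<Omega> \<longrightarrow> u x = 0" and xh: "x + h \<notin> \<Omega> \<longrightarrow> u (x + h) = 0"
    show "x \<notin> \<Omega> \<longrightarrow> \<phi> x * fdiff h u x = 0"
    proof (cases "x \<in> ball x\<^sub>0 (3 * \<rho>)")
      case True
      then have "x \<notin> \<Omega> \<longrightarrow> x + h \<notin> \<Omega>"
        using n h(1) by (auto simp: cone_directions_def)
      then show ?thesis using x xh by (auto simp: fdiff_def)
    qed (simp add: supp)
  qed
  then show ?thesis using 1 by (simp add: X0_space_def)
qed

text \<open>The energy identity expresses the left side as the growth of the seminorm from
  \<open>u\<close> to the competitor minus \<open>2 \<kappa>\<close> times the pairing with
  \<open>f\<close>. The growth is \<open>O(|h|^s)\<close> by convexity, the pairing because the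
  increment of \<open>u\<close> is \<open>O(|h|^s)\<close> in \<open>L2\<close>.\<close>

lemma localized_difference_gagl:
  fixes u \<phi> :: "real^'n \<Rightarrow> real" and h :: "real^'n"
  assumes s: "0 < s" "s < 1" and \<Omega>: "bounded \<Omega>" and f: "f \<in> L2_space"
    and u: "weak_solution s \<Omega> f u"
    and m [measurable]: "\<phi> \<in> borel_measurable borel"
    and \<phi>: "\<And>x. 0 \<le> \<phi> x" "\<And>x. \<phi> x \<le> 1"
    and lip: "\<And>x y. \<bar>\<phi> x - \<phi> y\<bar> \<le> L * norm (x - y)" and L: "0 \<le> L"
    and supp: "\<And>x. x \<notin> ball x\<^sub>0 (3 * \<rho>) \<Longrightarrow> \<phi> x = 0"
    and n: "n \<in> cone_directions \<rho> \<theta> x\<^sub>0 \<Omega>" and h: "h \<in> cone \<rho> \<theta> n" "norm h \<le> 1"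
  shows "gagl s (\<lambda>x. \<phi> x * fdiff h u x) \<le> norm h powr s * (loc_const TYPE('n) s L * gagl s u
    + 2 * gker_const TYPE('n) s * L2_norm f * sqrt (shift_const TYPE('n) s * gagl s u))"
proof -
  let ?v = "\<lambda>x. \<phi> x * fdiff h u x"
  let ?k = "gker_const TYPE('n) s"
  let ?K = "shift_const TYPE('n) s"
  have h0: "h \<noteq> 0" using h by (auto simp: cone_def)
  have uX: "u \<in> X0_space s \<Omega>" using u by (simp add: weak_solution_def)
  have uH: "u \<in> Hs_space s" using uX by (simp add: X0_space_def)
  have [measurable]: "u \<in> borel_measurable borel" using uH by (auto intro: L2_spaceD Hs_spaceD)
  have vX: "?v \<in> X0_space s \<Omega>" by (rule localized_difference_X0[OF s uX m \<phi> lip L supp n h])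
  have vL2: "?v \<in> L2_space" using vX by (auto simp: X0_space_def intro: Hs_spaceD)
  have "gagl s (\<lambda>x. u x + ?v x) = gagl s u + 2 * ?k * L2_pairing f ?v + gagl s ?v"
    by (rule weak_solution_energy[OF s \<Omega> u vX])
  moreover have "(\<lambda>x. u x + ?v x) = (\<lambda>x. \<phi> x * u (x + h) + (1 - \<phi> x) * u x)"
    by (auto simp: fdiff_def algebra_simps)
  moreover have "gagl s (\<lambda>x. \<phi> x * u (x + h) + (1 - \<phi> x) * u x) \<le> (1 + loc_const TYPE('n) s L * norm h powr s) * gagl s u"
    by (rule localized_shift_Hs(2)[OF s uH m \<phi> lip L h(2) h0])
  ultimately have 1: "gagl s ?v \<le> loc_const TYPE('n) s L * norm h powr s * gagl s u - 2 * ?k * L2_pairing f ?v"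
    by (simp add: algebra_simps)
  have "sqn ?v \<le> sqn (fdiff h u)"
    using \<phi> by (intro sqn_mono) (auto simp: abs_mult intro!: mult_left_le_one_le)
  also have "\<dots> \<le> ennreal (?K * norm h powr (2 * s) * gagl s u)" by (rule gagl_fdiff_le[OF s(1) uH])
  also have "?K * norm h powr (2 * s) * gagl s u = (norm h powr s * sqrt (?K * gagl s u))\<^sup>2"
  proof -
    have "norm h powr (2 * s) = (norm h powr s)\<^sup>2" by (simp add: power2_eq_square flip: powr_add)
    then show ?thesis by (simp add: power_mult_distrib less_imp_le[OF shift_const_pos])
  qed
  finally have "L2_norm ?v \<le> norm h powr s * sqrt (?K * gagl s u)"
    by (intro L2_norm_le L2_spaceD vL2) (simp_all add: less_imp_le[OF shift_const_pos])
  then have "L2_norm f * L2_norm ?v \<le> L2_norm f * (norm h powr s * sqrt (?K * gagl s u))"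
    by (intro mult_left_mono) auto
  then have "- L2_pairing f ?v \<le> L2_norm f * (norm h powr s * sqrt (?K * gagl s u))"
    using L2_Cauchy_Schwarz[OF f vL2] by linarith
  then have "2 * ?k * (- L2_pairing f ?v) \<le> 2 * ?k * (L2_norm f * (norm h powr s * sqrt (?K * gagl s u)))"
    by (intro mult_left_mono) auto
  then show ?thesis using 1 by (simp add: algebra_simps)
qed

lemma gagliardo_sq_cmult:
  fixes v :: "real^'n \<Rightarrow> real"
  assumes [measurable]: "v \<in> borel_measurable borel"
  shows "gagliardo_sq s (\<lambda>x. c * v x) = ennreal (c\<^sup>2) * gagliardo_sq s v"
proof -
  have "fdiff z (\<lambda>x. c * v x) = (\<lambda>x. c * fdiff z v x)" for z
    by (auto simp: fdiff_def algebra_simps)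
  then have "gagliardo_sq s (\<lambda>x. c * v x) = (\<integral>\<^sup>+z. ennreal (c\<^sup>2) * (ennreal (gker s z) * sqn (fdiff z v)) \<partial>lborel)"
    by (subst gagliardo_sq_fdiff) (simp_all add: sqn_cmult mult.left_commute)
  also have "\<dots> = ennreal (c\<^sup>2) * gagliardo_sq s v"
    unfolding gagliardo_sq_fdiff[OF assms] by (rule nn_integral_cmult) measurable
  finally show ?thesis .
qed

lemma gagliardo_sq_shift:
  fixes v :: "real^'n \<Rightarrow> real"
  assumes [measurable]: "v \<in> borel_measurable borel"
  shows "gagliardo_sq s (\<lambda>x. v (x + c)) = gagliardo_sq s v"
proof -
  have "sqn (fdiff z (\<lambda>x. v (x + c))) = sqn (fdiff z v)" for z
  proof -
    have "fdiff z (\<lambda>x. v (x + c)) = (\<lambda>x. fdiff z v (x + c))"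
      by (auto simp: fdiff_def algebra_simps)
    then show ?thesis by simp
  qed
  then show ?thesis by (subst (1 2) gagliardo_sq_fdiff) simp_all
qed

section \<open>The dual norm and the energy estimate\<close>

lemma Hs_norm_nonneg [simp]: "0 \<le> Hs_norm s v"
  by (simp add: Hs_norm_def)

lemma L2_norm_le_Hs_norm: "L2_norm v \<le> Hs_norm s v"
  unfolding Hs_norm_def by (rule real_le_rsqrt) simp

lemma L2_norm_cmult: "L2_norm (\<lambda>x. c * v x :: real) = \<bar>c\<bar> * L2_norm v"
  by (simp add: L2_norm_def power_mult_distrib real_sqrt_mult)

lemma L2_pairing_cmult: "L2_pairing f (\<lambda>x. c * v x) = c * L2_pairing f v"
  unfolding L2_pairing_def by (simp flip: integral_mult_right_zero add: mult_ac)

lemma Hs_space_cmult: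
  fixes v :: "real^'n \<Rightarrow> real"
  assumes v: "v \<in> Hs_space s"
  shows "(\<lambda>x. c * v x) \<in> Hs_space s" and "Hs_norm s (\<lambda>x. c * v x) = \<bar>c\<bar> * Hs_norm s v"
    and "gagl s (\<lambda>x. c * v x) = c\<^sup>2 * gagl s v"
proof -
  have m: "v \<in> borel_measurable borel" using v by (auto intro: L2_spaceD Hs_spaceD)
  show g: "gagl s (\<lambda>x. c * v x) = c\<^sup>2 * gagl s v"
    by (simp add: gagl_def gagliardo_sq_cmult[OF m] enn2real_mult)
  show "(\<lambda>x. c * v x) \<in> Hs_space s"
    using v m by (simp add: Hs_space_def L2_space_iff sqn_cmult gagliardo_sq_cmult ennreal_mult_less_top)
  have "(\<bar>c\<bar> * L2_norm v)\<^sup>2 + c\<^sup>2 * gagl s v = c\<^sup>2 * ((L2_norm v)\<^sup>2 + gagl s v)"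
    by (simp add: power_mult_distrib algebra_simps)
  then show "Hs_norm s (\<lambda>x. c * v x) = \<bar>c\<bar> * Hs_norm s v"
    unfolding Hs_norm_def gagl_def[symmetric] g L2_norm_cmult by (simp add: real_sqrt_mult)
qed

lemma zero_Hs_space: "(\<lambda>x. 0) \<in> Hs_space s" and Hs_norm_zero: "Hs_norm s (\<lambda>x. 0) = 0"
  by (simp_all add: Hs_space_def L2_space_iff sqn_def gagliardo_sq_def Hs_norm_def L2_norm_def)

text \<open>A supremum of reals is informative only for a nonempty bounded set: the zero function
  and the Cauchy-Schwarz bound by \<open>L2_norm f\<close> provide this. The last claim follows by
  normalising \<open>\<phi>\<close>.\<close>

lemma Hdual_norm_bounds:
  fixes f :: "real^'n \<Rightarrow> real"
  assumes f: "f \<in> L2_space"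
  shows "0 \<le> Hdual_norm s f" and "Hdual_norm s f \<le> L2_norm f"
    and "\<phi> \<in> Hs_space s \<Longrightarrow> \<bar>L2_pairing f \<phi>\<bar> \<le> Hdual_norm s f * Hs_norm s \<phi>"
proof -
  let ?S = "{\<phi> \<in> Hs_space s. Hs_norm s \<phi> \<le> 1}"
  have zero: "(\<lambda>x. 0) \<in> ?S" by (simp add: zero_Hs_space Hs_norm_zero)
  have le: "\<bar>L2_pairing f \<phi>\<bar> \<le> L2_norm f * Hs_norm s \<phi>" if "\<phi> \<in> Hs_space s" for \<phi>
    using L2_Cauchy_Schwarz[OF f Hs_spaceD(1)[OF that]]
    by (rule order_trans) (intro mult_left_mono L2_norm_le_Hs_norm L2_norm_nonneg)
  have le1: "\<bar>L2_pairing f \<phi>\<bar> \<le> L2_norm f" if "\<phi> \<in> ?S" for \<phi>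
    using le[of \<phi>] that mult_left_mono[of "Hs_norm s \<phi>" 1 "L2_norm f"] by auto
  then have bdd: "bdd_above ((\<lambda>\<phi>. \<bar>L2_pairing f \<phi>\<bar>) ` ?S)" by (intro bdd_aboveI2)
  have up: "\<bar>L2_pairing f \<phi>\<bar> \<le> Hdual_norm s f" if "\<phi> \<in> ?S" for \<phi>
    unfolding Hdual_norm_def by (rule cSUP_upper[OF that bdd])
  show "0 \<le> Hdual_norm s f" using up[OF zero] by linarith
  show "Hdual_norm s f \<le> L2_norm f"
    unfolding Hdual_norm_def using zero by (intro cSUP_least le1) auto
  show "\<bar>L2_pairing f \<phi>\<bar> \<le> Hdual_norm s f * Hs_norm s \<phi>" if \<phi>: "\<phi> \<in> Hs_space s"
  \<comment> \<open>A function of norm zero cannot be normalised; its pairing vanishes by the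
    \<open>L2\<close> bound.\<close>
  proof (cases "Hs_norm s \<phi> = 0")
    case True
    then show ?thesis using le[OF \<phi>] by simp
  next
    case False
    then have p: "0 < Hs_norm s \<phi>" using Hs_norm_nonneg[of s \<phi>] by linarith
    let ?c = "1 / Hs_norm s \<phi>"
    have "(\<lambda>x. ?c * \<phi> x) \<in> ?S"
      using p Hs_space_cmult(1,2)[OF \<phi>, of ?c] by simp
    from up[OF this] have "?c * \<bar>L2_pairing f \<phi>\<bar> \<le> Hdual_norm s f"
      unfolding L2_pairing_cmult using p by (simp add: abs_mult)
    then show ?thesis using p by (simp add: field_simps)
  qed
qed

text \<open>The constant of \<open>gagl_fdiff_le\<close> for a translation of length
  \<open>d + 1\<close>, where \<open>d\<close> stands for the diameter.\<close>

definition poincare_const :: "'n::finite itself \<Rightarrow> real \<Rightarrow> real \<Rightarrow> real" where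
  "poincare_const T s d = shift_const T s * (d + 1) powr (2 * s)"

lemma poincare_const_nonneg [simp]: "0 \<le> poincare_const T s d"
  by (simp add: poincare_const_def less_imp_le[OF shift_const_pos])

text \<open>A translation by more than the diameter moves \<open>\<Omega>\<close> off itself.\<close>

lemma fractional_poincare:
  fixes u :: "real^'n \<Rightarrow> real"
  assumes s: "0 < s" and \<Omega>: "bounded \<Omega>" and u: "u \<in> X0_space s \<Omega>"
  shows "(L2_norm u)\<^sup>2 \<le> poincare_const TYPE('n) s (diameter \<Omega>) * gagl s u"
proof -
  let ?d = "diameter \<Omega>"
  have d: "0 \<le> ?d" by (rule diameter_ge_0[OF \<Omega>])
  obtain h :: "real^'n" where h: "norm h = ?d + 1"
    using d vector_choose_size[of "?d + 1"] by auto
  have uH: "u \<in> Hs_space s" and ae: "AE x in lborel. x \<notin> \<Omega> \<longrightarrow> u x = 0"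
    using u by (simp_all add: X0_space_def)
  have "sqn u \<le> sqn (fdiff h u)"
  proof (rule sqn_mono_AE)
    show "AE x in lborel. \<bar>u x\<bar> \<le> \<bar>fdiff h u x\<bar>"
      using ae AE_shift[OF ae, of h]
    proof eventually_elim
      fix x assume x: "x \<notin> \<Omega> \<longrightarrow> u x = 0" and xh: "x + h \<notin> \<Omega> \<longrightarrow> u (x + h) = 0"
      \<comment> \<open>Two points of \<open>\<Omega>\<close> are at most a diameter apart, so at
        least one of the two values of \<open>u\<close> is zero.\<close>
      have "x \<notin> \<Omega> \<or> x + h \<notin> \<Omega>"
        using diameter_bounded_bound[OF \<Omega>, of x "x + h"] h by (auto simp: dist_norm)
      then show "\<bar>u x\<bar> \<le> \<bar>fdiff h u x\<bar>" using x xh by (auto simp: fdiff_def)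
    qed
  qed
  also have "\<dots> \<le> ennreal (poincare_const TYPE('n) s ?d * gagl s u)"
    using gagl_fdiff_le[OF s uH, of h] by (simp add: h poincare_const_def)
  finally show ?thesis
    by (simp add: sqn_eq_L2_norm[OF Hs_spaceD(1)[OF uH]])
qed

definition energy_const :: "'n::finite itself \<Rightarrow> real \<Rightarrow> real \<Rightarrow> real" where
  "energy_const T s d = gker_const T s * sqrt (1 + poincare_const T s d)"

lemma energy_const_nonneg [simp]: "0 \<le> energy_const T s d"
  by (simp add: energy_const_def)

text \<open>Test with \<open>u\<close> itself: for \<open>v = u\<close> the energy identity has
  \<open>4 * gagl s u\<close> on the left, whence \<open>gagl s u\<close> is \<open>\<kappa>\<close>
  times the pairing of \<open>f\<close> and \<open>u\<close>. Duality and Poincare bound this by a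
  multiple of \<open>sqrt (gagl s u)\<close>, one factor of which cancels.\<close>

lemma energy_estimate:
  fixes u :: "real^'n \<Rightarrow> real"
  assumes s: "0 < s" "s < 1" and \<Omega>: "bounded \<Omega>" and f: "f \<in> L2_space"
    and u: "weak_solution s \<Omega> f u"
  shows "sqrt (gagl s u) \<le> energy_const TYPE('n) s (diameter \<Omega>) * Hdual_norm s f"
proof -
  let ?k = "gker_const TYPE('n) s"
  let ?P = "poincare_const TYPE('n) s (diameter \<Omega>)"
  let ?H = "Hdual_norm s f"
  define g where "g = sqrt (gagl s u)"
  have g: "0 \<le> g" "gagl s u = g\<^sup>2" by (simp_all add: g_def)
  have uX: "u \<in> X0_space s \<Omega>" using u by (simp add: weak_solution_def)
  have uH: "u \<in> Hs_space s" using uX by (simp add: X0_space_def)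
  have "gagl s (\<lambda>x. u x + u x) = 4 * gagl s u"
    using Hs_space_cmult(3)[OF uH, of 2] unfolding mult_2 by simp
  then have "gagl s u = ?k * L2_pairing f u"
    using weak_solution_energy[OF s \<Omega> u uX] by simp
  also have "\<dots> \<le> ?k * (?H * Hs_norm s u)"
    using Hdual_norm_bounds(3)[OF f uH] by (intro mult_left_mono) auto
  also have "Hs_norm s u \<le> sqrt (1 + ?P) * g"
  proof -
    have "(L2_norm u)\<^sup>2 + gagl s u \<le> (1 + ?P) * gagl s u"
      using fractional_poincare[OF s(1) \<Omega> uX] by (simp add: algebra_simps)
    then have "Hs_norm s u \<le> sqrt ((1 + ?P) * gagl s u)"
      by (simp add: Hs_norm_def gagl_def)
    then show ?thesis by (simp add: real_sqrt_mult g_def)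
  qed
  finally have "g\<^sup>2 \<le> ?k * (?H * (sqrt (1 + ?P) * g))"
    using Hdual_norm_bounds(1)[OF f] g by (simp add: mult_left_mono)
  then have "g * g \<le> (energy_const TYPE('n) s (diameter \<Omega>) * ?H) * g"
    by (simp add: energy_const_def power2_eq_square mult_ac)
  then have "g \<le> energy_const TYPE('n) s (diameter \<Omega>) * ?H"
    using g(1) Hdual_norm_bounds(1)[OF f, of s] by (cases "g = 0") (auto simp: mult_le_cancel_right)
  then show ?thesis by (simp add: g_def)
qed

definition diff_const :: "'n::finite itself \<Rightarrow> real \<Rightarrow> real \<Rightarrow> real \<Rightarrow> real" where
  "diff_const T s L d = loc_const T s L * (energy_const T s d)\<^sup>2
    + 2 * gker_const T s * sqrt (shift_const T s) * energy_const T s d"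

lemma diff_const_nonneg: "0 \<le> L \<Longrightarrow> 0 \<le> diff_const T s L d"
  unfolding diff_const_def
  by (intro add_nonneg_nonneg mult_nonneg_nonneg loc_const_nonneg)
    (auto simp: less_imp_le[OF shift_const_pos])

text \<open>The product of the two norms appears here. The forcing term is the \<open>L2\<close>
  norm times \<open>sqrt (gagl s u)\<close>, hence times the dual norm; in the other term the
  squared dual norm is weakened to the product, since the dual norm is the smaller one.\<close>

lemma localized_difference_data:
  fixes u \<phi> :: "real^'n \<Rightarrow> real" and h :: "real^'n"
  assumes s: "0 < s" "s < 1" and \<Omega>: "bounded \<Omega>" and f: "f \<in> L2_space"
    and u: "weak_solution s \<Omega> f u"
    and m: "\<phi> \<in> borel_measurable borel"
    and \<phi>: "\<And>x. 0 \<le> \<phi> x" "\<And>x. \<phi> x \<le> 1"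
    and lip: "\<And>x y. \<bar>\<phi> x - \<phi> y\<bar> \<le> L * norm (x - y)" and L: "0 \<le> L"
    and supp: "\<And>x. x \<notin> ball x\<^sub>0 (3 * \<rho>) \<Longrightarrow> \<phi> x = 0"
    and n: "n \<in> cone_directions \<rho> \<theta> x\<^sub>0 \<Omega>" and h: "h \<in> cone \<rho> \<theta> n" "norm h \<le> 1"
  shows "gagl s (\<lambda>x. \<phi> x * fdiff h u x)
    \<le> norm h powr s * diff_const TYPE('n) s L (diameter \<Omega>) * (Hdual_norm s f * L2_norm f)"
proof -
  let ?E = "energy_const TYPE('n) s (diameter \<Omega>)"
  let ?k = "gker_const TYPE('n) s"
  let ?K = "shift_const TYPE('n) s"
  let ?H = "Hdual_norm s f" and ?F = "L2_norm f"
  have H: "0 \<le> ?H" "?H \<le> ?F" using Hdual_norm_bounds[OF f] by auto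
  have g: "sqrt (gagl s u) \<le> ?E * ?H" by (rule energy_estimate[OF s \<Omega> f u])
  have "gagl s u = (sqrt (gagl s u))\<^sup>2" by simp
  also have "\<dots> \<le> (?E * ?H)\<^sup>2" using g by (intro power_mono) auto
  also have "\<dots> = ?E\<^sup>2 * (?H * ?H)" by (simp add: power2_eq_square)
  also have "\<dots> \<le> ?E\<^sup>2 * (?H * ?F)"
    using H by (intro mult_left_mono) auto
  finally have 1: "gagl s u \<le> ?E\<^sup>2 * (?H * ?F)" .
  have 2: "sqrt (?K * gagl s u) \<le> sqrt ?K * (?E * ?H)"
    unfolding real_sqrt_mult using g by (intro mult_left_mono) (auto simp: less_imp_le[OF shift_const_pos])
  have "gagl s (\<lambda>x. \<phi> x * fdiff h u x) \<le> norm h powr s * (loc_const TYPE('n) s L * gagl s u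
    + 2 * ?k * ?F * sqrt (?K * gagl s u))"
    by (rule localized_difference_gagl[OF s \<Omega> f u m \<phi> lip L supp n h])
  also have "\<dots> \<le> norm h powr s * (loc_const TYPE('n) s L * (?E\<^sup>2 * (?H * ?F)) + 2 * ?k * ?F * (sqrt ?K * (?E * ?H)))"
    using 1 2 loc_const_nonneg[OF L] by (intro mult_left_mono add_mono) auto
  also have "\<dots> = norm h powr s * diff_const TYPE('n) s L (diameter \<Omega>) * (?H * ?F)"
    by (simp add: diff_const_def algebra_simps)
  finally show ?thesis .
qed

section \<open>Second differences\<close>

text \<open>The value is \<open>1\<close> up to distance \<open>\<rho>\<close> and \<open>0\<close>
  from \<open>2 * \<rho>\<close> on. The gap up to the radius \<open>3 * \<rho>\<close> of the cone
  condition leaves room for one translation shorter than \<open>\<rho>\<close>.\<close>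

definition cutoff :: "real^'n \<Rightarrow> real \<Rightarrow> real^'n \<Rightarrow> real" where
  "cutoff c \<rho> x = max 0 (min 1 (2 - norm (x - c) / \<rho>))"

lemma cutoff_measurable [measurable]: "cutoff c \<rho> \<in> borel_measurable borel"
  unfolding cutoff_def[abs_def] by measurable

lemma cutoff_bounds: "0 \<le> cutoff c \<rho> x" "cutoff c \<rho> x \<le> 1"
  by (simp_all add: cutoff_def)

lemma cutoff_lipschitz:
  assumes "0 < \<rho>"
  shows "\<bar>cutoff c \<rho> x - cutoff c \<rho> y\<bar> \<le> (1 / \<rho>) * norm (x - y)"
proof -
  have "\<bar>cutoff c \<rho> x - cutoff c \<rho> y\<bar> \<le> \<bar>norm (x - c) / \<rho> - norm (y - c) / \<rho>\<bar>"
    unfolding cutoff_def by linarith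
  also have "\<dots> = (1 / \<rho>) * \<bar>norm (x - c) - norm (y - c)\<bar>"
    using assms by (simp add: diff_divide_distrib[symmetric])
  also have "\<dots> \<le> (1 / \<rho>) * norm (x - y)"
    using norm_triangle_ineq3[of "x - c" "y - c"] assms by (intro mult_left_mono) auto
  finally show ?thesis .
qed

lemma cutoff_eq_0: "0 < \<rho> \<Longrightarrow> 2 * \<rho> \<le> norm (x - c) \<Longrightarrow> cutoff c \<rho> x = 0"
  by (simp add: cutoff_def field_simps)

lemma cutoff_eq_1: "0 < \<rho> \<Longrightarrow> norm (x - c) \<le> \<rho> \<Longrightarrow> cutoff c \<rho> x = 1"
  by (simp add: cutoff_def field_simps)

text \<open>Chosen so that \<open>m * (1 - cos \<theta>) = 2\<close>, which gives
  \<open>(m + 1) * cos \<theta> < m - 1\<close>: an axial vector of length \<open>m |h|\<close>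
  remains in the cone when perturbed by \<open>h\<close>.\<close>

definition cone_ratio :: "real \<Rightarrow> real" where
  "cone_ratio \<theta> = 2 / (1 - cos \<theta>)"

lemma cone_ratio_gt: "0 < \<theta> \<Longrightarrow> \<theta> < pi / 2 \<Longrightarrow> 2 < cone_ratio \<theta>"
proof -
  assume "0 < \<theta>" "\<theta> < pi / 2"
  then have "0 < cos \<theta>" "cos \<theta> < 1"
    using cos_gt_zero[of \<theta>] cos_monotone_0_pi[of 0 \<theta>] by auto
  then show ?thesis by (simp add: cone_ratio_def field_simps)
qed

text \<open>Adding \<open>h\<close> to the axial vector \<open>b\<close> leaves an axial component
  of at least \<open>(m - 1) |h|\<close> and a length of at most \<open>(m + 1) |h|\<close>, where
  \<open>m = cone_ratio \<theta>\<close>. Thus \<open>h\<close> is the difference of the cone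
  elements \<open>b + h\<close> and \<open>b\<close>, both of length comparable to
  \<open>|h|\<close>.\<close>

lemma cone_decomposition:
  fixes n h :: "real^'n"
  assumes \<theta>: "0 < \<theta>" "\<theta> < pi / 2" and n: "norm n = 1" and h: "h \<noteq> 0"
    and small: "(cone_ratio \<theta> + 1) * norm h < \<rho>"
  defines "b \<equiv> (cone_ratio \<theta> * norm h) *\<^sub>R n"
  shows "b \<in> cone \<rho> \<theta> n" "b + h \<in> cone \<rho> \<theta> n"
    "norm b \<le> (cone_ratio \<theta> + 1) * norm h" "norm (b + h) \<le> (cone_ratio \<theta> + 1) * norm h"
proof -
  let ?c = "cos \<theta>"
  let ?m = "cone_ratio \<theta>"
  have c: "0 < ?c" "?c < 1"
    using \<theta> cos_gt_zero[of \<theta>] cos_monotone_0_pi[of 0 \<theta>] by auto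
  have m: "2 < ?m" by (rule cone_ratio_gt[OF \<theta>])
  have "?c \<noteq> 1" using c by simp
  then have mc: "?m * (1 - ?c) = 2" by (simp add: cone_ratio_def field_simps)
  have p: "0 < norm h" using h by simp
  have mp: "0 < ?m * norm h" using m p by simp
  have nb: "norm b = ?m * norm h" using mp n by (simp add: b_def)
  show 1: "norm b \<le> (?m + 1) * norm h" using nb by (simp add: algebra_simps)
  show 2: "norm (b + h) \<le> (?m + 1) * norm h"
    using norm_triangle_ineq[of b h] nb by (simp add: algebra_simps)
  have nn: "n \<bullet> n = 1" using n by (simp add: norm_eq_1)
  have "norm b * ?c < norm b * 1" using nb mp c by (intro mult_strict_left_mono) auto
  then show "b \<in> cone \<rho> \<theta> n"
    using 1 small nb mp nn by (auto simp: cone_def b_def inner_simps)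
  have "\<bar>h \<bullet> n\<bar> \<le> norm h" using Cauchy_Schwarz_ineq2[of h n] n by simp
  then have in_ge: "(?m - 1) * norm h \<le> (b + h) \<bullet> n"
    using nn by (simp add: b_def inner_simps algebra_simps)
  have c1: "(?m + 1) * ?c = (?m - 1) - (1 - ?c)" using mc by (simp add: algebra_simps)
  have "norm (b + h) * ?c \<le> ((?m + 1) * norm h) * ?c" using 2 c by (intro mult_right_mono) auto
  also have "\<dots> = ((?m + 1) * ?c) * norm h" by simp
  also have "\<dots> = ((?m - 1) - (1 - ?c)) * norm h" by (simp only: c1)
  also have "\<dots> < (?m - 1) * norm h" using c p by (intro mult_strict_right_mono) auto
  also note in_ge
  finally have 3: "norm (b + h) * ?c < (b + h) \<bullet> n" .
  have "0 < (?m - 1) * norm h" using m p by (intro mult_pos_pos) auto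
  then have "b + h \<noteq> 0" using in_ge by auto
  then show "b + h \<in> cone \<rho> \<theta> n" using 2 3 small by (auto simp: cone_def)
qed

lemma Hs_space_shift:
  fixes v :: "real^'n \<Rightarrow> real"
  assumes v: "v \<in> Hs_space s"
  shows "(\<lambda>x. v (x + c)) \<in> Hs_space s" "gagl s (\<lambda>x. v (x + c)) = gagl s v"
proof -
  have m [measurable]: "v \<in> borel_measurable borel" using v by (auto intro: L2_spaceD Hs_spaceD)
  have [measurable]: "(\<lambda>x. v (x + c)) \<in> borel_measurable borel" by measurable
  show "(\<lambda>x. v (x + c)) \<in> Hs_space s" "gagl s (\<lambda>x. v (x + c)) = gagl s v"
    using v by (simp_all add: Hs_space_def L2_space_iff gagliardo_sq_shift gagl_def)
qed

text \<open>Arbitrary small directions are reached by subtracting the increments of \<open>u\<close>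
  for \<open>b + h\<close> and for \<open>b\<close>: their difference is the increment for
  \<open>h\<close>, evaluated at the point translated by \<open>b\<close>. The factor
  \<open>4\<close> is \<open>2 + 2\<close> from \<open>Hs_space_diff\<close>.\<close>

lemma cutoff_difference:
  fixes u :: "real^'n \<Rightarrow> real" and h :: "real^'n"
  assumes s: "0 < s" "s < 1" and \<Omega>: "bounded \<Omega>" and f: "f \<in> L2_space"
    and u: "weak_solution s \<Omega> f u"
    and \<theta>: "0 < \<theta>" "\<theta> < pi / 2" and \<rho>: "0 < \<rho>" and lc: "lipschitz_cone_condition \<rho> \<theta> \<Omega>"
    and h: "h \<noteq> 0" "(cone_ratio \<theta> + 1) * norm h < \<rho>" "(cone_ratio \<theta> + 1) * norm h \<le> 1"
  shows "(\<lambda>x. cutoff c \<rho> x * fdiff h u x) \<in> Hs_space s"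
    and "gagl s (\<lambda>x. cutoff c \<rho> x * fdiff h u x) \<le> 4 * (((cone_ratio \<theta> + 1) * norm h) powr s
      * diff_const TYPE('n) s (1 / \<rho>) (diameter \<Omega>) * (Hdual_norm s f * L2_norm f))"
proof -
  let ?q = "(cone_ratio \<theta> + 1) * norm h"
  let ?X = "?q powr s * diff_const TYPE('n) s (1 / \<rho>) (diameter \<Omega>) * (Hdual_norm s f * L2_norm f)"
  obtain n where n: "n \<in> cone_directions \<rho> \<theta> c \<Omega>"
    using lc unfolding lipschitz_cone_condition_def by blast
  then have n1: "norm n = 1" by (simp add: cone_directions_def)
  define b where "b = (cone_ratio \<theta> * norm h) *\<^sub>R n"
  note cd = cone_decomposition[OF \<theta> n1 h(1,2), folded b_def]
  \<comment> \<open>The cut-off is translated in advance, so that undoing the translation by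
    \<open>b\<close> leaves it centred at \<open>c\<close>; as \<open>|b| < \<rho>\<close>, its
    support remains within \<open>3 * \<rho>\<close> of \<open>c\<close>.\<close>
  define \<phi> where "\<phi> x = cutoff c \<rho> (x + b)" for x
  define W where "W a = (\<lambda>x. \<phi> x * fdiff a u x)" for a
  have m: "\<phi> \<in> borel_measurable borel" unfolding \<phi>_def[abs_def] by measurable
  have \<phi>: "0 \<le> \<phi> x" "\<phi> x \<le> 1" for x by (simp_all add: \<phi>_def cutoff_bounds)
  have lip: "\<bar>\<phi> x - \<phi> y\<bar> \<le> (1 / \<rho>) * norm (x - y)" for x y
    using cutoff_lipschitz[OF \<rho>, of c "x + b" "y + b"] by (simp add: \<phi>_def)
  have supp: "\<phi> x = 0" if "x \<notin> ball c (3 * \<rho>)" for x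
  proof -
    have "norm (x - c) \<le> norm (x + b - c) + norm b"
      using norm_triangle_ineq4[of "x + b - c" b] by (simp add: algebra_simps)
    then have "2 * \<rho> \<le> norm (x + b - c)"
      using that cd(3) h(2) by (simp add: dist_norm norm_minus_commute)
    then show ?thesis unfolding \<phi>_def by (rule cutoff_eq_0[OF \<rho>])
  qed
  have L: "0 \<le> 1 / \<rho>" using \<rho> by simp
  have uX: "u \<in> X0_space s \<Omega>" using u by (simp add: weak_solution_def)
  have W: "W a \<in> Hs_space s" "gagl s (W a) \<le> ?X"
    if a: "a \<in> cone \<rho> \<theta> n" "norm a \<le> ?q" for a
  proof -
    have a1: "norm a \<le> 1" using a h by linarith
    show "W a \<in> Hs_space s"
      using localized_difference_X0[OF s uX m \<phi> lip L supp n a(1) a1] by (simp add: X0_space_def W_def)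
    have "gagl s (W a) \<le> norm a powr s * diff_const TYPE('n) s (1 / \<rho>) (diameter \<Omega>) * (Hdual_norm s f * L2_norm f)"
      unfolding W_def by (rule localized_difference_data[OF s \<Omega> f u m \<phi> lip L supp n a(1) a1])
    also have "\<dots> \<le> ?X"
      using a s by (intro mult_right_mono powr_mono2 diff_const_nonneg L mult_nonneg_nonneg Hdual_norm_bounds(1) f) auto
    finally show "gagl s (W a) \<le> ?X" .
  qed
  have Wb: "W b \<in> Hs_space s" "gagl s (W b) \<le> ?X" and Wa: "W (b + h) \<in> Hs_space s" "gagl s (W (b + h)) \<le> ?X"
    using W[OF cd(1,3)] W[OF cd(2,4)] by auto
  let ?V = "\<lambda>x. W (b + h) x - W b x"
  have V: "?V \<in> Hs_space s" by (rule Hs_space_diff(1)[OF Wa(1) Wb(1)])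
  have eq: "(\<lambda>x. cutoff c \<rho> x * fdiff h u x) = (\<lambda>x. ?V (x + - b))"
    by (auto simp: W_def \<phi>_def fdiff_def algebra_simps)
  show "(\<lambda>x. cutoff c \<rho> x * fdiff h u x) \<in> Hs_space s"
    unfolding eq by (rule Hs_space_shift(1)[OF V])
  have "gagl s (\<lambda>x. cutoff c \<rho> x * fdiff h u x) = gagl s ?V"
    unfolding eq by (rule Hs_space_shift(2)[OF V])
  also have "\<dots> \<le> 2 * ?X + 2 * ?X"
    by (rule order_trans[OF Hs_space_diff(2)[OF Wa(1) Wb(1)]]) (use Wa(2) Wb(2) in linarith)
  also have "\<dots> = 4 * ?X" by linarith
  finally show "gagl s (\<lambda>x. cutoff c \<rho> x * fdiff h u x) \<le> 4 * ?X" .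
qed

text \<open>The bound for differences in \<open>L2\<close> is applied to the localized first
  difference, giving the order \<open>2 s + s\<close> for the square. On the small ball both
  \<open>x\<close> and \<open>x + h\<close> lie where the cut-off equals \<open>1\<close>, so its
  difference is the second difference of \<open>u\<close>.\<close>

lemma local_second_difference:
  fixes u :: "real^'n \<Rightarrow> real" and h :: "real^'n"
  assumes s: "0 < s" "s < 1" and \<Omega>: "bounded \<Omega>" and f: "f \<in> L2_space"
    and u: "weak_solution s \<Omega> f u"
    and \<theta>: "0 < \<theta>" "\<theta> < pi / 2" and \<rho>: "0 < \<rho>" and lc: "lipschitz_cone_condition \<rho> \<theta> \<Omega>"
    and h: "h \<noteq> 0" "(cone_ratio \<theta> + 1) * norm h \<le> min 1 (\<rho> / 2)"
  shows "sqn (\<lambda>x. indicator (ball c (\<rho> / 2)) x * fdiff h (fdiff h u) x)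
    \<le> ennreal (4 * shift_const TYPE('n) s * (cone_ratio \<theta> + 1) powr s * diff_const TYPE('n) s (1 / \<rho>) (diameter \<Omega>)
      * norm h powr (3 * s) * (Hdual_norm s f * L2_norm f))"
proof -
  let ?v = "\<lambda>x. cutoff c \<rho> x * fdiff h u x"
  let ?D = "diff_const TYPE('n) s (1 / \<rho>) (diameter \<Omega>) * (Hdual_norm s f * L2_norm f)"
  have h2: "(cone_ratio \<theta> + 1) * norm h < \<rho>" "(cone_ratio \<theta> + 1) * norm h \<le> 1"
    using h(2) \<rho> by auto
  have m: "2 < cone_ratio \<theta>" by (rule cone_ratio_gt[OF \<theta>])
  have "1 * norm h \<le> (cone_ratio \<theta> + 1) * norm h" using m by (intro mult_right_mono) auto
  then have hr: "norm h \<le> \<rho> / 2" using h(2) by simp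
  note v = cutoff_difference[OF s \<Omega> f u \<theta> \<rho> lc h(1) h2, of c]
  have "sqn (\<lambda>x. indicator (ball c (\<rho> / 2)) x * fdiff h (fdiff h u) x) \<le> sqn (fdiff h ?v)"
  proof (rule sqn_mono)
    fix x
    show "\<bar>indicator (ball c (\<rho> / 2)) x * fdiff h (fdiff h u) x\<bar> \<le> \<bar>fdiff h ?v x\<bar>"
    proof (cases "x \<in> ball c (\<rho> / 2)")
      case True
      then have x: "norm (x - c) < \<rho> / 2" by (simp add: dist_norm norm_minus_commute)
      moreover have "norm (x + h - c) \<le> norm (x - c) + norm h"
        using norm_triangle_ineq[of "x - c" h] by (simp add: algebra_simps)
      ultimately have "norm (x - c) \<le> \<rho>" "norm (x + h - c) \<le> \<rho>"
        using hr \<rho> by linarith+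
      then have "cutoff c \<rho> x = 1" "cutoff c \<rho> (x + h) = 1"
        by (simp_all add: cutoff_eq_1[OF \<rho>])
      then show ?thesis using True by (simp add: fdiff_def)
    qed simp
  qed
  also have "\<dots> \<le> ennreal (shift_const TYPE('n) s * norm h powr (2 * s) * gagl s ?v)"
    by (rule gagl_fdiff_le[OF s(1) v(1)])
  also have "\<dots> \<le> ennreal (shift_const TYPE('n) s * norm h powr (2 * s) * (4 * (((cone_ratio \<theta> + 1) * norm h) powr s * ?D)))"
    using v(2) by (intro ennreal_leI mult_left_mono) (simp_all add: mult.assoc less_imp_le[OF shift_const_pos])
  also have "shift_const TYPE('n) s * norm h powr (2 * s) * (4 * (((cone_ratio \<theta> + 1) * norm h) powr s * ?D))
    = 4 * shift_const TYPE('n) s * (cone_ratio \<theta> + 1) powr s * diff_const TYPE('n) s (1 / \<rho>) (diameter \<Omega>)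
      * norm h powr (3 * s) * (Hdual_norm s f * L2_norm f)"
  proof -
    have "norm h powr (3 * s) = norm h powr (2 * s) * norm h powr s" by (simp flip: powr_add)
    then show ?thesis using m by (simp add: powr_mult mult_ac)
  qed
  finally show ?thesis .
qed

section \<open>The global estimate by covering\<close>

lemma sqn_sum_le:
  fixes g :: "'i \<Rightarrow> real^'n \<Rightarrow> real"
  assumes "finite I" and [measurable]: "\<And>i. i \<in> I \<Longrightarrow> g i \<in> borel_measurable borel"
    and ae: "AE x in lborel. (w x)\<^sup>2 \<le> (\<Sum>i\<in>I. (g i x)\<^sup>2)"
  shows "sqn w \<le> (\<Sum>i\<in>I. sqn (g i))"
proof -
  have "sqn w \<le> (\<integral>\<^sup>+x. (\<Sum>i\<in>I. ennreal ((g i x)\<^sup>2)) \<partial>lborel)"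
    unfolding sqn_def
  proof (rule nn_integral_mono_AE)
    show "AE x in lborel. ennreal ((w x)\<^sup>2) \<le> (\<Sum>i\<in>I. ennreal ((g i x)\<^sup>2))"
      using ae by eventually_elim (simp add: sum_ennreal ennreal_leI)
  qed
  also have "\<dots> = (\<Sum>i\<in>I. sqn (g i))"
    unfolding sqn_def by (rule nn_integral_sum) measurable
  finally show ?thesis .
qed

text \<open>The choice depends on the two radii alone, so the number of balls may enter a constant
  that does not see \<open>\<Omega>\<close>.\<close>

definition cover_centers :: "real \<Rightarrow> real \<Rightarrow> (real^'n) set" where
  "cover_centers R r = (SOME F. finite F \<and> cball 0 R \<subseteq> (\<Union>c\<in>F. ball c r))"

lemma cover_centers:
  assumes "0 < r"
  shows "finite (cover_centers R r :: (real^'n) set)"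
    and "(cball 0 R :: (real^'n) set) \<subseteq> (\<Union>c\<in>cover_centers R r. ball c r)"
proof -
  have "\<exists>F :: (real^'n) set. finite F \<and> cball 0 R \<subseteq> (\<Union>c\<in>F. ball c r)"
    using compact_cball[of "0::real^'n" R] assms unfolding compact_eq_totally_bounded by blast
  from someI_ex[OF this]
  show "finite (cover_centers R r :: (real^'n) set)"
    and "(cball 0 R :: (real^'n) set) \<subseteq> (\<Union>c\<in>cover_centers R r. ball c r)"
    by (simp_all add: cover_centers_def)
qed

text \<open>For \<open>|h| \<le> 1\<close> the second difference involves \<open>u\<close> only
  within distance \<open>2\<close> of \<open>x\<close>, so it vanishes far from
  \<open>\<Omega>\<close>. The remaining ball is covered by translates of one fixed finite family,
  with the same local estimate on each member.\<close>

lemma small_second_difference: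
  fixes u :: "real^'n \<Rightarrow> real" and h :: "real^'n"
  assumes s: "0 < s" "s < 1" and \<Omega>: "bounded \<Omega>" and f: "f \<in> L2_space"
    and u: "weak_solution s \<Omega> f u"
    and \<theta>: "0 < \<theta>" "\<theta> < pi / 2" and \<rho>: "0 < \<rho>" and lc: "lipschitz_cone_condition \<rho> \<theta> \<Omega>"
    and h: "h \<noteq> 0" "(cone_ratio \<theta> + 1) * norm h \<le> min 1 (\<rho> / 2)"
  shows "sqn (fdiff h (fdiff h u)) \<le> ennreal (real (card (cover_centers (diameter \<Omega> + 2) (\<rho> / 2) :: (real^'n) set))
    * (4 * shift_const TYPE('n) s * (cone_ratio \<theta> + 1) powr s * diff_const TYPE('n) s (1 / \<rho>) (diameter \<Omega>)
      * norm h powr (3 * s) * (Hdual_norm s f * L2_norm f)))" (is "_ \<le> ennreal (_ * ?B)")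
proof -
  let ?C = "cover_centers (diameter \<Omega> + 2) (\<rho> / 2) :: (real^'n) set"
  have C: "finite ?C" "cball 0 (diameter \<Omega> + 2) \<subseteq> (\<Union>c\<in>?C. ball c (\<rho> / 2))"
    using cover_centers[of "\<rho> / 2"] \<rho> by auto
  have "0 \<le> ?B"
    using \<rho> by (intro mult_nonneg_nonneg diff_const_nonneg Hdual_norm_bounds(1)[OF f])
      (auto simp: less_imp_le[OF shift_const_pos])
  \<comment> \<open>The covering is centred at the origin and is moved to \<open>p\<close>. For
    empty \<open>\<Omega>\<close> any point serves.\<close>
  obtain p where p: "\<Omega> \<subseteq> cball p (diameter \<Omega>)"
  proof (cases "\<Omega> = {}")
    case False
    then obtain p where "p \<in> \<Omega>" by auto
    then show ?thesis using diameter_bounded_bound[OF \<Omega>] by (intro that[of p]) auto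
  qed (use that in auto)
  have uX: "u \<in> X0_space s \<Omega>" using u by (simp add: weak_solution_def)
  then have ae: "AE x in lborel. x \<notin> \<Omega> \<longrightarrow> u x = 0" by (simp add: X0_space_def)
  have um [measurable]: "u \<in> borel_measurable borel"
    using uX by (auto simp: X0_space_def intro: L2_spaceD Hs_spaceD)
  have m: "2 < cone_ratio \<theta>" by (rule cone_ratio_gt[OF \<theta>])
  have "1 * norm h \<le> (cone_ratio \<theta> + 1) * norm h" using m by (intro mult_right_mono) auto
  then have h1: "norm h \<le> 1" using h(2) by simp
  let ?g = "\<lambda>c x. indicator (ball (p + c) (\<rho> / 2)) x * fdiff h (fdiff h u) x"
  have "sqn (fdiff h (fdiff h u)) \<le> (\<Sum>c\<in>?C. sqn (?g c))"
  proof (rule sqn_sum_le[OF C(1)])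
    show "?g c \<in> borel_measurable borel" for c by measurable
    show "AE x in lborel. (fdiff h (fdiff h u) x)\<^sup>2 \<le> (\<Sum>c\<in>?C. (?g c x)\<^sup>2)"
      using ae AE_shift[OF ae, of h] AE_shift[OF ae, of "h + h"]
    proof eventually_elim
      fix x assume x: "x \<notin> \<Omega> \<longrightarrow> u x = 0" "x + h \<notin> \<Omega> \<longrightarrow> u (x + h) = 0" "x + (h + h) \<notin> \<Omega> \<longrightarrow> u (x + (h + h)) = 0"
      show "(fdiff h (fdiff h u) x)\<^sup>2 \<le> (\<Sum>c\<in>?C. (?g c x)\<^sup>2)"
      proof (cases "norm (x - p) \<le> diameter \<Omega> + 2")
        case True
        then have "x - p \<in> cball 0 (diameter \<Omega> + 2)" by simp
        then obtain c where c: "c \<in> ?C" "x - p \<in> ball c (\<rho> / 2)" using C(2) by blast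
        then have "x \<in> ball (p + c) (\<rho> / 2)" by (simp add: dist_norm algebra_simps)
        then have "(fdiff h (fdiff h u) x)\<^sup>2 = (?g c x)\<^sup>2" by simp
        also have "\<dots> \<le> (\<Sum>c\<in>?C. (?g c x)\<^sup>2)" using C(1) c(1) by (intro member_le_sum) auto
        finally show ?thesis .
      next
        case False
        have far: "y \<notin> \<Omega>" if "norm (x - y) \<le> 2" for y
        proof
          assume "y \<in> \<Omega>"
          then have "norm (y - p) \<le> diameter \<Omega>" using p by (auto simp: dist_norm norm_minus_commute)
          then show False using norm_triangle_ineq[of "x - y" "y - p"] that False by simp
        qed
        have "norm (h + h) \<le> 2" using norm_triangle_ineq[of h h] h1 by simp
        then have "u x = 0" "u (x + h) = 0" "u (x + (h + h)) = 0"
          using x far[of x] far[of "x + h"] far[of "x + (h + h)"] h1 by auto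
        then have "fdiff h (fdiff h u) x = 0" by (simp add: fdiff_def add.assoc)
        then show ?thesis by (simp add: sum_nonneg)
      qed
    qed
  qed
  also have "\<dots> \<le> (\<Sum>c\<in>?C. ennreal ?B)"
    by (intro sum_mono local_second_difference[OF s \<Omega> f u \<theta> \<rho> lc h])
  also have "\<dots> = ennreal (real (card ?C) * ?B)"
    using \<open>0 \<le> ?B\<close> by (simp add: ennreal_mult ennreal_of_nat_eq_real_of_nat)
  finally show ?thesis .
qed

text \<open>The constant is produced before \<open>\<Omega>\<close>, \<open>f\<close> and
  \<open>u\<close> are given, with only the diameter prescribed; this order of quantifiers is the
  uniformity in the theorem.\<close>

lemma second_difference_estimate:
  fixes d s \<rho> \<theta> :: real
  assumes s: "0 < s" "s < 1" and \<theta>: "0 < \<theta>" "\<theta> < pi / 2" and \<rho>: "0 < \<rho>"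
  obtains A where "0 \<le> A"
    "\<And>\<Omega> f (u :: real^'n \<Rightarrow> real). bounded \<Omega> \<Longrightarrow> diameter \<Omega> = d \<Longrightarrow> lipschitz_cone_condition \<rho> \<theta> \<Omega> \<Longrightarrow>
      f \<in> L2_space \<Longrightarrow> weak_solution s \<Omega> f u \<Longrightarrow>
      L2_norm u \<le> A * sqrt (Hdual_norm s f * L2_norm f) \<and>
      (\<forall>h. h \<noteq> 0 \<longrightarrow> L2_norm (fdiff h (fdiff h u)) \<le> A * norm h powr (3 * s / 2) * sqrt (Hdual_norm s f * L2_norm f))"
proof -
  define B where "B = real (card (cover_centers (d + 2) (\<rho> / 2) :: (real^'n) set))
    * (4 * shift_const TYPE('n) s * (cone_ratio \<theta> + 1) powr s * diff_const TYPE('n) s (1 / \<rho>) d)"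
  define h0 where "h0 = min 1 (\<rho> / 2) / (cone_ratio \<theta> + 1)"
  define A0 where "A0 = sqrt (poincare_const TYPE('n) s d) * energy_const TYPE('n) s d"
  have m: "2 < cone_ratio \<theta>" by (rule cone_ratio_gt[OF \<theta>])
  have h0: "0 < h0" using m \<rho> by (simp add: h0_def)
  have B: "0 \<le> B" unfolding B_def
    using \<rho> by (intro mult_nonneg_nonneg diff_const_nonneg) (auto simp: less_imp_le[OF shift_const_pos])
  have A0: "0 \<le> A0" by (simp add: A0_def)
  let ?r = "3 * s / 2"
  \<comment> \<open>One summand for each bound: the norm of \<open>u\<close>, increments up to
    \<open>h0\<close>, and longer increments, where \<open>4 * L2_norm u\<close> is compared with
    \<open>(|h| / h0) powr ?r \<ge> 1\<close>.\<close>
  let ?A = "A0 + sqrt B + 4 * h0 powr (- ?r) * A0"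
  show thesis
  proof (rule that)
    show "0 \<le> ?A" using A0 B by simp
    fix \<Omega> f and u :: "real^'n \<Rightarrow> real"
    assume \<Omega>: "bounded \<Omega>" "diameter \<Omega> = d" and lc: "lipschitz_cone_condition \<rho> \<theta> \<Omega>"
      and f: "f \<in> L2_space" and u: "weak_solution s \<Omega> f u"
    define H where "H = Hdual_norm s f"
    define F where "F = L2_norm f"
    have HF: "0 \<le> H" "H \<le> F" using Hdual_norm_bounds[OF f] by (auto simp: H_def F_def)
    let ?X = "sqrt (H * F)"
    have uX: "u \<in> X0_space s \<Omega>" using u by (simp add: weak_solution_def)
    then have uL2: "u \<in> L2_space" by (auto simp: X0_space_def Hs_spaceD)
    have um: "u \<in> borel_measurable borel" using uL2 by (rule L2_spaceD)
    \<comment> \<open>The dual norm is at most the geometric mean, being the smaller of the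
      two.\<close>
    have "H * H \<le> H * F" using HF by (intro mult_left_mono) auto
    then have HX: "H \<le> ?X" using HF by (intro real_le_rsqrt) (simp add: power2_eq_square)
    have "L2_norm u \<le> sqrt (poincare_const TYPE('n) s d * gagl s u)"
      using fractional_poincare[OF s(1) \<Omega>(1) uX] \<Omega>(2) by (intro real_le_rsqrt) simp
    also have "\<dots> \<le> sqrt (poincare_const TYPE('n) s d) * (energy_const TYPE('n) s d * H)"
      unfolding real_sqrt_mult using energy_estimate[OF s \<Omega>(1) f u] \<Omega>(2)
      by (intro mult_left_mono) (auto simp: H_def)
    also have "\<dots> \<le> A0 * ?X"
      unfolding A0_def mult.assoc[symmetric] using HX by (intro mult_left_mono) auto
    finally have u0: "L2_norm u \<le> A0 * ?X" .
    have HF0: "0 \<le> H * F" using HF by (intro mult_nonneg_nonneg) auto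
    then have X0: "0 \<le> ?X" by simp
    have "A0 * ?X \<le> ?A * ?X" using A0 B X0 by (intro mult_right_mono) auto
    with u0 have "L2_norm u \<le> ?A * ?X" by linarith
    moreover have "L2_norm (fdiff h (fdiff h u)) \<le> ?A * norm h powr ?r * ?X" if h: "h \<noteq> 0" for h
    proof (cases "norm h \<le> h0")
      case True
      then have "(cone_ratio \<theta> + 1) * norm h \<le> min 1 (\<rho> / 2)"
        using m unfolding h0_def by (subst (asm) pos_le_divide_eq) (auto simp: mult.commute)
      from small_second_difference[OF s \<Omega>(1) f u \<theta> \<rho> lc h this]
      have "sqn (fdiff h (fdiff h u)) \<le> ennreal (B * norm h powr (3 * s) * (H * F))"
        by (simp add: \<Omega>(2) B_def H_def F_def mult.assoc)
      also have "B * norm h powr (3 * s) * (H * F) = (sqrt B * norm h powr ?r * ?X)\<^sup>2"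
      proof -
        have "norm h powr (3 * s) = (norm h powr ?r)\<^sup>2" by (simp add: power2_eq_square flip: powr_add)
        then show ?thesis using B HF by (simp add: power_mult_distrib)
      qed
      finally have "L2_norm (fdiff h (fdiff h u)) \<le> sqrt B * norm h powr ?r * ?X"
        using um B HF0 by (intro L2_norm_le fdiff_measurable) auto
      also have "\<dots> \<le> ?A * norm h powr ?r * ?X"
        using A0 B X0 by (intro mult_right_mono) auto
      finally show ?thesis .
    next
      case False
      have "sqn (fdiff h (fdiff h u)) \<le> 4 * (4 * sqn u)"
        by (rule order_trans[OF sqn_fdiff_le mult_left_mono[OF sqn_fdiff_le]]) (simp_all add: um fdiff_measurable)
      also have "\<dots> = ennreal ((4 * L2_norm u)\<^sup>2)"
        unfolding sqn_eq_L2_norm[OF uL2] by (simp add: power_mult_distrib ennreal_mult' flip: mult.assoc)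
      finally have "L2_norm (fdiff h (fdiff h u)) \<le> 4 * L2_norm u"
        using um by (intro L2_norm_le fdiff_measurable) auto
      also have "\<dots> \<le> 4 * (A0 * ?X)" using u0 by simp
      also have "\<dots> \<le> (4 * h0 powr (- ?r) * A0) * norm h powr ?r * ?X"
      proof -
        have "h0 powr ?r \<le> norm h powr ?r" using False h0 s by (intro powr_mono2) auto
        then have "1 \<le> h0 powr (- ?r) * norm h powr ?r"
          using h0 by (simp add: powr_minus field_simps)
        then have "4 * (A0 * ?X) * 1 \<le> 4 * (A0 * ?X) * (h0 powr (- ?r) * norm h powr ?r)"
          using A0 X0 by (intro mult_left_mono) auto
        then show ?thesis by (simp add: mult_ac)
      qed
      also have "\<dots> \<le> ?A * norm h powr ?r * ?X"
        using A0 B X0 by (intro mult_right_mono) auto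
      finally show ?thesis .
    qed
    ultimately show "L2_norm u \<le> ?A * sqrt (Hdual_norm s f * L2_norm f) \<and>
      (\<forall>h. h \<noteq> 0 \<longrightarrow> L2_norm (fdiff h (fdiff h u)) \<le> ?A * norm h powr (3 * s / 2) * sqrt (Hdual_norm s f * L2_norm f))"
      by (simp add: H_def F_def)
  qed
qed

section \<open>Test functions\<close>

lemma partial_deriv_eqI:
  "(f has_derivative D) (at x) \<Longrightarrow> partial_deriv i f x = D (axis i 1)"
  unfolding partial_deriv_def using frechet_derivative_at by metis

lemma differentiable_has_derivative:
  "f differentiable_on UNIV \<Longrightarrow> (f has_derivative frechet_derivative f (at x)) (at x)"
  unfolding differentiable_on_def using frechet_derivative_works by auto

lemma C_k_Suc_imp: "C_k (Suc k) f \<Longrightarrow> C_k k f"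
proof (induction k arbitrary: f)
  case 0
  then show ?case by (simp add: differentiable_imp_continuous_on)
next
  case (Suc k)
  then show ?case using C_k.simps(2) by blast
qed

lemma C_k_const: "C_k k (\<lambda>x::real^'n. c)"
proof (induction k arbitrary: c)
  case (Suc k)
  have "partial_deriv i (\<lambda>x::real^'n. c) = (\<lambda>x. 0)" for i
    by (rule ext, rule partial_deriv_eqI) (rule has_derivative_const)
  then show ?case using Suc[of 0] by simp
qed simp

lemma C_k_add:
  fixes f g :: "real^'n \<Rightarrow> real"
  shows "C_k k f \<Longrightarrow> C_k k g \<Longrightarrow> C_k k (\<lambda>x. f x + g x)"
proof (induction k arbitrary: f g)
  case (Suc k)
  then have d: "f differentiable_on UNIV" "g differentiable_on UNIV" by simp_all
  have "partial_deriv i (\<lambda>x. f x + g x) = (\<lambda>x. partial_deriv i f x + partial_deriv i g x)" for i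
  proof
    fix x
    show "partial_deriv i (\<lambda>x. f x + g x) x = partial_deriv i f x + partial_deriv i g x"
      unfolding partial_deriv_def[of i f] partial_deriv_def[of i g]
      by (intro partial_deriv_eqI has_derivative_add differentiable_has_derivative d)
  qed
  then show ?case using Suc by (simp add: differentiable_on_add)
qed (auto intro: continuous_on_add)

lemma C_k_mult:
  fixes f g :: "real^'n \<Rightarrow> real"
  shows "C_k k f \<Longrightarrow> C_k k g \<Longrightarrow> C_k k (\<lambda>x. f x * g x)"
proof (induction k arbitrary: f g)
  case (Suc k)
  then have d: "f differentiable_on UNIV" "g differentiable_on UNIV" by simp_all
  have "partial_deriv i (\<lambda>x. f x * g x) = (\<lambda>x. f x * partial_deriv i g x + partial_deriv i f x * g x)" for i
  proof
    fix x
    show "partial_deriv i (\<lambda>x. f x * g x) x = f x * partial_deriv i g x + partial_deriv i f x * g x"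
      unfolding partial_deriv_def[of i f] partial_deriv_def[of i g]
      by (intro partial_deriv_eqI has_derivative_mult differentiable_has_derivative d)
  qed
  moreover have "(\<lambda>x. f x * g x) differentiable_on UNIV" using d by (rule differentiable_on_mult)
  ultimately show ?case using Suc C_k_Suc_imp[OF Suc.prems(1)] C_k_Suc_imp[OF Suc.prems(2)]
    by (auto intro!: C_k_add)
qed (auto intro: continuous_on_mult)

lemma C_k_prod:
  fixes f :: "'i \<Rightarrow> real^'n \<Rightarrow> real"
  assumes "finite I" "\<And>i. i \<in> I \<Longrightarrow> C_k k (f i)"
  shows "C_k k (\<lambda>x. \<Prod>i\<in>I. f i x)"
  using assms by (induction I rule: finite_induct) (auto intro: C_k_const C_k_mult)

text \<open>The powers make the family \<open>t^(-m) exp (- 1 / t)\<close>, extended by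
  \<open>0\<close>, closed under differentiation up to linear combinations.\<close>

definition flat_fun :: "nat \<Rightarrow> real \<Rightarrow> real" where
  "flat_fun m t = (if 0 < t then inverse t ^ m / exp (inverse t) else 0)"

lemma flat_fun_deriv:
  "(flat_fun m has_real_derivative flat_fun (m + 2) t - real m * flat_fun (m + 1) t) (at t)"
proof -
  consider "t > 0" | "t < 0" | "t = 0" by linarith
  then show ?thesis
  proof cases
    case 1
    have "((\<lambda>t. inverse t ^ m / exp (inverse t)) has_real_derivative flat_fun (m + 2) t - real m * flat_fun (m + 1) t) (at t)"
    proof -
      have i: "(inverse has_real_derivative - (inverse t)\<^sup>2) (at t)"
        using DERIV_inverse[of t UNIV] 1 by (simp add: power2_eq_square)
      have e: "((\<lambda>t. exp (- inverse t)) has_real_derivative exp (- inverse t) * (inverse t)\<^sup>2) (at t)"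
        using DERIV_chain2[OF DERIV_exp DERIV_minus[OF i]] by simp
      have p: "((\<lambda>t. inverse t ^ m) has_real_derivative - (real m * inverse t ^ (m + 1))) (at t)"
      proof (cases m)
        case (Suc l)
        show ?thesis
          using DERIV_power_Suc[OF i, of l] unfolding Suc by (simp add: algebra_simps power2_eq_square)
      qed simp
      have "((\<lambda>t. inverse t ^ m * exp (- inverse t)) has_real_derivative
          - (real m * inverse t ^ (m + 1)) * exp (- inverse t) + exp (- inverse t) * (inverse t)\<^sup>2 * inverse t ^ m) (at t)"
        by (rule DERIV_mult[OF p e])
      moreover have "- (real m * inverse t ^ (m + 1)) * exp (- inverse t) + exp (- inverse t) * (inverse t)\<^sup>2 * inverse t ^ m
          = flat_fun (m + 2) t - real m * flat_fun (m + 1) t"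
        using 1 by (simp add: flat_fun_def exp_minus divide_inverse power_add power2_eq_square mult_ac)
      moreover have "(\<lambda>t::real. inverse t ^ m * exp (- inverse t)) = (\<lambda>t. inverse t ^ m / exp (inverse t))"
        by (simp add: exp_minus divide_inverse)
      ultimately show ?thesis by simp
    qed
    then show ?thesis
      by (rule has_field_derivative_transform_within_open[of _ _ _ "{0<..}"]) (use 1 in \<open>auto simp: flat_fun_def\<close>)
  next
    case 2
    have "((\<lambda>t. 0) has_real_derivative flat_fun (m + 2) t - real m * flat_fun (m + 1) t) (at t)"
      using 2 by (simp add: flat_fun_def)
    then show ?thesis
      by (rule has_field_derivative_transform_within_open[of _ _ _ "{..<0}"]) (use 2 in \<open>auto simp: flat_fun_def\<close>)
  next
    case 3
    \<comment> \<open>At the origin the right difference quotient is the next member of the family,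
      where the exponential beats the power.\<close>
    have "((\<lambda>h. flat_fun m h / h) \<longlongrightarrow> 0) (at_right 0)"
    proof -
      have "((\<lambda>h::real. inverse h ^ (m + 1) / exp (inverse h)) \<longlongrightarrow> 0) (at_right 0)"
        by (rule filterlim_compose[OF tendsto_power_div_exp_0 filterlim_inverse_at_top_right])
      moreover have "\<forall>\<^sub>F h in at_right 0. inverse h ^ (m + 1) / exp (inverse h) = flat_fun m h / (h::real)"
        using eventually_at_right_less[of "0::real"] by eventually_elim (simp add: flat_fun_def field_simps)
      ultimately show ?thesis by (rule Lim_transform_eventually)
    qed
    moreover have "((\<lambda>h. flat_fun m h / h) \<longlongrightarrow> 0) (at_left 0)"
    proof (rule tendsto_eventually)
      show "\<forall>\<^sub>F h in at_left 0. flat_fun m h / h = 0"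
        unfolding eventually_at_filter by (rule always_eventually) (auto simp: flat_fun_def)
    qed
    ultimately have "((\<lambda>h. flat_fun m h / h) \<longlongrightarrow> 0) (at 0)" by (rule filterlim_split_at[rotated])
    then show ?thesis using 3 by (simp add: has_field_derivative_iff flat_fun_def)
  qed
qed

text \<open>The exponent \<open>m\<close> must vary in the induction, since each partial derivative
  combines members with exponents \<open>m + 1\<close> and \<open>m + 2\<close>.\<close>

lemma C_k_flat_fun:
  "C_k k (\<lambda>x::real^'n. flat_fun m (c * x $ i + d))"
proof (induction k arbitrary: m)
  case 0
  have "isCont (flat_fun m) t" for t using flat_fun_deriv by (rule DERIV_isCont)
  then have c: "continuous_on UNIV (flat_fun m)" by (simp add: continuous_at_imp_continuous_on)
  have "continuous_on UNIV (\<lambda>x::real^'n. c * x $ i + d)" by (intro continuous_intros)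
  from continuous_on_compose2[OF c this] show ?case by simp
next
  case (Suc k)
  let ?f = "\<lambda>x::real^'n. flat_fun m (c * x $ i + d)"
  have der: "(?f has_derivative (\<lambda>v. (flat_fun (m + 2) (c * x $ i + d) - real m * flat_fun (m + 1) (c * x $ i + d)) * (c * v $ i))) (at x)" for x
  proof -
    have "((\<lambda>x::real^'n. c * x $ i + d) has_derivative (\<lambda>v. c * v $ i)) (at x)"
      by (intro has_derivative_add_const has_derivative_mult_right bounded_linear_imp_has_derivative bounded_linear_vec_nth)
    from has_derivative_compose[OF this flat_fun_deriv[THEN has_field_derivative_imp_has_derivative], of m]
    show ?thesis by simp
  qed
  have pd: "partial_deriv j ?f = (\<lambda>x. (c * axis j 1 $ i) * flat_fun (m + 2) (c * x $ i + d)
      + (- (c * axis j 1 $ i) * real m) * flat_fun (m + 1) (c * x $ i + d))" for j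
    by (rule ext, subst partial_deriv_eqI[OF der]) (simp add: algebra_simps)
  have "?f differentiable_on UNIV"
    using der unfolding differentiable_on_def differentiable_def by blast
  then show ?case unfolding C_k.simps pd by (intro conjI allI C_k_add C_k_mult C_k_const Suc)
qed

lemma flat_fun_0: "0 \<le> flat_fun 0 t" "flat_fun 0 t \<le> 1" "t \<le> 0 \<Longrightarrow> flat_fun 0 t = 0"
  by (auto simp: flat_fun_def divide_le_eq_1)

lemma flat_fun_0_tendsto:
  assumes "0 < t" shows "(\<lambda>n. flat_fun 0 (real (Suc n) * t)) \<longlonglongrightarrow> 1"
proof -
  have "(\<lambda>n. 1 / exp (inverse (real (Suc n)) * inverse t)) \<longlonglongrightarrow> 1 / exp (0 * inverse t)"
    by (intro tendsto_intros LIMSEQ_inverse_real_of_nat) simp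
  then show ?thesis using assms by (simp add: flat_fun_def inverse_mult_distrib)
qed

text \<open>The factor \<open>Suc n\<close> steepens the profile, so the bumps tend to the indicator
  of the open box from inside it: smooth test functions determine integrals over boxes.\<close>

definition box_bump :: "nat \<Rightarrow> real^'n \<Rightarrow> real^'n \<Rightarrow> real^'n \<Rightarrow> real" where
  "box_bump n a b x = (\<Prod>i\<in>UNIV. flat_fun 0 (real (Suc n) * (x $ i - a $ i)) * flat_fun 0 (real (Suc n) * (b $ i - x $ i)))"

lemma box_bump_bounds: "0 \<le> box_bump n a b x" "box_bump n a b x \<le> 1"
  unfolding box_bump_def
  by (auto intro!: prod_nonneg prod_le_1 mult_nonneg_nonneg mult_le_one flat_fun_0)

lemma box_bump_outside:
  fixes x :: "real^'n"
  assumes "x \<notin> box a b" shows "box_bump n a b x = 0"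
proof -
  obtain i where "x $ i - a $ i \<le> 0 \<or> b $ i - x $ i \<le> 0"
    using assms by (auto simp: mem_box_cart not_less)
  then have "real (Suc n) * (x $ i - a $ i) \<le> 0 \<or> real (Suc n) * (b $ i - x $ i) \<le> 0"
    by (auto intro: mult_nonneg_nonpos)
  then have "flat_fun 0 (real (Suc n) * (x $ i - a $ i)) * flat_fun 0 (real (Suc n) * (b $ i - x $ i)) = 0"
    by (auto simp: flat_fun_0(3))
  then show ?thesis unfolding box_bump_def by (intro prod_zero) auto
qed

lemma box_bump_tendsto: "(\<lambda>n. box_bump n a b x) \<longlonglongrightarrow> indicator (box a b) (x :: real^'n)"
proof (cases "x \<in> box a b")
  case True
  have "(\<lambda>n. box_bump n a b x) \<longlonglongrightarrow> (\<Prod>i\<in>(UNIV::'n set). 1 * 1)"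
    unfolding box_bump_def
    by (intro tendsto_prod tendsto_mult flat_fun_0_tendsto) (use True in \<open>auto simp: mem_box_cart\<close>)
  then show ?thesis using True by simp
qed (simp add: box_bump_outside)

lemma test_function_box_bump: "test_function (box_bump n a b :: real^'n \<Rightarrow> real)"
  unfolding test_function_def
proof (intro conjI allI)
  fix k
  have *: "flat_fun 0 (real (Suc n) * (x $ i - a $ i)) = flat_fun 0 (real (Suc n) * x $ i + (- real (Suc n) * a $ i))"
    "flat_fun 0 (real (Suc n) * (b $ i - x $ i)) = flat_fun 0 ((- real (Suc n)) * x $ i + (real (Suc n) * b $ i))"
    for i and x :: "real^'n" by (auto simp: algebra_simps)
  show "C_k k (box_bump n a b :: real^'n \<Rightarrow> real)"
    unfolding box_bump_def[abs_def] * by (intro C_k_prod C_k_mult C_k_flat_fun) auto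
  have "closure {x. box_bump n a b x \<noteq> 0} \<subseteq> cbox a b"
    by (rule closure_minimal) (use box_bump_outside[of _ a b n] box_subset_cbox[of a b] in auto)
  then show "compact (closure {x. box_bump n a b x \<noteq> 0})"
    using bounded_subset[OF bounded_cbox] by (simp add: compact_eq_bounded_closed)
qed

section \<open>Uniqueness of weak derivatives\<close>

lemma locally_integrable_measurable:
  assumes "locally_integrable g"
  shows "g \<in> borel_measurable borel"
proof -
  have m: "(\<lambda>x. indicator (cball 0 (real n)) x *\<^sub>R g x) \<in> borel_measurable borel" for n
  proof -
    have "integrable lborel (\<lambda>x. indicator (cball 0 (real n)) x *\<^sub>R g x)"
      using assms compact_cball unfolding locally_integrable_def set_integrable_def by blast
    from borel_measurable_integrable[OF this] show ?thesis by (simp only: measurable_lborel2)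
  qed
  have lim: "(\<lambda>n. indicator (cball 0 (real n)) x *\<^sub>R g x) \<longlonglongrightarrow> g x" for x
  proof (rule tendsto_eventually)
    obtain m where "norm x < real m" using reals_Archimedean2 by blast
    then show "\<forall>\<^sub>F n in sequentially. indicator (cball 0 (real n)) x *\<^sub>R g x = g x"
      by (intro eventually_sequentiallyI[of m]) (auto simp: indicator_def)
  qed
  show ?thesis by (rule borel_measurable_LIMSEQ_metric[OF m lim])
qed

lemma locally_integrable_diff:
  "locally_integrable f \<Longrightarrow> locally_integrable g \<Longrightarrow> locally_integrable (\<lambda>x. f x - g x)"
  unfolding locally_integrable_def using set_integral_diff(1) by blast

lemma test_function_measurable:
  fixes \<phi> :: "real^'n \<Rightarrow> real"
  assumes "test_function \<phi>" shows "\<phi> \<in> borel_measurable borel"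
proof -
  have "C_k 0 \<phi>" using assms by (simp add: test_function_def)
  then show ?thesis by (simp add: borel_measurable_continuous_onI)
qed

lemma continuous_compact_support_bounded:
  fixes \<phi> :: "real^'n \<Rightarrow> real"
  assumes c: "continuous_on UNIV \<phi>" and K: "compact K" and supp: "\<And>x. x \<notin> K \<Longrightarrow> \<phi> x = 0"
  obtains B where "0 \<le> B" "\<And>x. \<bar>\<phi> x\<bar> \<le> B"
proof -
  have "bounded (\<phi> ` K)" using c K by (intro compact_imp_bounded compact_continuous_image) (auto intro: continuous_on_subset)
  then obtain B where B: "\<forall>x\<in>K. \<bar>\<phi> x\<bar> \<le> B" by (auto simp: bounded_iff)
  show thesis by (rule that[of "max 0 B"]) (use B supp in \<open>force simp: le_max_iff_disj\<close>)+
qed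

lemma locally_integrable_mult_bounded:
  fixes g \<psi> :: "real^'n \<Rightarrow> real"
  assumes g: "locally_integrable g" and m: "\<psi> \<in> borel_measurable borel" and K: "compact K"
    and bound: "\<And>x. \<bar>\<psi> x\<bar> \<le> B * indicator K x"
  shows "integrable lborel (\<lambda>x. g x * \<psi> x)"
proof (rule Bochner_Integration.integrable_bound)
  show "integrable lborel (\<lambda>x. B * (indicator K x *\<^sub>R g x))"
    using g K unfolding locally_integrable_def set_integrable_def by auto
  show "(\<lambda>x. g x * \<psi> x) \<in> borel_measurable lborel"
    using m locally_integrable_measurable[OF g] by measurable
  show "AE x in lborel. norm (g x * \<psi> x) \<le> norm (B * (indicator K x *\<^sub>R g x))"
  proof (rule AE_I2)
    fix x
    have "\<bar>g x\<bar> * \<bar>\<psi> x\<bar> \<le> \<bar>g x\<bar> * \<bar>B * indicator K x\<bar>"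
      using bound[of x] by (intro mult_left_mono) auto
    then show "norm (g x * \<psi> x) \<le> norm (B * (indicator K x *\<^sub>R g x))"
      by (simp add: abs_mult mult_ac)
  qed
qed

lemma test_function_integrable:
  fixes g \<phi> :: "real^'n \<Rightarrow> real"
  assumes g: "locally_integrable g" and \<phi>: "test_function \<phi>"
  shows "integrable lborel (\<lambda>x. g x * \<phi> x)"
proof -
  let ?K = "closure {x. \<phi> x \<noteq> 0}"
  have K: "compact ?K" "\<And>x. x \<notin> ?K \<Longrightarrow> \<phi> x = 0" and c: "C_k 0 \<phi>"
    using \<phi> closure_subset[of "{x. \<phi> x \<noteq> 0}"] by (auto simp only: test_function_def)
  obtain B where B: "0 \<le> B" "\<And>x. \<bar>\<phi> x\<bar> \<le> B"
    using continuous_compact_support_bounded[of \<phi> ?K] c K by (metis C_k.simps(1))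
  show ?thesis
  proof (rule locally_integrable_mult_bounded[OF g test_function_measurable[OF \<phi>] K(1), of B])
    fix x show "\<bar>\<phi> x\<bar> \<le> B * indicator ?K x"
      using B(2)[of x] K(2)[of x] by (auto simp: indicator_def)
  qed
qed

text \<open>Bumps converge to indicators, so the integral of \<open>d\<close> over every box is
  zero. Boxes generate the Borel sets and are stable under intersection, hence the measures with
  densities the positive and the negative part of \<open>d\<close> coincide, and so do the densities
  almost everywhere.\<close>

lemma locally_integrable_eq_0:
  fixes d :: "real^'n \<Rightarrow> real"
  assumes d: "locally_integrable d"
    and zero: "\<And>\<phi>. test_function \<phi> \<Longrightarrow> L2_pairing d \<phi> = 0"
  shows "AE x in lborel. d x = 0"
proof -
  have [measurable]: "d \<in> borel_measurable borel" by (rule locally_integrable_measurable[OF d])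
  have ib: "integrable lborel (\<lambda>x. d x * indicator (box a b) x)" for a b
    by (rule locally_integrable_mult_bounded[OF d _ compact_cbox[of a b], of _ 1])
      (use box_subset_cbox[of a b] in \<open>auto simp: indicator_def\<close>)
  have box0: "(\<integral>x. d x * indicator (box a b) x \<partial>lborel) = 0" for a b
  proof -
    have "(\<lambda>n. \<integral>x. d x * box_bump n a b x \<partial>lborel) \<longlonglongrightarrow> (\<integral>x. d x * indicator (box a b) x \<partial>lborel)"
    proof (rule integral_dominated_convergence[where w = "\<lambda>x. \<bar>d x * indicator (box a b) x\<bar>"])
      show "AE x in lborel. (\<lambda>n. d x * box_bump n a b x) \<longlonglongrightarrow> d x * indicator (box a b) x"
        by (intro AE_I2 tendsto_mult_left box_bump_tendsto)
      show "AE x in lborel. norm (d x * box_bump n a b x) \<le> \<bar>d x * indicator (box a b) x\<bar>" for n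
      proof (rule AE_I2)
        fix x
        show "norm (d x * box_bump n a b x) \<le> \<bar>d x * indicator (box a b) x\<bar>"
          using box_bump_bounds[of n a b x] box_bump_outside[of x a b n]
          by (cases "x \<in> box a b") (auto simp: abs_mult intro!: mult_left_le)
      qed
      show "(\<lambda>x. d x * box_bump n a b x) \<in> borel_measurable lborel" for n
        using test_function_measurable[OF test_function_box_bump[of n a b]] by measurable
    qed (use ib in auto)
    moreover have "(\<integral>x. d x * box_bump n a b x \<partial>lborel) = 0" for n
      using zero[OF test_function_box_bump] by (simp add: L2_pairing_def)
    ultimately show ?thesis by (simp add: LIMSEQ_const_iff)
  qed
  have pm: "(\<integral>\<^sup>+x. ennreal (d x) * indicator (box a b) x \<partial>lborel) = (\<integral>\<^sup>+x. ennreal (- d x) * indicator (box a b) x \<partial>lborel)"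
    and fin: "(\<integral>\<^sup>+x. ennreal (d x) * indicator (box a b) x \<partial>lborel) \<noteq> \<infinity>" for a b
  proof -
    let ?f = "\<lambda>x. d x * indicator (box a b) x"
    have 1: "ennreal (d x) * indicator (box a b) x = ennreal (?f x)" "ennreal (- d x) * indicator (box a b) x = ennreal (- ?f x)" for x
      by (auto simp: indicator_def)
    have f: "(\<integral>\<^sup>+x. ennreal (?f x) \<partial>lborel) \<noteq> \<infinity>" "(\<integral>\<^sup>+x. ennreal (- ?f x) \<partial>lborel) \<noteq> \<infinity>"
      using ib[of a b] by (auto simp: real_integrable_def)
    have eq: "enn2real (\<integral>\<^sup>+x. ennreal (?f x) \<partial>lborel) = enn2real (\<integral>\<^sup>+x. ennreal (- ?f x) \<partial>lborel)"
      using box0[of a b] real_lebesgue_integral_def[OF ib[of a b]] by simp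
    have er: "ennreal (enn2real y) = y" if "y \<noteq> \<infinity>" for y :: ennreal
      using that by (simp add: less_top)
    have "(\<integral>\<^sup>+x. ennreal (?f x) \<partial>lborel) = ennreal (enn2real (\<integral>\<^sup>+x. ennreal (?f x) \<partial>lborel))"
      by (rule er[OF f(1), symmetric])
    also have "\<dots> = (\<integral>\<^sup>+x. ennreal (- ?f x) \<partial>lborel)"
      unfolding eq by (rule er[OF f(2)])
    finally have "(\<integral>\<^sup>+x. ennreal (?f x) \<partial>lborel) = (\<integral>\<^sup>+x. ennreal (- ?f x) \<partial>lborel)" .
    then show "(\<integral>\<^sup>+x. ennreal (d x) * indicator (box a b) x \<partial>lborel) = (\<integral>\<^sup>+x. ennreal (- d x) * indicator (box a b) x \<partial>lborel)"
      "(\<integral>\<^sup>+x. ennreal (d x) * indicator (box a b) x \<partial>lborel) \<noteq> \<infinity>"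
      using f by (simp_all only: 1)
  qed
  \<comment> \<open>Since \<open>ennreal\<close> sends negative numbers to \<open>0\<close>, these
    two densities are the positive and the negative part of \<open>d\<close>.\<close>
  have "density lborel (\<lambda>x. ennreal (d x)) = density lborel (\<lambda>x. ennreal (- d x))"
  proof (rule measure_eqI_generator_eq)
    let ?E = "range (\<lambda>(a, b). box a b :: (real^'n) set)"
    let ?A = "\<lambda>n::nat. box (- (real n *\<^sub>R One)) (real n *\<^sub>R One) :: (real^'n) set"
    show "Int_stable ?E" by (auto simp: Int_stable_def box_Int_box)
    show "?E \<subseteq> Pow UNIV" by simp
    show "emeasure (density lborel (\<lambda>x. ennreal (d x))) X = emeasure (density lborel (\<lambda>x. ennreal (- d x))) X" if "X \<in> ?E" for X
      using that pm by (auto simp: emeasure_density)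
    show "sets (density lborel (\<lambda>x. ennreal (d x))) = sigma_sets UNIV ?E"
      "sets (density lborel (\<lambda>x. ennreal (- d x))) = sigma_sets UNIV ?E"
      by (simp_all add: borel_eq_box)
    show "range ?A \<subseteq> ?E" by auto
    show "(\<Union>i. ?A i) = UNIV" by (rule UN_box_eq_UNIV)
    show "emeasure (density lborel (\<lambda>x. ennreal (d x))) (?A i) \<noteq> \<infinity>" for i
      using fin by (simp add: emeasure_density)
  qed
  then have "AE x in lborel. ennreal (d x) = ennreal (- d x)"
    by (intro sigma_finite_measure.density_unique[OF sigma_finite_lborel]) auto
  then show ?thesis
  proof eventually_elim
    fix x assume e: "ennreal (d x) = ennreal (- d x)"
    show "d x = 0"
    proof (cases "0 \<le> d x")
      case True
      then have "ennreal (d x) = 0" using e by (simp add: ennreal_neg)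
      then show ?thesis using True by (simp add: ennreal_eq_0_iff)
    next
      case False
      then have "ennreal (- d x) = 0" using e by (simp add: ennreal_neg)
      then show ?thesis using False by (simp add: ennreal_eq_0_iff)
    qed
  qed
qed

text \<open>\<open>weak_partial\<close> is an arbitrary choice; uniqueness transfers to it the
  bounds proved for a constructed derivative.\<close>

lemma has_weak_partial_unique:
  fixes u :: "real^'n \<Rightarrow> real"
  assumes g: "has_weak_partial i u g" and k: "has_weak_partial i u k"
  shows "AE x in lborel. g x = k x"
proof -
  have li: "locally_integrable g" "locally_integrable k" using g k by (simp_all add: has_weak_partial_def)
  have "AE x in lborel. g x - k x = 0"
  proof (rule locally_integrable_eq_0[OF locally_integrable_diff[OF li]])
    fix \<phi> :: "real^'n \<Rightarrow> real" assume \<phi>: "test_function \<phi>"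
    have "L2_pairing g \<phi> = L2_pairing k \<phi>"
      using g k \<phi> unfolding has_weak_partial_def by (metis minus_equation_iff)
    then show "L2_pairing (\<lambda>x. g x - k x) \<phi> = 0"
      using test_function_integrable[OF li(1) \<phi>] test_function_integrable[OF li(2) \<phi>]
      by (simp add: L2_pairing_def left_diff_distrib)
  qed
  then show ?thesis by eventually_elim simp
qed

section \<open>Derivatives of functions with small second differences\<close>

lemma geometric_sum_le:
  fixes q :: real
  assumes q: "0 < q" "q < 1"
  shows "(\<Sum>k=K..<M. q ^ k) \<le> q ^ K / (1 - q)"
proof (cases "K \<le> M")
  case True
  have "(\<Sum>k=K..<M. q ^ k) = q ^ K * (\<Sum>k<M - K. q ^ k)"
    by (subst sum.atLeastLessThan_shift_0) (simp add: power_add sum_distrib_left atLeast0LessThan)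
  also have "(\<Sum>k<M - K. q ^ k) = (1 - q ^ (M - K)) / (1 - q)"
    using q by (subst sum_gp_strict) simp
  also have "q ^ K * ((1 - q ^ (M - K)) / (1 - q)) \<le> q ^ K / (1 - q)"
    using q by (simp add: field_simps)
  finally show ?thesis .
qed (use q in simp)

text \<open>Cauchy-Schwarz after splitting \<open>a k\<close> into \<open>sqrt (q ^ k)\<close> and
  \<open>a k / sqrt (q ^ k)\<close>.\<close>

lemma sum_square_weighted:
  fixes a :: "nat \<Rightarrow> real"
  assumes q: "0 < q" "q < 1"
  shows "(\<Sum>k=K..<M. a k)\<^sup>2 \<le> q ^ K / (1 - q) * (\<Sum>k=K..<M. (a k)\<^sup>2 / q ^ k)"
proof -
  have "(\<Sum>k=K..<M. a k) = (\<Sum>k=K..<M. sqrt (q ^ k) * (a k / sqrt (q ^ k)))"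
    using q by (intro sum.cong) auto
  also have "\<dots>\<^sup>2 \<le> (\<Sum>k=K..<M. (sqrt (q ^ k))\<^sup>2) * (\<Sum>k=K..<M. (a k / sqrt (q ^ k))\<^sup>2)"
    by (rule Cauchy_Schwarz_ineq_sum)
  also have "\<dots> = (\<Sum>k=K..<M. q ^ k) * (\<Sum>k=K..<M. (a k)\<^sup>2 / q ^ k)"
    using q by (simp add: power_divide)
  also have "\<dots> \<le> (q ^ K / (1 - q)) * (\<Sum>k=K..<M. (a k)\<^sup>2 / q ^ k)"
    using q by (intro mult_right_mono sum_nonneg geometric_sum_le) auto
  finally show ?thesis .
qed

text \<open>
  The weights \<open>q^(-k)\<close> turn geometric decay of the terms in \<open>L\<^sup>2\<close> into almost everywhere
  summability, so that no completeness theorem for \<open>L\<^sup>2\<close> is needed.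
\<close>

lemma L2_geometric_series:
  fixes d :: "nat \<Rightarrow> real^'n \<Rightarrow> real"
  assumes [measurable]: "\<And>k. d k \<in> borel_measurable borel"
    and q: "0 < q" "q < 1" and A: "0 \<le> A"
    and le: "\<And>k. sqn (d k) \<le> ennreal (A * q ^ (2 * k))"
  obtains g where "g \<in> borel_measurable borel"
    "\<And>K. sqn (\<lambda>x. g x - (\<Sum>k<K. d k x)) \<le> ennreal (A * q ^ (2 * K) / (1 - q)\<^sup>2)"
proof -
  \<comment> \<open>Dividing by \<open>q ^ k\<close> spends half of the decay
    \<open>q ^ (2 * k)\<close>; what remains is still summable.\<close>
  have w: "(\<integral>\<^sup>+x. ennreal ((d k x)\<^sup>2 / q ^ k) \<partial>lborel) \<le> ennreal (A * q ^ k)" for k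
  proof -
    have "(\<integral>\<^sup>+x. ennreal ((d k x)\<^sup>2 / q ^ k) \<partial>lborel) = (\<integral>\<^sup>+x. ennreal (1 / q ^ k) * ennreal ((d k x)\<^sup>2) \<partial>lborel)"
      using q by (intro nn_integral_cong) (simp add: ennreal_mult[symmetric])
    also have "\<dots> = ennreal (1 / q ^ k) * sqn (d k)"
      unfolding sqn_def by (rule nn_integral_cmult) measurable
    also have "\<dots> \<le> ennreal (1 / q ^ k) * ennreal (A * q ^ (2 * k))"
      by (intro mult_left_mono le) simp
    also have "\<dots> = ennreal (1 / q ^ k * (A * q ^ (2 * k)))"
      using q A by (intro ennreal_mult[symmetric]) auto
    also have "1 / q ^ k * (A * q ^ (2 * k)) = A * q ^ k"
      using q unfolding mult_2 power_add by simp
    finally show ?thesis .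
  qed
  have geo: "summable (\<lambda>k. q ^ k)" using q by (intro summable_geometric) auto
  have "(\<integral>\<^sup>+x. (\<Sum>k. ennreal ((d k x)\<^sup>2 / q ^ k)) \<partial>lborel) = (\<Sum>k. \<integral>\<^sup>+x. ennreal ((d k x)\<^sup>2 / q ^ k) \<partial>lborel)"
    by (rule nn_integral_suminf) measurable
  also have "\<dots> \<le> (\<Sum>k. ennreal (A * q ^ k))" by (intro suminf_le w) auto
  also have "\<dots> < \<infinity>"
  proof -
    have "(\<Sum>k. ennreal (A * q ^ k)) \<noteq> top"
      using A q by (intro ennreal_suminf_neq_top summable_mult geo) auto
    then show ?thesis by (simp add: less_top)
  qed
  finally have "(\<integral>\<^sup>+x. (\<Sum>k. ennreal ((d k x)\<^sup>2 / q ^ k)) \<partial>lborel) \<noteq> \<infinity>" by simp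
  then have "AE x in lborel. (\<Sum>k. ennreal ((d k x)\<^sup>2 / q ^ k)) \<noteq> \<infinity>"
    by (intro nn_integral_PInf_AE) measurable
  then have summ: "AE x in lborel. summable (\<lambda>k. d k x)"
  proof eventually_elim
    fix x assume "(\<Sum>k. ennreal ((d k x)\<^sup>2 / q ^ k)) \<noteq> \<infinity>"
    then have s1: "summable (\<lambda>k. (d k x)\<^sup>2 / q ^ k)"
      using q by (intro summable_suminf_not_top) auto
    show "summable (\<lambda>k. d k x)"
    proof (rule summable_comparison_test[OF _ summable_add[OF s1 geo]], intro exI allI impI)
      fix k :: nat
      have "2 * (\<bar>d k x\<bar> / sqrt (q ^ k)) * sqrt (q ^ k) \<le> (\<bar>d k x\<bar> / sqrt (q ^ k))\<^sup>2 + (sqrt (q ^ k))\<^sup>2"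
        by (rule sum_squares_bound)
      then have "2 * \<bar>d k x\<bar> \<le> (d k x)\<^sup>2 / q ^ k + q ^ k"
        using q by (simp add: power_divide)
      then show "norm (d k x) \<le> (d k x)\<^sup>2 / q ^ k + q ^ k" by simp
    qed
  qed
  \<comment> \<open>Where the series diverges this is an arbitrary default value, which affects a
    null set only.\<close>
  define g where "g x = (\<Sum>k. d k x)" for x
  have gm [measurable]: "g \<in> borel_measurable borel" unfolding g_def[abs_def] by measurable
  have "sqn (\<lambda>x. g x - (\<Sum>k<K. d k x)) \<le> ennreal (A * q ^ (2 * K) / (1 - q)\<^sup>2)" for K
  proof -
    let ?S = "\<lambda>M x. \<Sum>k=K..<M. d k x"
    have lim: "AE x in lborel. (\<lambda>M. ennreal ((?S M x)\<^sup>2)) \<longlonglongrightarrow> ennreal ((g x - (\<Sum>k<K. d k x))\<^sup>2)"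
      using summ
    proof eventually_elim
      fix x assume "summable (\<lambda>k. d k x)"
      then have "(\<lambda>M. (\<Sum>k<M. d k x)) \<longlonglongrightarrow> g x" unfolding g_def by (rule summable_LIMSEQ)
      then have "(\<lambda>M. ennreal (((\<Sum>k<M. d k x) - (\<Sum>k<K. d k x))\<^sup>2)) \<longlonglongrightarrow> ennreal ((g x - (\<Sum>k<K. d k x))\<^sup>2)"
        by (intro tendsto_ennrealI tendsto_intros)
      moreover have "\<forall>\<^sub>F M in sequentially. ennreal (((\<Sum>k<M. d k x) - (\<Sum>k<K. d k x))\<^sup>2) = ennreal ((?S M x)\<^sup>2)"
      proof (rule eventually_sequentiallyI[of K])
        fix M assume "K \<le> M"
        then have "(\<Sum>k<M. d k x) = (\<Sum>k<K. d k x) + ?S M x"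
          unfolding lessThan_atLeast0 by (rule sum.atLeastLessThan_concat[symmetric, OF le0])
        then show "ennreal (((\<Sum>k<M. d k x) - (\<Sum>k<K. d k x))\<^sup>2) = ennreal ((?S M x)\<^sup>2)" by simp
      qed
      ultimately show "(\<lambda>M. ennreal ((?S M x)\<^sup>2)) \<longlonglongrightarrow> ennreal ((g x - (\<Sum>k<K. d k x))\<^sup>2)"
        by (rule Lim_transform_eventually)
    qed
    have part: "(\<integral>\<^sup>+x. ennreal ((?S M x)\<^sup>2) \<partial>lborel) \<le> ennreal (A * q ^ (2 * K) / (1 - q)\<^sup>2)" if "K \<le> M" for M
    proof -
      have "(\<integral>\<^sup>+x. ennreal ((?S M x)\<^sup>2) \<partial>lborel) \<le> (\<integral>\<^sup>+x. ennreal (q ^ K / (1 - q)) * (\<Sum>k=K..<M. ennreal ((d k x)\<^sup>2 / q ^ k)) \<partial>lborel)"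
      proof (rule nn_integral_mono)
        fix x
        have "ennreal ((?S M x)\<^sup>2) \<le> ennreal (q ^ K / (1 - q) * (\<Sum>k=K..<M. (d k x)\<^sup>2 / q ^ k))"
          by (intro ennreal_leI sum_square_weighted q)
        also have "\<dots> = ennreal (q ^ K / (1 - q)) * ennreal (\<Sum>k=K..<M. (d k x)\<^sup>2 / q ^ k)"
          using q by (intro ennreal_mult sum_nonneg) auto
        also have "ennreal (\<Sum>k=K..<M. (d k x)\<^sup>2 / q ^ k) = (\<Sum>k=K..<M. ennreal ((d k x)\<^sup>2 / q ^ k))"
          using q by (intro sum_ennreal[symmetric]) auto
        finally show "ennreal ((?S M x)\<^sup>2) \<le> ennreal (q ^ K / (1 - q)) * (\<Sum>k=K..<M. ennreal ((d k x)\<^sup>2 / q ^ k))" .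
      qed
      also have "\<dots> = ennreal (q ^ K / (1 - q)) * (\<Sum>k=K..<M. \<integral>\<^sup>+x. ennreal ((d k x)\<^sup>2 / q ^ k) \<partial>lborel)"
        by (subst nn_integral_cmult, measurable, subst nn_integral_sum, measurable)
      also have "\<dots> \<le> ennreal (q ^ K / (1 - q)) * (\<Sum>k=K..<M. ennreal (A * q ^ k))"
        by (intro mult_left_mono sum_mono w) auto
      also have "(\<Sum>k=K..<M. ennreal (A * q ^ k)) = ennreal (\<Sum>k=K..<M. A * q ^ k)"
        using A q by (intro sum_ennreal) auto
      also have "\<dots> \<le> ennreal (A * (q ^ K / (1 - q)))"
        unfolding sum_distrib_left[symmetric]
        by (intro ennreal_leI mult_left_mono geometric_sum_le q A)
      finally have "(\<integral>\<^sup>+x. ennreal ((?S M x)\<^sup>2) \<partial>lborel) \<le> ennreal (q ^ K / (1 - q)) * ennreal (A * (q ^ K / (1 - q)))"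
        by (simp add: mult_left_mono)
      also have "\<dots> = ennreal (q ^ K / (1 - q) * (A * (q ^ K / (1 - q))))"
        using q A by (intro ennreal_mult[symmetric]) auto
      also have "q ^ K / (1 - q) * (A * (q ^ K / (1 - q))) = A * q ^ (2 * K) / (1 - q)\<^sup>2"
        by (simp add: power2_eq_square mult_2 power_add)
      finally show ?thesis .
    qed
    \<comment> \<open>The almost everywhere limit is written as a \<open>liminf\<close>, so that
      Fatou's lemma carries the uniform bound on partial sums over to the tail.\<close>
    have "sqn (\<lambda>x. g x - (\<Sum>k<K. d k x)) = (\<integral>\<^sup>+x. liminf (\<lambda>M. ennreal ((?S M x)\<^sup>2)) \<partial>lborel)"
      unfolding sqn_def
    proof (rule nn_integral_cong_AE)
      show "AE x in lborel. ennreal ((g x - (\<Sum>k<K. d k x))\<^sup>2) = liminf (\<lambda>M. ennreal ((?S M x)\<^sup>2))"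
        using lim by eventually_elim (rule lim_imp_Liminf[OF sequentially_bot, symmetric])
    qed
    also have "\<dots> \<le> liminf (\<lambda>M. \<integral>\<^sup>+x. ennreal ((?S M x)\<^sup>2) \<partial>lborel)"
      by (rule nn_integral_liminf) measurable
    also have "\<dots> \<le> ennreal (A * q ^ (2 * K) / (1 - q)\<^sup>2)"
      using part by (intro Liminf_le eventually_sequentiallyI[of K]) auto
    finally show ?thesis .
  qed
  with gm show thesis by (rule that)
qed

lemma sqn_fdiff_fdiff_le:
  assumes "v \<in> borel_measurable borel"
  shows "sqn (fdiff h (fdiff h v)) \<le> 16 * sqn v"
proof -
  have "sqn (fdiff h (fdiff h v)) \<le> 4 * (4 * sqn v)"
    by (rule order_trans[OF sqn_fdiff_le mult_left_mono[OF sqn_fdiff_le]]) (simp_all add: assms fdiff_measurable)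
  then show ?thesis by (simp flip: mult.assoc)
qed

lemma sqn_cmult_le:
  assumes "v \<in> borel_measurable borel" "sqn v \<le> ennreal (a\<^sup>2)"
  shows "sqn (\<lambda>x. c * v x) \<le> ennreal ((c * a)\<^sup>2)"
proof -
  have "sqn (\<lambda>x. c * v x) = ennreal (c\<^sup>2) * sqn v" by (rule sqn_cmult[OF assms(1)])
  also have "\<dots> \<le> ennreal (c\<^sup>2) * ennreal (a\<^sup>2)" by (intro mult_left_mono assms(2)) simp
  also have "\<dots> = ennreal ((c * a)\<^sup>2)" by (simp add: power_mult_distrib ennreal_mult)
  finally show ?thesis .
qed

text \<open>
  \<open>2 D (h/2) u - D h u\<close> is minus the second difference with increment \<open>h/2\<close>, so the difference
  quotients along \<open>e / 2^k\<close> converge geometrically.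
\<close>

lemma difference_quotients_converge:
  fixes u :: "real^'n \<Rightarrow> real" and e :: "real^'n"
  assumes um [measurable]: "u \<in> borel_measurable borel" and e: "norm e = 1"
    and r: "1 < r" and M: "0 \<le> M"
    and le: "\<And>h. h \<noteq> 0 \<Longrightarrow> sqn (fdiff h (fdiff h u)) \<le> ennreal ((M * norm h powr r)\<^sup>2)"
  obtains g where "g \<in> borel_measurable borel"
    "\<And>k. sqn (\<lambda>x. g x - 2 ^ k * fdiff ((1 / 2 ^ k) *\<^sub>R e) u x) \<le> ennreal ((M * (2 powr (1 - r)) ^ k / (1 - 2 powr (1 - r)))\<^sup>2)"
proof -
  let ?q = "2 powr (1 - r)"
  have q: "0 < ?q" "?q < 1" using r by (auto simp: powr_less_one)
  define w where "w k = (\<lambda>x. 2 ^ k * fdiff ((1 / 2 ^ k) *\<^sub>R e) u x)" for k :: nat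
  have wm [measurable]: "w k \<in> borel_measurable borel" for k unfolding w_def by measurable
  define d where "d k = (\<lambda>x. w (Suc k) x - w k x)" for k
  have dm: "d k \<in> borel_measurable borel" for k unfolding d_def by measurable
  have "sqn (d k) \<le> ennreal (M\<^sup>2 * ?q ^ (2 * k))" for k
  proof -
    define h where "h = (1 / 2 ^ Suc k) *\<^sub>R e"
    have "2 powr (- real (Suc k)) = 1 / (2::real) ^ Suc k"
      by (simp only: powr_minus powr_realpow zero_less_numeral inverse_eq_divide)
    then have h: "h \<noteq> 0" "norm h = 2 powr (- real (Suc k))"
      using e by (auto simp: h_def)
    have "(1 / 2 ^ k :: real) = 1 / 2 ^ Suc k + 1 / 2 ^ Suc k" by simp
    then have hh: "(1 / 2 ^ k) *\<^sub>R e = h + h" unfolding h_def by (simp only: scaleR_left_distrib)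
    have w: "w k = (\<lambda>x. 2 ^ k * fdiff (h + h) u x)" "w (Suc k) = (\<lambda>x. 2 * 2 ^ k * fdiff h u x)"
      by (simp add: w_def hh) (simp add: w_def h_def)
    have d: "d k = (\<lambda>x. (- (2 ^ k)) * fdiff h (fdiff h u) x)"
      unfolding d_def w by (auto simp: fdiff_def add.assoc algebra_simps)
    have "sqn (d k) \<le> ennreal ((- (2 ^ k) * (M * norm h powr r))\<^sup>2)"
      unfolding d by (rule sqn_cmult_le[OF _ le[OF h(1)]]) measurable
    also have "\<dots> \<le> ennreal (M\<^sup>2 * ?q ^ (2 * k))"
    proof (rule ennreal_leI)
      \<comment> \<open>The exact exponent is \<open>- (k + 1) * r\<close>; dropping the
        \<open>1\<close> gives a clean power of the ratio \<open>2 powr (1 - r)\<close>.\<close>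
      have "norm h powr r \<le> 2 powr (- real k * r)"
        unfolding h(2) powr_powr using r by (intro powr_mono) (auto simp: algebra_simps)
      then have "2 ^ k * (M * norm h powr r) \<le> 2 ^ k * (M * 2 powr (- real k * r))"
        using M by (intro mult_left_mono) auto
      also have "\<dots> = M * ?q ^ k"
        by (simp add: powr_realpow[symmetric] powr_powr powr_add[symmetric] algebra_simps)
      finally have "(2 ^ k * (M * norm h powr r))\<^sup>2 \<le> (M * ?q ^ k)\<^sup>2"
        using M by (intro power_mono) auto
      then show "(- (2 ^ k) * (M * norm h powr r))\<^sup>2 \<le> M\<^sup>2 * ?q ^ (2 * k)"
        by (simp add: power_mult_distrib power_even_eq)
    qed
    finally show ?thesis .
  qed
  from L2_geometric_series[OF dm q zero_le_power2 this]
  obtain g where gm [measurable]: "g \<in> borel_measurable borel"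
    and g: "\<And>K. sqn (\<lambda>x. g x - (\<Sum>k<K. d k x)) \<le> ennreal (M\<^sup>2 * ?q ^ (2 * K) / (1 - ?q)\<^sup>2)"
    by blast
  have tel: "(\<Sum>k<K. d k x) = w K x - w 0 x" for K x
    unfolding d_def by (rule sum_lessThan_telescope)
  show thesis
  proof (rule that)
    \<comment> \<open>The series sums the increments \<open>w (Suc k) - w k\<close>, so the initial
      quotient \<open>w 0\<close> has to be added back to obtain the limit.\<close>
    show "(\<lambda>x. g x + w 0 x) \<in> borel_measurable borel" by measurable
    fix K
    have "(\<lambda>x. (g x + w 0 x) - 2 ^ K * fdiff ((1 / 2 ^ K) *\<^sub>R e) u x) = (\<lambda>x. g x - (\<Sum>k<K. d k x))"
      unfolding tel by (auto simp: w_def)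
    moreover have "M\<^sup>2 * ?q ^ (2 * K) / (1 - ?q)\<^sup>2 = (M * ?q ^ K / (1 - ?q))\<^sup>2"
      by (simp add: power_mult_distrib power_divide power_even_eq)
    ultimately show "sqn (\<lambda>x. (g x + w 0 x) - 2 ^ K * fdiff ((1 / 2 ^ K) *\<^sub>R e) u x) \<le> ennreal ((M * ?q ^ K / (1 - ?q))\<^sup>2)"
      using g[of K] by simp
  qed
qed

text \<open>Compare \<open>g\<close> with the difference quotient of step \<open>2^-k\<close>
  comparable to \<open>|h|\<close>. The distance to it is of order
  \<open>(2^-k) powr (r - 1)\<close>, and its own second difference is \<open>2^k\<close> times a
  difference of the second difference of \<open>u\<close>, hence of order \<open>2^k |h|^r\<close>;
  both are \<open>|h|^(r - 1)\<close>.\<close>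

lemma derivative_second_difference:
  fixes u g :: "real^'n \<Rightarrow> real" and e :: "real^'n"
  assumes um [measurable]: "u \<in> borel_measurable borel" and gm [measurable]: "g \<in> borel_measurable borel"
    and e: "norm e = 1" and r: "1 < r" and M: "0 \<le> M" and B: "0 \<le> B"
    and le: "\<And>h. h \<noteq> 0 \<Longrightarrow> sqn (fdiff h (fdiff h u)) \<le> ennreal ((M * norm h powr r)\<^sup>2)"
    and g: "\<And>k. sqn (\<lambda>x. g x - 2 ^ k * fdiff ((1 / 2 ^ k) *\<^sub>R e) u x) \<le> ennreal ((B * (2 powr (1 - r)) ^ k)\<^sup>2)"
    and h: "h \<noteq> 0" "norm h \<le> 1"
  shows "sqn (fdiff h (fdiff h g)) \<le> ennreal (32 * (B\<^sup>2 + M\<^sup>2) * (2 powr r * norm h powr (r - 1))\<^sup>2)"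
proof -
  \<comment> \<open>The floor yields \<open>|h| \<le> 2^-k < 2 |h|\<close>; the left inequality
    serves the quotient, the right one the distance to it.\<close>
  define k where "k = nat \<lfloor>- log 2 (norm h)\<rfloor>"
  have p: "0 < norm h" using h by simp
  have "log 2 (norm h) \<le> log 2 1" using h p by (intro log_mono) auto
  then have "0 \<le> - log 2 (norm h)" by simp
  then have k: "real k \<le> - log 2 (norm h)" "- log 2 (norm h) < real k + 1"
    unfolding k_def by linarith+
  have nh: "norm h = 2 powr log 2 (norm h)" using p by simp
  let ?q = "2 powr (1 - r)"
  have k1: "?q ^ k \<le> 2 powr (r - 1) * norm h powr (r - 1)"
  proof -
    have "?q ^ k = 2 powr ((1 - r) * real k)" by (simp add: powr_realpow[symmetric] powr_powr)
    also have "\<dots> \<le> 2 powr ((r - 1) * (1 + log 2 (norm h)))"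
    proof (rule powr_mono)
      have "(r - 1) * (- real k) \<le> (r - 1) * (1 + log 2 (norm h))"
        using r k(2) by (intro mult_left_mono) auto
      then show "(1 - r) * real k \<le> (r - 1) * (1 + log 2 (norm h))" by (simp add: algebra_simps)
    qed simp
    also have "\<dots> = 2 powr (r - 1) * (2 powr log 2 (norm h)) powr (r - 1)"
      by (simp add: powr_powr powr_add[symmetric] algebra_simps)
    finally show ?thesis using p by simp
  qed
  have k2: "2 ^ k * norm h \<le> 1"
  proof -
    have "(2::real) ^ k = 2 powr real k" by (simp add: powr_realpow)
    also have "\<dots> \<le> 2 powr (- log 2 (norm h))" using k(1) by (intro powr_mono) auto
    also have "\<dots> = 1 / norm h" using p by (simp add: powr_minus inverse_eq_divide)
    finally show ?thesis using p by (simp add: field_simps)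
  qed
  let ?eh = "(1 / 2 ^ k) *\<^sub>R e"
  let ?w = "\<lambda>x. 2 ^ k * fdiff ?eh u x"
  \<comment> \<open>Differences with different increments commute.\<close>
  have "fdiff h (fdiff h ?w) = (\<lambda>x. 2 ^ k * fdiff ?eh (fdiff h (fdiff h u)) x)"
    unfolding fdiff_def by (auto simp: algebra_simps)
  then have "sqn (fdiff h (fdiff h ?w)) = ennreal ((2 ^ k)\<^sup>2) * sqn (fdiff ?eh (fdiff h (fdiff h u)))"
    by (simp only:) (rule sqn_cmult, measurable)
  also have "\<dots> \<le> ennreal ((2 ^ k)\<^sup>2) * (4 * ennreal ((M * norm h powr r)\<^sup>2))"
    by (intro mult_left_mono order_trans[OF sqn_fdiff_le mult_left_mono[OF le]] h) auto
  also have "\<dots> = ennreal (4 * (2 ^ k * (M * norm h powr r))\<^sup>2)"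
    by (simp add: power_mult_distrib ennreal_mult' mult_ac)
  also have "\<dots> \<le> ennreal (4 * (M * norm h powr (r - 1))\<^sup>2)"
  proof (intro ennreal_leI mult_left_mono power_mono)
    have "norm h powr r = norm h * norm h powr (r - 1)" using p by (simp add: powr_diff)
    then have "2 ^ k * (M * norm h powr r) = (2 ^ k * norm h) * (M * norm h powr (r - 1))" by simp
    also have "\<dots> \<le> 1 * (M * norm h powr (r - 1))" using k2 M by (intro mult_right_mono) auto
    finally show "2 ^ k * (M * norm h powr r) \<le> M * norm h powr (r - 1)" by simp
  qed (use M in auto)
  finally have w: "sqn (fdiff h (fdiff h ?w)) \<le> ennreal (4 * (M * norm h powr (r - 1))\<^sup>2)" .
  have "sqn (fdiff h (fdiff h (\<lambda>x. g x - ?w x))) \<le> 16 * ennreal ((B * ?q ^ k)\<^sup>2)"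
    by (rule order_trans[OF sqn_fdiff_fdiff_le mult_left_mono[OF g]]) auto
  also have "\<dots> \<le> 16 * ennreal ((B * (2 powr (r - 1) * norm h powr (r - 1)))\<^sup>2)"
    using k1 B by (intro mult_left_mono ennreal_leI power_mono) auto
  finally have R: "sqn (fdiff h (fdiff h (\<lambda>x. g x - ?w x))) \<le> 16 * ennreal ((B * (2 powr (r - 1) * norm h powr (r - 1)))\<^sup>2)" .
  have "sqn (fdiff h (fdiff h g)) \<le> 2 * sqn (fdiff h (fdiff h (\<lambda>x. g x - ?w x))) + 2 * sqn (fdiff h (fdiff h ?w))"
    by (rule sqn_le_add) (measurable, simp add: fdiff_def)
  also have "\<dots> \<le> 2 * (16 * ennreal ((B * (2 powr (r - 1) * norm h powr (r - 1)))\<^sup>2)) + 2 * ennreal (4 * (M * norm h powr (r - 1))\<^sup>2)"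
    by (intro add_mono mult_left_mono R w) auto
  also have "\<dots> = ennreal (32 * (B * (2 powr (r - 1) * norm h powr (r - 1)))\<^sup>2 + 8 * (M * norm h powr (r - 1))\<^sup>2)"
    by (simp add: ennreal_mult' flip: mult.assoc)
  also have "\<dots> \<le> ennreal (32 * (B\<^sup>2 + M\<^sup>2) * (2 powr r * norm h powr (r - 1))\<^sup>2)"
  proof (rule ennreal_leI)
    have a: "(2 powr (r - 1))\<^sup>2 \<le> (2 powr r)\<^sup>2" by (intro power_mono powr_mono) auto
    have "1 \<le> 2 powr r" using r by (intro ge_one_powr_ge_zero) auto
    then have b: "1 \<le> (2 powr r)\<^sup>2" by (rule one_le_power)
    let ?H = "(norm h powr (r - 1))\<^sup>2"
    have "32 * (B * (2 powr (r - 1) * norm h powr (r - 1)))\<^sup>2 + 8 * (M * norm h powr (r - 1))\<^sup>2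
      = 32 * B\<^sup>2 * ?H * (2 powr (r - 1))\<^sup>2 + 8 * M\<^sup>2 * ?H * 1"
      by (simp add: power_mult_distrib)
    also have "\<dots> \<le> 32 * B\<^sup>2 * ?H * (2 powr r)\<^sup>2 + 32 * M\<^sup>2 * ?H * (2 powr r)\<^sup>2"
      by (intro add_mono mult_mono a b) auto
    also have "\<dots> = 32 * (B\<^sup>2 + M\<^sup>2) * (2 powr r * norm h powr (r - 1))\<^sup>2"
      by (simp add: power_mult_distrib algebra_simps)
    finally show "32 * (B * (2 powr (r - 1) * norm h powr (r - 1)))\<^sup>2 + 8 * (M * norm h powr (r - 1))\<^sup>2
      \<le> 32 * (B\<^sup>2 + M\<^sup>2) * (2 powr r * norm h powr (r - 1))\<^sup>2" .
  qed
  finally show ?thesis .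
qed

section \<open>From difference quotients to weak derivatives\<close>

lemma L2_locally_integrable:
  fixes g :: "real^'n \<Rightarrow> real"
  assumes g: "g \<in> L2_space"
  shows "locally_integrable g"
  unfolding locally_integrable_def set_integrable_def
proof (intro allI impI)
  fix K :: "(real^'n) set" assume K: "compact K"
  show "integrable lborel (\<lambda>x. indicator K x *\<^sub>R g x)"
  proof (rule Bochner_Integration.integrable_bound)
    have Kb [measurable]: "K \<in> sets borel" using K by (simp add: compact_imp_closed)
    show "integrable lborel (\<lambda>x. indicator K x + (g x)\<^sup>2)"
      using g K emeasure_compact_finite[OF K]
      by (intro Bochner_Integration.integrable_add integrable_real_indicator) (auto simp: L2_space_def Kb)
    have [measurable]: "g \<in> borel_measurable borel" using g by (rule L2_spaceD)
    show "(\<lambda>x. indicator K x *\<^sub>R g x) \<in> borel_measurable lborel" by measurable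
    show "AE x in lborel. norm (indicator K x *\<^sub>R g x) \<le> norm (indicator K x + (g x)\<^sup>2)"
    proof (rule AE_I2)
      fix x
      have "2 * \<bar>g x\<bar> \<le> 1 + (g x)\<^sup>2" using sum_squares_bound[of "\<bar>g x\<bar>" 1] by simp
      then show "norm (indicator K x *\<^sub>R g x) \<le> norm (indicator K x + (g x)\<^sup>2)"
        by (cases "x \<in> K") auto
    qed
  qed
qed

lemma test_function_facts:
  fixes \<phi> :: "real^'n \<Rightarrow> real"
  assumes \<phi>: "test_function \<phi>"
  obtains B R where "0 \<le> B"
    "\<And>x. \<bar>\<phi> x\<bar> \<le> B * indicator (cball 0 R) x"
    "\<And>x. \<bar>partial_deriv i \<phi> x\<bar> \<le> B * indicator (cball 0 R) x"
    "continuous_on UNIV \<phi>" "continuous_on UNIV (partial_deriv i \<phi>)" "\<phi> differentiable_on UNIV"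
proof -
  have C1: "C_k (Suc 0) \<phi>" and K: "compact (closure {x. \<phi> x \<noteq> 0})"
    using \<phi> unfolding test_function_def by blast+
  then have diff: "\<phi> differentiable_on UNIV" and cd: "continuous_on UNIV (partial_deriv i \<phi>)" by simp_all
  have c: "continuous_on UNIV \<phi>" using diff by (rule differentiable_imp_continuous_on)
  obtain R where "\<forall>x\<in>closure {x. \<phi> x \<noteq> 0}. norm x \<le> R"
    using compact_imp_bounded[OF K] unfolding bounded_iff by blast
  then have R: "closure {x. \<phi> x \<noteq> 0} \<subseteq> cball 0 R" by auto
  have z: "\<phi> x = 0" if "x \<notin> cball 0 R" for x
    using that R closure_subset[of "{x. \<phi> x \<noteq> 0}"] by auto
  have zd: "partial_deriv i \<phi> x = 0" if "x \<notin> cball 0 R" for x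
  proof -
    have "((\<lambda>x. 0) has_derivative (\<lambda>v. 0)) (at x)" by simp
    then have "(\<phi> has_derivative (\<lambda>v. 0)) (at x)"
      by (rule has_derivative_transform_within_open[of _ _ _ _ "- cball 0 R"]) (use z that in auto)
    from partial_deriv_eqI[OF this, of i] show ?thesis by simp
  qed
  obtain B1 where B1: "0 \<le> B1" "\<And>x. \<bar>\<phi> x\<bar> \<le> B1"
    using continuous_compact_support_bounded[OF c compact_cball z] by blast
  obtain B2 where B2: "0 \<le> B2" "\<And>x. \<bar>partial_deriv i \<phi> x\<bar> \<le> B2"
    using continuous_compact_support_bounded[OF cd compact_cball zd] by blast
  show thesis
  proof (rule that[of "B1 + B2" R])
    fix x
    show "\<bar>\<phi> x\<bar> \<le> (B1 + B2) * indicator (cball 0 R) x"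
      using B1(2)[of x] B2(1) z[of x] by (auto simp: indicator_def)
    show "\<bar>partial_deriv i \<phi> x\<bar> \<le> (B1 + B2) * indicator (cball 0 R) x"
      using B2(2)[of x] B1(1) zd[of x] by (auto simp: indicator_def)
  qed (use B1 B2 c cd diff in auto)
qed

lemma difference_quotient_mvt:
  fixes \<phi> :: "real^'n \<Rightarrow> real"
  assumes diff: "\<phi> differentiable_on UNIV" and t: "0 < t"
  obtains z where "0 < z" "z < t" "\<phi> (x - t *\<^sub>R axis i 1) - \<phi> x = - t * partial_deriv i \<phi> (x - z *\<^sub>R axis i 1)"
proof -
  let ?e = "axis i 1 :: real^'n"
  have der: "((\<lambda>t. \<phi> (x - t *\<^sub>R ?e)) has_real_derivative - partial_deriv i \<phi> (x - t *\<^sub>R ?e)) (at t)" for t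
  proof -
    let ?D = "frechet_derivative \<phi> (at (x - t *\<^sub>R ?e))"
    have D: "(\<phi> has_derivative ?D) (at (x - t *\<^sub>R ?e))" by (rule differentiable_has_derivative[OF diff])
    have "((\<lambda>t. x - t *\<^sub>R ?e) has_derivative (\<lambda>v. - (v *\<^sub>R ?e))) (at t)"
      by (auto intro!: derivative_eq_intros)
    from has_derivative_compose[OF this D]
    have "((\<lambda>t. \<phi> (x - t *\<^sub>R ?e)) has_derivative (\<lambda>v. ?D (- (v *\<^sub>R ?e)))) (at t)" .
    moreover have "?D (- (v *\<^sub>R ?e)) = v * - partial_deriv i \<phi> (x - t *\<^sub>R ?e)" for v
      using has_derivative_linear[OF D] by (simp add: linear_neg linear_scale partial_deriv_def)
    ultimately have "((\<lambda>t. \<phi> (x - t *\<^sub>R ?e)) has_derivative (\<lambda>v. v * - partial_deriv i \<phi> (x - t *\<^sub>R ?e))) (at t)"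
      by (simp only:)
    then show ?thesis by (simp only: has_field_derivative_def mult_commute_abs)
  qed
  have "\<exists>z>0. z < t \<and> \<phi> (x - t *\<^sub>R ?e) - \<phi> (x - 0 *\<^sub>R ?e) = (t - 0) * - partial_deriv i \<phi> (x - z *\<^sub>R ?e)"
    by (rule MVT2[OF t]) (rule der)
  then obtain z where "0 < z" "z < t" "\<phi> (x - t *\<^sub>R ?e) - \<phi> (x - 0 *\<^sub>R ?e) = (t - 0) * - partial_deriv i \<phi> (x - z *\<^sub>R ?e)"
    by blast
  then show thesis by (intro that[of z]) auto
qed

text \<open>Translation invariance moves the difference quotient from \<open>u\<close> to the test
  function, where it tends to minus the classical derivative under a common bound. On the other side
  the quotients of \<open>u\<close> converge in \<open>L2\<close>, so their pairings with the test
  function converge.\<close>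

lemma L2_limit_weak_partial:
  fixes u g :: "real^'n \<Rightarrow> real"
  assumes u: "u \<in> L2_space" and g: "g \<in> L2_space"
    and conv: "\<And>k. sqn (\<lambda>x. g x - 2 ^ k * fdiff ((1 / 2 ^ k) *\<^sub>R axis i 1) u x) \<le> ennreal ((b k)\<^sup>2)"
    and b: "\<And>k. 0 \<le> b k" "b \<longlonglongrightarrow> 0"
  shows "has_weak_partial i u g"
  unfolding has_weak_partial_def
proof (intro conjI allI impI)
  show lu: "locally_integrable u" and lg: "locally_integrable g"
    using u g by (simp_all add: L2_locally_integrable)
  have [measurable]: "u \<in> borel_measurable borel" "g \<in> borel_measurable borel"
    using u g by (simp_all add: L2_spaceD)
  fix \<phi> :: "real^'n \<Rightarrow> real" assume \<phi>: "test_function \<phi>"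
  obtain B R where B: "0 \<le> B" "\<And>x. \<bar>\<phi> x\<bar> \<le> B * indicator (cball 0 R) x"
    "\<And>x. \<bar>partial_deriv i \<phi> x\<bar> \<le> B * indicator (cball 0 R) x"
    and cont: "continuous_on UNIV \<phi>" "continuous_on UNIV (partial_deriv i \<phi>)" "\<phi> differentiable_on UNIV"
    by (rule test_function_facts[OF \<phi>, of i]) (rule that)
  have [measurable]: "\<phi> \<in> borel_measurable borel" "partial_deriv i \<phi> \<in> borel_measurable borel"
    using cont by (simp_all add: borel_measurable_continuous_onI)
  let ?e = "axis i 1 :: real^'n"
  let ?h = "\<lambda>k::nat. (1 / 2 ^ k) *\<^sub>R ?e"
  let ?w = "\<lambda>k x. 2 ^ k * fdiff (?h k) u x"
  let ?E = "\<lambda>k x. 2 ^ k * (\<phi> (x - ?h k) - \<phi> x)"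
  have Ez: "\<exists>z. 0 < z \<and> z < 1 / 2 ^ k \<and> ?E k x = - partial_deriv i \<phi> (x - z *\<^sub>R ?e)" for k x
  proof -
    obtain z where "0 < z" "z < 1 / 2 ^ k" "\<phi> (x - ?h k) - \<phi> x = - (1 / 2 ^ k) * partial_deriv i \<phi> (x - z *\<^sub>R ?e)"
      by (rule difference_quotient_mvt[OF cont(3), of "1 / 2 ^ k" x i]) auto
    then show ?thesis by (intro exI[of _ z]) simp
  qed
  \<comment> \<open>All steps are at most \<open>1\<close>, so enlarging the radius by
    \<open>1\<close> gives a dominating function that does not depend on \<open>k\<close>.\<close>
  have Eb: "\<bar>?E k x\<bar> \<le> B * indicator (cball 0 (R + 1)) x" for k x
  proof -
    obtain z where z: "0 < z" "z < 1 / 2 ^ k" "?E k x = - partial_deriv i \<phi> (x - z *\<^sub>R ?e)" using Ez by blast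
    have "(1::real) / 2 ^ k \<le> 1" by simp
    then have "z \<le> 1" using z by linarith
    then have "norm x \<le> norm (x - z *\<^sub>R ?e) + 1"
      using norm_triangle_ineq[of "x - z *\<^sub>R ?e" "z *\<^sub>R ?e"] z by simp
    then have "indicator (cball 0 R) (x - z *\<^sub>R ?e) \<le> (indicator (cball 0 (R + 1)) x :: real)"
      by (auto simp: indicator_def)
    then have "B * indicator (cball 0 R) (x - z *\<^sub>R ?e) \<le> B * indicator (cball 0 (R + 1)) x"
      using B(1) by (rule mult_left_mono)
    then show ?thesis using B(3)[of "x - z *\<^sub>R ?e"] z(3) by simp
  qed
  have El: "(\<lambda>k. ?E k x) \<longlonglongrightarrow> - partial_deriv i \<phi> x" for x
  proof -
    have "\<exists>z. \<forall>k. 0 < z k \<and> z k < 1 / 2 ^ k \<and> ?E k x = - partial_deriv i \<phi> (x - z k *\<^sub>R ?e)"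
      by (intro choice allI Ez)
    then obtain z where z: "0 < z k" "z k < 1 / 2 ^ k" "?E k x = - partial_deriv i \<phi> (x - z k *\<^sub>R ?e)" for k
      by blast
    have "(\<lambda>k. (1 / 2) ^ k) \<longlonglongrightarrow> (0::real)" by (rule LIMSEQ_realpow_zero) auto
    then have "(\<lambda>k. 1 / 2 ^ k) \<longlonglongrightarrow> (0::real)" by (simp add: power_one_over)
    then have "z \<longlonglongrightarrow> 0"
    proof (rule Lim_null_comparison[rotated])
      show "\<forall>\<^sub>F k in sequentially. norm (z k) \<le> 1 / 2 ^ k"
        using z(1,2) by (intro always_eventually) (simp add: less_imp_le abs_of_pos)
    qed
    then have "(\<lambda>k. x - z k *\<^sub>R ?e) \<longlonglongrightarrow> x - 0 *\<^sub>R ?e" by (intro tendsto_intros)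
    moreover have "isCont (partial_deriv i \<phi>) x" using cont(2) by (simp add: continuous_on_eq_continuous_at)
    ultimately have "(\<lambda>k. partial_deriv i \<phi> (x - z k *\<^sub>R ?e)) \<longlonglongrightarrow> partial_deriv i \<phi> x"
      by (intro isCont_tendsto_compose[of x "partial_deriv i \<phi>"]) simp_all
    then show ?thesis unfolding z(3) by (rule tendsto_minus)
  qed
  have Em [measurable]: "?E k \<in> borel_measurable borel" for k by measurable
  have parts: "L2_pairing (?w k) \<phi> = L2_pairing u (?E k)" for k
  proof -
    have i1: "integrable lborel (\<lambda>x. u x * \<phi> x)" by (rule test_function_integrable[OF lu \<phi>])
    have "integrable lborel (\<lambda>x. u x * ?E k x)"
      by (rule locally_integrable_mult_bounded[OF lu Em compact_cball Eb])
    \<comment> \<open>Integrability of \<open>u\<close> against the translated test function is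
      recovered by solving the definition of \<open>?E k\<close> for it.\<close>
    then have "integrable lborel (\<lambda>x. (1 / 2 ^ k) * (u x * ?E k x) + u x * \<phi> x)"
      using i1 by (intro Bochner_Integration.integrable_add integrable_mult_right)
    then have i2: "integrable lborel (\<lambda>x. u x * \<phi> (x - ?h k))" by (simp add: algebra_simps)
    have s: "(\<integral>x. u (x + ?h k) * \<phi> x \<partial>lborel) = (\<integral>x. u x * \<phi> (x - ?h k) \<partial>lborel)"
      and i3: "integrable lborel (\<lambda>x. u (x + ?h k) * \<phi> x)"
      using lborel_integral_shift[OF i2, of "?h k"] by simp_all
    have "L2_pairing (?w k) \<phi> = (\<integral>x. 2 ^ k * (u (x + ?h k) * \<phi> x - u x * \<phi> x) \<partial>lborel)"
      unfolding L2_pairing_def fdiff_def by (simp add: algebra_simps)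
    also have "\<dots> = 2 ^ k * ((\<integral>x. u x * \<phi> (x - ?h k) \<partial>lborel) - (\<integral>x. u x * \<phi> x \<partial>lborel))"
      using i1 i3 s by simp
    also have "\<dots> = (\<integral>x. 2 ^ k * (u x * \<phi> (x - ?h k) - u x * \<phi> x) \<partial>lborel)"
      using i1 i2 by simp
    also have "\<dots> = L2_pairing u (?E k)"
      unfolding L2_pairing_def by (simp add: algebra_simps)
    finally show ?thesis .
  qed
  have Im: "(\<lambda>x::real^'n. B * indicator (cball 0 (R + 1)) x) \<in> borel_measurable borel"
    by (intro borel_measurable_times borel_measurable_const borel_measurable_indicator) auto
  have "(\<lambda>k. L2_pairing u (?E k)) \<longlonglongrightarrow> (\<integral>x. u x * - partial_deriv i \<phi> x \<partial>lborel)"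
    unfolding L2_pairing_def
  proof (rule integral_dominated_convergence[where w = "\<lambda>x. \<bar>u x * (B * indicator (cball 0 (R + 1)) x)\<bar>"])
    show "integrable lborel (\<lambda>x. \<bar>u x * (B * indicator (cball 0 (R + 1)) x)\<bar>)"
      using B(1) by (intro integrable_abs locally_integrable_mult_bounded[OF lu Im compact_cball[of 0 "R + 1"], of B]) auto
    show "AE x in lborel. (\<lambda>k. u x * ?E k x) \<longlonglongrightarrow> u x * - partial_deriv i \<phi> x"
      by (intro AE_I2 tendsto_mult_left El)
    show "AE x in lborel. norm (u x * ?E k x) \<le> \<bar>u x * (B * indicator (cball 0 (R + 1)) x)\<bar>" for k
    proof (rule AE_I2)
      fix x
      have "\<bar>u x\<bar> * \<bar>?E k x\<bar> \<le> \<bar>u x\<bar> * \<bar>B * indicator (cball 0 (R + 1)) x\<bar>"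
        using Eb[of k x] by (intro mult_left_mono) auto
      then show "norm (u x * ?E k x) \<le> \<bar>u x * (B * indicator (cball 0 (R + 1)) x)\<bar>"
        by (simp only: real_norm_def abs_mult)
    qed
  qed measurable
  then have lim1: "(\<lambda>k. L2_pairing (?w k) \<phi>) \<longlonglongrightarrow> - L2_pairing u (partial_deriv i \<phi>)"
    unfolding parts by (simp add: L2_pairing_def)
  have \<phi>L2: "\<phi> \<in> L2_space"
  proof -
    have "integrable lborel (\<lambda>x::real^'n. B\<^sup>2 * indicator (cball 0 R) x :: real)"
      using emeasure_compact_finite[OF compact_cball[of "0::real^'n" R]] by (intro integrable_mult_right integrable_real_indicator) auto
    then have "integrable lborel (\<lambda>x. (\<phi> x)\<^sup>2)"
    proof (rule Bochner_Integration.integrable_bound)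
      show "AE x in lborel. norm ((\<phi> x)\<^sup>2) \<le> norm (B\<^sup>2 * indicator (cball 0 R) x)"
      proof (rule AE_I2)
        fix x
        have "\<bar>\<phi> x\<bar>\<^sup>2 \<le> (B * indicator (cball 0 R) x)\<^sup>2" using B(2)[of x] by (intro power_mono) auto
        then show "norm ((\<phi> x)\<^sup>2) \<le> norm (B\<^sup>2 * indicator (cball 0 R) x)"
          by (auto simp: indicator_def)
      qed
    qed measurable
    then show ?thesis by (simp add: L2_space_def)
  qed
  have lim2: "(\<lambda>k. L2_pairing (?w k) \<phi>) \<longlonglongrightarrow> L2_pairing g \<phi>"
  proof (rule Lim_null_comparison[THEN Lim_null[THEN iffD2]])
    show "(\<lambda>k. b k * L2_norm \<phi>) \<longlonglongrightarrow> 0" using tendsto_mult_right[OF b(2), of "L2_norm \<phi>"] by simp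
    show "\<forall>\<^sub>F k in sequentially. norm (L2_pairing (?w k) \<phi> - L2_pairing g \<phi>) \<le> b k * L2_norm \<phi>"
    proof (rule always_eventually, rule allI)
      fix k
      let ?d = "\<lambda>x. g x - ?w k x"
      have dm: "?d \<in> borel_measurable borel" by measurable
      have dL2: "?d \<in> L2_space" unfolding L2_space_iff
        using dm le_less_trans[OF conv[of k] ennreal_less_top] by simp
      have "fdiff (?h k) u \<in> L2_space"
        using u sqn_fdiff_le[of u "?h k"] by (auto simp: L2_space_iff ennreal_mult_less_top intro: le_less_trans)
      then have wL2: "?w k \<in> L2_space"
        by (simp add: L2_space_iff sqn_cmult ennreal_mult_less_top)
      have "L2_pairing (?w k) \<phi> - L2_pairing g \<phi> = - L2_pairing ?d \<phi>"
        using L2_space_integrable_mult[OF wL2 \<phi>L2] L2_space_integrable_mult[OF g \<phi>L2]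
        unfolding L2_pairing_def left_diff_distrib by (subst Bochner_Integration.integral_diff) auto
      then have "norm (L2_pairing (?w k) \<phi> - L2_pairing g \<phi>) \<le> L2_norm ?d * L2_norm \<phi>"
        using L2_Cauchy_Schwarz[OF dL2 \<phi>L2] by simp
      also have "\<dots> \<le> b k * L2_norm \<phi>"
        by (intro mult_right_mono L2_norm_le[OF dm conv b(1)]) simp
      finally show "norm (L2_pairing (?w k) \<phi> - L2_pairing g \<phi>) \<le> b k * L2_norm \<phi>" .
    qed
  qed
  show "L2_pairing u (partial_deriv i \<phi>) = - L2_pairing g \<phi>"
    using LIMSEQ_unique[OF lim1 lim2] by simp
qed

text \<open>For \<open>|h| \<le> 1\<close> the comparison with difference quotients applies; for
  longer increments the trivial bound by \<open>4 * L2_norm g\<close> suffices, because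
  \<open>|h| powr (r - 1) \<ge> 1\<close>.\<close>

lemma weak_partial_exists:
  fixes u :: "real^'n \<Rightarrow> real"
  assumes u: "u \<in> L2_space" and r: "1 < r" "r < 2" and M: "0 \<le> M"
    and le: "\<And>h. h \<noteq> 0 \<Longrightarrow> L2_norm (fdiff h (fdiff h u)) \<le> M * norm h powr r"
  defines "N \<equiv> 32 * (M / (1 - 2 powr (1 - r)) + M + L2_norm u)"
  obtains g where "has_weak_partial i u g" "g \<in> L2_space" "L2_norm g \<le> N"
    "\<And>h. h \<noteq> 0 \<Longrightarrow> L2_norm (fdiff h (fdiff h g)) \<le> N * norm h powr (r - 1)"
proof -
  let ?e = "axis i 1 :: real^'n"
  let ?q = "2 powr (1 - r)"
  define B where "B = M / (1 - ?q)"
  have e: "norm ?e = 1" by simp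
  have q: "0 < ?q" "?q < 1" using r by (auto simp: powr_less_one)
  have B: "0 \<le> B" using M q by (simp add: B_def)
  have um [measurable]: "u \<in> borel_measurable borel" using u by (rule L2_spaceD)
  have fd4: "fdiff h v \<in> L2_space" if "v \<in> L2_space" for h and v :: "real^'n \<Rightarrow> real"
    using that sqn_fdiff_le[of v h] by (auto simp: L2_space_iff fdiff_measurable ennreal_mult_less_top intro: le_less_trans)
  have le': "sqn (fdiff h (fdiff h u)) \<le> ennreal ((M * norm h powr r)\<^sup>2)" if "h \<noteq> 0" for h
    unfolding sqn_eq_L2_norm[OF fd4[OF fd4[OF u]]] using le[OF that] by (intro ennreal_leI power_mono) auto
  obtain g where gm [measurable]: "g \<in> borel_measurable borel" and
    g: "\<And>k. sqn (\<lambda>x. g x - 2 ^ k * fdiff ((1 / 2 ^ k) *\<^sub>R ?e) u x) \<le> ennreal ((M * ?q ^ k / (1 - ?q))\<^sup>2)"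
    using difference_quotients_converge[OF um e r(1) M le'] by blast
  have gB: "sqn (\<lambda>x. g x - 2 ^ k * fdiff ((1 / 2 ^ k) *\<^sub>R ?e) u x) \<le> ennreal ((B * ?q ^ k)\<^sup>2)" for k
    using g[of k] by (simp add: B_def)
  have "sqn g \<le> 2 * sqn (\<lambda>x. g x - fdiff ?e u x) + 2 * sqn (fdiff ?e u)"
    by (rule sqn_le_add) auto
  also have "\<dots> \<le> 2 * ennreal (B\<^sup>2) + 2 * (4 * ennreal ((L2_norm u)\<^sup>2))"
    using gB[of 0] sqn_fdiff_le[OF um, of ?e] sqn_eq_L2_norm[OF u] by (intro add_mono mult_left_mono) auto
  also have "\<dots> = ennreal (2 * B\<^sup>2 + 8 * (L2_norm u)\<^sup>2)"
    by (simp add: ennreal_mult' flip: mult.assoc)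
  also have "\<dots> \<le> ennreal ((3 * (B + L2_norm u))\<^sup>2)"
  proof (rule ennreal_leI)
    have "0 \<le> B * L2_norm u" using B by simp
    then show "2 * B\<^sup>2 + 8 * (L2_norm u)\<^sup>2 \<le> (3 * (B + L2_norm u))\<^sup>2"
      by (simp add: power2_eq_square algebra_simps)
  qed
  finally have sg: "sqn g \<le> ennreal ((3 * (B + L2_norm u))\<^sup>2)" .
  have gL2: "g \<in> L2_space" using gm le_less_trans[OF sg ennreal_less_top] by (simp add: L2_space_iff)
  define U where "U = L2_norm u"
  have U: "0 \<le> U" by (simp add: U_def)
  have gn: "L2_norm g \<le> 3 * (B + U)" unfolding U_def using B by (intro L2_norm_le gm sg) auto
  \<comment> \<open>The factor \<open>32\<close> absorbs \<open>3\<close> from the norm of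
    \<open>g\<close>, \<open>12\<close> from long increments, and \<open>sqrt (32 * 16)\<close> from
    short ones, where \<open>r < 2\<close> gives \<open>2 powr r \<le> 4\<close>.\<close>
  have N: "N = 32 * (B + M + U)" by (simp add: N_def B_def U_def)
  show thesis
  proof (rule that)
    have "(\<lambda>k. ?q ^ k) \<longlonglongrightarrow> 0" using q by (intro LIMSEQ_realpow_zero) auto
    then have "(\<lambda>k. B * ?q ^ k) \<longlonglongrightarrow> 0" using tendsto_mult_left[of "\<lambda>k. ?q ^ k" 0 sequentially B] by simp
    then show "has_weak_partial i u g"
      using B by (intro L2_limit_weak_partial[OF u gL2 gB]) auto
    show "g \<in> L2_space" by (rule gL2)
    have BU: "3 * (B + U) \<le> 32 * (B + M + U)" "4 * (3 * (B + U)) \<le> 32 * (B + M + U)"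
      using B M U by auto
    show "L2_norm g \<le> N" unfolding N by (rule order_trans[OF gn BU(1)])
    fix h :: "real^'n" assume h: "h \<noteq> 0"
    show "L2_norm (fdiff h (fdiff h g)) \<le> N * norm h powr (r - 1)"
    proof (cases "norm h \<le> 1")
      case True
      have "sqn (fdiff h (fdiff h g)) \<le> ennreal (32 * (B\<^sup>2 + M\<^sup>2) * (2 powr r * norm h powr (r - 1))\<^sup>2)"
        by (rule derivative_second_difference[OF um gm e r(1) M B le' gB h True])
      also have "\<dots> \<le> ennreal ((N * norm h powr (r - 1))\<^sup>2)"
      proof (rule ennreal_leI)
        have "2 powr r \<le> 2 powr 2" using r by (intro powr_mono) auto
        then have "(2 powr r)\<^sup>2 \<le> (4::real)\<^sup>2" by (intro power_mono) (simp_all add: powr_numeral)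
        then have p: "(2 powr r)\<^sup>2 \<le> (16::real)" by simp
        have "32 * (B\<^sup>2 + M\<^sup>2) * (2 powr r)\<^sup>2 \<le> 32 * (B\<^sup>2 + M\<^sup>2) * 16"
          by (intro mult_left_mono p) auto
        also have "\<dots> \<le> 32\<^sup>2 * (B + M)\<^sup>2" using B M by (simp add: power2_sum)
        also have "\<dots> = (32 * (B + M))\<^sup>2" by (rule power_mult_distrib[symmetric])
        also have "\<dots> \<le> N\<^sup>2" unfolding N using B M U by (intro power_mono) auto
        finally have "32 * (B\<^sup>2 + M\<^sup>2) * (2 powr r)\<^sup>2 * (norm h powr (r - 1))\<^sup>2 \<le> N\<^sup>2 * (norm h powr (r - 1))\<^sup>2"
          by (intro mult_right_mono) auto
        then show "32 * (B\<^sup>2 + M\<^sup>2) * (2 powr r * norm h powr (r - 1))\<^sup>2 \<le> (N * norm h powr (r - 1))\<^sup>2"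
          by (simp add: power_mult_distrib mult.assoc)
      qed
      finally show ?thesis using B M U unfolding N by (intro L2_norm_le fdiff_measurable gm) auto
    next
      case False
      have "sqn (fdiff h (fdiff h g)) \<le> 16 * sqn g" by (rule sqn_fdiff_fdiff_le[OF gm])
      also have "\<dots> = ennreal ((4 * L2_norm g)\<^sup>2)"
        unfolding sqn_eq_L2_norm[OF gL2] by (simp add: power_mult_distrib ennreal_mult')
      finally have "L2_norm (fdiff h (fdiff h g)) \<le> 4 * L2_norm g"
        by (intro L2_norm_le fdiff_measurable gm) auto
      also have "\<dots> \<le> 4 * (3 * (B + U))" using gn by simp
      also have "\<dots> \<le> N * 1" unfolding N using BU(2) by simp
      also have "\<dots> \<le> N * norm h powr (r - 1)"
        using False r B M U unfolding N by (intro mult_left_mono ge_one_powr_ge_zero) auto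
      finally show ?thesis .
    qed
  qed
qed

section \<open>Besov regularity\<close>

lemma L2_norm_cong_AE:
  fixes v w :: "real^'n \<Rightarrow> real"
  assumes "AE x in lborel. v x = w x" "v \<in> borel_measurable borel" "w \<in> borel_measurable borel"
  shows "L2_norm v = L2_norm w"
proof -
  have "(\<integral>x. (norm (v x))\<^sup>2 \<partial>lborel) = (\<integral>x. (norm (w x))\<^sup>2 \<partial>lborel)"
    using assms by (intro integral_cong_AE) auto
  then show ?thesis by (simp add: L2_norm_def)
qed

lemma besov_norm_le:
  fixes v :: "real^'n \<Rightarrow> real"
  assumes r: "r \<le> 1" and A: "0 \<le> A" and v: "L2_norm v \<le> A"
    and d: "\<And>h. h \<noteq> 0 \<Longrightarrow> L2_norm (fdiff h (fdiff h v)) \<le> A * norm h powr r"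
  shows "besov_norm r v \<le> ennreal (2 * A)"
proof -
  have "(SUP h\<in>-{0}. ennreal (norm h powr (-r) * L2_norm (second_difference h v))) \<le> ennreal A"
  proof (rule SUP_least)
    fix h :: "real^'n" assume "h \<in> -{0}"
    then have h: "h \<noteq> 0" by simp
    have "norm h powr (-r) * L2_norm (second_difference h v) \<le> norm h powr (-r) * (A * norm h powr r)"
      unfolding second_difference_eq using d[OF h] by (intro mult_left_mono) auto
    also have "\<dots> = A" using h by (simp add: powr_minus)
    finally show "ennreal (norm h powr (-r) * L2_norm (second_difference h v)) \<le> ennreal A" by (rule ennreal_leI)
  qed
  moreover have "ennreal (L2_norm v) \<le> ennreal A" using v by (rule ennreal_leI)
  moreover have "ennreal (2 * A) = ennreal A + ennreal A" using A by (simp flip: ennreal_plus)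
  ultimately show ?thesis
    using r by (subst besov_norm.simps) (simp add: add_mono)
qed

text \<open>For \<open>r \<le> 1\<close> the hypothesis is the Besov condition itself; for
  \<open>1 < r < 2\<close> a single step of the recursion leads to the order
  \<open>r - 1 < 1\<close>. The absolute value lets one formula serve both ranges.\<close>

lemma besov_regularity_of_second_difference:
  fixes u :: "real^'n \<Rightarrow> real"
  assumes u: "u \<in> L2_space" and r: "0 < r" "r < 2" and A: "0 \<le> A" and uA: "L2_norm u \<le> A"
    and d: "\<And>h. h \<noteq> 0 \<Longrightarrow> L2_norm (fdiff h (fdiff h u)) \<le> A * norm h powr r"
  shows "u \<in> besov_space r \<and> besov_norm r u
    \<le> ennreal ((2 + real CARD('n) * (64 / \<bar>1 - 2 powr (1 - r)\<bar> + 128)) * A)"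
proof (cases "r \<le> 1")
  case True
  have "besov_norm r u \<le> ennreal (2 * A)" by (rule besov_norm_le[OF True A uA d])
  \<comment> \<open>For \<open>r = 1\<close> the quotient is \<open>64 / 0 = 0\<close>, which leaves
    the inequality valid.\<close>
  also have "\<dots> \<le> ennreal ((2 + real CARD('n) * (64 / \<bar>1 - 2 powr (1 - r)\<bar> + 128)) * A)"
    using A by (intro ennreal_leI mult_right_mono) auto
  finally have le: "besov_norm r u \<le> ennreal ((2 + real CARD('n) * (64 / \<bar>1 - 2 powr (1 - r)\<bar> + 128)) * A)" .
  then have "besov_norm r u < \<infinity>" using le_less_trans[OF le ennreal_less_top] by simp
  then show ?thesis using le u True by (simp add: besov_space.simps[of r])
next
  case False
  then have r1: "1 < r" by simp
  let ?q = "2 powr (1 - r)"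
  have q: "?q < 1" using r1 by (simp add: powr_less_one)
  define N where "N = 32 * (A / (1 - ?q) + A + L2_norm u)"
  have N: "0 \<le> N" using A q by (simp add: N_def)
  have ex: "\<exists>g. has_weak_partial i u g \<and> g \<in> L2_space \<and> besov_norm (r - 1) g \<le> ennreal (2 * N)" for i
  proof -
    obtain g where g: "has_weak_partial i u g" "g \<in> L2_space" "L2_norm g \<le> N"
      "\<And>h. h \<noteq> 0 \<Longrightarrow> L2_norm (fdiff h (fdiff h g)) \<le> N * norm h powr (r - 1)"
      using weak_partial_exists[OF u r1 r(2) A d, of i] unfolding N_def by blast
    then show ?thesis using besov_norm_le[OF _ N g(3,4)] r by auto
  qed
  have mem: "u \<in> besov_space r"
  proof -
    have "\<exists>g\<in>besov_space (r - 1). has_weak_partial i u g" for i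
    proof -
      obtain g where g: "has_weak_partial i u g" "g \<in> L2_space" "besov_norm (r - 1) g \<le> ennreal (2 * N)"
        using ex by blast
      have "g \<in> besov_space (r - 1)"
        using g(2) r le_less_trans[OF g(3) ennreal_less_top] by (simp add: besov_space.simps[of "r - 1"])
      then show ?thesis using g(1) by blast
    qed
    then show ?thesis using u r1 by (simp add: besov_space.simps[of r])
  qed
  have part: "besov_norm (r - 1) (weak_partial i u) \<le> ennreal (2 * N)" for i
  proof -
    obtain g where g: "has_weak_partial i u g" "besov_norm (r - 1) g \<le> ennreal (2 * N)"
      using ex by blast
    have w: "has_weak_partial i u (weak_partial i u)"
      unfolding weak_partial_def by (rule someI[of "has_weak_partial i u", OF g(1)])
    have ae: "AE x in lborel. weak_partial i u x = g x" by (rule has_weak_partial_unique[OF w g(1)])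
    have m: "weak_partial i u \<in> borel_measurable borel" "g \<in> borel_measurable borel"
      using w g(1) by (auto simp: has_weak_partial_def intro: locally_integrable_measurable)
    have "L2_norm (weak_partial i u) = L2_norm g" by (rule L2_norm_cong_AE[OF ae m])
    moreover have "L2_norm (second_difference h (weak_partial i u)) = L2_norm (second_difference h g)" for h
      unfolding second_difference_eq
      by (intro L2_norm_cong_AE fdiff_cong_AE ae fdiff_measurable m)
    ultimately have "besov_norm (r - 1) (weak_partial i u) = besov_norm (r - 1) g"
      using r by (simp add: besov_norm.simps[of "r - 1"])
    then show ?thesis using g(2) by simp
  qed
  have "besov_norm r u = ennreal (L2_norm u) + (\<Sum>i\<in>UNIV. besov_norm (r - 1) (weak_partial i u))"
    using r1 by (subst besov_norm.simps) simp
  also have "\<dots> \<le> ennreal A + (\<Sum>i\<in>(UNIV::'n set). ennreal (2 * N))"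
    by (intro add_mono sum_mono part ennreal_leI uA)
  also have "\<dots> = ennreal (A + real CARD('n) * (2 * N))"
    using A N by (simp add: ennreal_mult ennreal_of_nat_eq_real_of_nat)
  also have "\<dots> \<le> ennreal ((2 + real CARD('n) * (64 / \<bar>1 - ?q\<bar> + 128)) * A)"
  proof (rule ennreal_leI)
    \<comment> \<open>\<open>2 * N\<close> is \<open>64\<close> times the sum of
      \<open>A / (1 - ?q)\<close>, \<open>A\<close> and \<open>L2_norm u\<close>, and the last is at
      most \<open>A\<close>.\<close>
    have "2 * N \<le> (64 / \<bar>1 - ?q\<bar> + 128) * A"
      using uA q by (simp add: N_def algebra_simps)
    then have "real CARD('n) * (2 * N) \<le> real CARD('n) * ((64 / \<bar>1 - ?q\<bar> + 128) * A)"
      by (intro mult_left_mono) auto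
    then show "A + real CARD('n) * (2 * N) \<le> (2 + real CARD('n) * (64 / \<bar>1 - ?q\<bar> + 128)) * A"
      using A by (simp only: distrib_right mult.assoc)
  qed
  finally show ?thesis using mem by blast
qed

theorem theorem3:
  shows "\<exists>C :: real \<Rightarrow> real \<Rightarrow> real \<Rightarrow> real \<Rightarrow> real.
    \<forall>s \<rho> \<theta>. \<forall>\<Omega> :: (real^'n) set. \<forall>f u.
      0 < s \<and> s < 1 \<and> open \<Omega> \<and> bounded \<Omega> \<and>
      0 < \<rho> \<and> 0 < \<theta> \<and> \<theta> < pi / 2 \<and> lipschitz_cone_condition \<rho> \<theta> \<Omega> \<and>
      f \<in> L2_space \<and> weak_solution s \<Omega> f u
      \<longrightarrow> u \<in> besov_space (3 * s / 2) \<and>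
          besov_norm (3 * s / 2) u
            \<le> ennreal (C s (diameter \<Omega>) \<rho> \<theta> * sqrt (Hdual_norm s f) * sqrt (L2_norm f))"
proof -
  \<comment> \<open>All solutions on all domains of diameter \<open>d\<close> share the constant
    \<open>c\<close> in \<open>P\<close>, so \<open>C\<close> can be chosen for each tuple of real
    parameters; the dimension enters through the type.\<close>
  define P where "P s d \<rho> \<theta> c \<longleftrightarrow> (\<forall>\<Omega> :: (real^'n) set. \<forall>f u.
      bounded \<Omega> \<and> diameter \<Omega> = d \<and> lipschitz_cone_condition \<rho> \<theta> \<Omega> \<and> f \<in> L2_space \<and> weak_solution s \<Omega> f u
      \<longrightarrow> u \<in> besov_space (3 * s / 2) \<and>
          besov_norm (3 * s / 2) u \<le> ennreal (c * sqrt (Hdual_norm s f) * sqrt (L2_norm f)))" for s d \<rho> \<theta> c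
  have ex: "\<exists>c. P s d \<rho> \<theta> c" if s: "0 < s" "s < 1" and \<rho>: "0 < \<rho>" and \<theta>: "0 < \<theta>" "\<theta> < pi / 2" for s d \<rho> \<theta>
  proof -
    obtain A where A: "0 \<le> A"
      "\<And>\<Omega> f (u :: real^'n \<Rightarrow> real). bounded \<Omega> \<Longrightarrow> diameter \<Omega> = d \<Longrightarrow> lipschitz_cone_condition \<rho> \<theta> \<Omega> \<Longrightarrow>
        f \<in> L2_space \<Longrightarrow> weak_solution s \<Omega> f u \<Longrightarrow>
        L2_norm u \<le> A * sqrt (Hdual_norm s f * L2_norm f) \<and>
        (\<forall>h. h \<noteq> 0 \<longrightarrow> L2_norm (fdiff h (fdiff h u)) \<le> A * norm h powr (3 * s / 2) * sqrt (Hdual_norm s f * L2_norm f))"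
      using second_difference_estimate[OF s \<theta> \<rho>, where d = d and 'n = 'n] by blast
    let ?K = "2 + real CARD('n) * (64 / \<bar>1 - 2 powr (1 - 3 * s / 2)\<bar> + 128)"
    have "P s d \<rho> \<theta> (?K * A)"
      unfolding P_def
    proof (intro allI impI, elim conjE)
      fix \<Omega> :: "(real^'n) set" and f u
      assume \<Omega>: "bounded \<Omega>" "diameter \<Omega> = d" "lipschitz_cone_condition \<rho> \<theta> \<Omega>"
        and f: "f \<in> L2_space" and u: "weak_solution s \<Omega> f u"
      let ?X = "sqrt (Hdual_norm s f * L2_norm f)"
      have uL2: "u \<in> L2_space" using u by (auto simp: weak_solution_def X0_space_def Hs_spaceD)
      have X: "0 \<le> ?X" using Hdual_norm_bounds(1)[OF f, of s] by simp
      have dA: "L2_norm (fdiff h (fdiff h u)) \<le> (A * ?X) * norm h powr (3 * s / 2)" if "h \<noteq> 0" for h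
        using A(2)[OF \<Omega> f u] that by (auto simp: mult_ac)
      have uA: "L2_norm u \<le> A * ?X" using A(2)[OF \<Omega> f u] by simp
      have "u \<in> besov_space (3 * s / 2) \<and> besov_norm (3 * s / 2) u \<le> ennreal (?K * (A * ?X))"
        by (rule besov_regularity_of_second_difference[OF uL2 _ _ _ uA dA]) (use s A X in auto)
      moreover have "?K * (A * ?X) = ?K * A * sqrt (Hdual_norm s f) * sqrt (L2_norm f)"
        by (simp add: real_sqrt_mult mult_ac)
      ultimately show "u \<in> besov_space (3 * s / 2) \<and>
          besov_norm (3 * s / 2) u \<le> ennreal (?K * A * sqrt (Hdual_norm s f) * sqrt (L2_norm f))" by simp
    qed
    then show ?thesis by blast
  qed
  show ?thesis
  proof (rule exI[of _ "\<lambda>s d \<rho> \<theta>. SOME c. P s d \<rho> \<theta> c"], intro allI impI, elim conjE)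
    fix s \<rho> \<theta> :: real and \<Omega> :: "(real^'n) set" and f u
    assume a: "0 < s" "s < 1" "0 < \<rho>" "0 < \<theta>" "\<theta> < pi / 2"
      and b: "bounded \<Omega>" "lipschitz_cone_condition \<rho> \<theta> \<Omega>" "f \<in> L2_space" "weak_solution s \<Omega> f u"
    have "P s (diameter \<Omega>) \<rho> \<theta> (SOME c. P s (diameter \<Omega>) \<rho> \<theta> c)"
      by (rule someI_ex[OF ex[OF a]])
    then show "u \<in> besov_space (3 * s / 2) \<and> besov_norm (3 * s / 2) u
      \<le> ennreal ((SOME c. P s (diameter \<Omega>) \<rho> \<theta> c) * sqrt (Hdual_norm s f) * sqrt (L2_norm f))"
      using b unfolding P_def by blast
  qed
qed

end
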